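(* Let $\Bbbk$ be a field and let $W=\Bbbk[t](x,y,\sigma,h)$ be a quantum generalized Weyl algebra of degree one with $|\sigma|=n<\infty$ ($|\sigma|$ the order of $\sigma$). Let $Z=Z(W)$ be the center of $W$. Then the $\mathcal R$-discriminant and the $\overline{\mathcal R}$-discriminant of $W$ over $Z$ exist and $$\varrho(W/Z)=_{Z^\times}t^{n^2(n-1)},\qquad \bar\varrho(W/Z)=_{W^\times}t^{n^2(n-1)}.$$
   Context: Let $R$ be a ring, $\sigma\in\mathrm{Aut}(R)$, and $h$ a nonzero central element of $R$. The degree one generalized Weyl algebra (GWA) $R(x,y,\sigma,h)$ is generated over $R$ by $x,y$ with relations $xy=h$, $yx=\sigma^{-1}(h)$, $xr=\sigma(r)x$, $yr=\sigma^{-1}(r)y$ for all $r\in R$. It is quantum if $R=\Bbbk[t]$ and $\sigma$ is the $\Bbbk$-algebra automorphism with $\sigma(t)=qt$ for some $q\in\Bbbk^\times$. Discriminant notions: let $R$ be a commutative domain that is a central subalgebra of a prime algebra $B$ with $B$ a finitely generated $R$-module. Let $F$ be the fraction field of $R$, $B_F=B\otimes_RF$, $w=\dim_FB_F$. The regular trace $\mathrm{tr}:B\to F$ sends $b$ to the trace of left multiplication by $b$ on $B_F$; it is required that $\mathrm{tr}(B)\subseteq R$. $\mathrm{MD}(B/R)$ is the ideal of $R$ generated by all $\det\big(\mathrm{tr}(u_iu_j')\big)_{i,j=1}^w$, where $\{u_i\}_{i=1}^w,\{u_i'\}_{i=1}^w$ range over all $w$-element subsets of $B$. For an $R$-module $M$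 put $M^\vee=\mathrm{Hom}_R(M,R)$; $M$ is reflexive if the natural map $M\to M^{\vee\vee}$ is an isomorphism. For an ideal $I$ of $R$, $I^{\vee\vee}$ is viewed as an ideal of $R$ containing $I$; if $B$ is reflexive over $R$ and $M$ is an ideal of $B$, $M^{\vee\vee}$ is viewed as an ideal of $B=B^{\vee\vee}$ containing $M$. An element $d\in R$ is an $\mathcal R$-discriminant, denoted $\varrho(B/R)$, if $\mathrm{MD}(B/R)^{\vee\vee}=dR$. If $B$ is reflexive over $R$, a normal element $d\in B$ (i.e. $dB=Bd$) is an $\overline{\mathcal R}$-discriminant, denoted $\bar\varrho(B/R)$, if $(\mathrm{MD}(B/R)B)^{\vee\vee}=dB$. These are unique up to units of $R$, resp. $B$. For a ring $S$, $f=_{S^\times}g$ means $f=cg$ for some unit $c\in S^\times$. *)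

theory Defs
  imports
    "HOL-Algebra.Bij"
    "HOL-Algebra.Free_Abelian_Groups"
    "HOL-Algebra.Ideal_Product"
    "HOL-Algebra.Multiplicative_Group"
    "HOL-Algebra.Subrings"
    "HOL-Combinatorics.Permutations"
    "HOL-Computational_Algebra.Polynomial"
    "Jordan_Normal_Form.Missing_VectorSpace"
begin

section \<open>Generalized Weyl algebras of degree one\<close>

definition ring_automorphism :: "('r::ring_1 \<Rightarrow> 'r) \<Rightarrow> bool" where
  "ring_automorphism \<sigma> \<longleftrightarrow> bij \<sigma> \<and> \<sigma> 1 = 1 \<and>
     (\<forall>a b. \<sigma> (a + b) = \<sigma> a + \<sigma> b) \<and> (\<forall>a b. \<sigma> (a * b) = \<sigma> a * \<sigma> b)"

text \<open>
  The ring generated over \<open>R\<close> by \<open>x\<close> and \<open>y\<close> subject to relations is built from all ring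
  expressions in \<open>x\<close>, \<open>y\<close> and constants from \<open>R\<close>, modulo the least congruence that contains the
  ring axioms, makes \<open>Const\<close> a unital ring homomorphism, and contains the relations.
\<close>

datatype 'r gwa_term =
    Const 'r
  | GenX
  | GenY
  | Plus "'r gwa_term" "'r gwa_term"
  | Neg "'r gwa_term"
  | Times "'r gwa_term" "'r gwa_term"

inductive gwa_eq :: "('r::ring_1 \<Rightarrow> 'r) \<Rightarrow> 'r \<Rightarrow> 'r gwa_term \<Rightarrow> 'r gwa_term \<Rightarrow> bool"
  for \<sigma> :: "'r::ring_1 \<Rightarrow> 'r" and h :: 'r
where
  refl: "gwa_eq \<sigma> h u u"
| sym: "gwa_eq \<sigma> h u v \<Longrightarrow> gwa_eq \<sigma> h v u"
| trans: "gwa_eq \<sigma> h u v \<Longrightarrow> gwa_eq \<sigma> h v w \<Longrightarrow> gwa_eq \<sigma> h u w"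
| cong_plus: "gwa_eq \<sigma> h u u' \<Longrightarrow> gwa_eq \<sigma> h v v' \<Longrightarrow> gwa_eq \<sigma> h (Plus u v) (Plus u' v')"
| cong_neg: "gwa_eq \<sigma> h u u' \<Longrightarrow> gwa_eq \<sigma> h (Neg u) (Neg u')"
| cong_times: "gwa_eq \<sigma> h u u' \<Longrightarrow> gwa_eq \<sigma> h v v' \<Longrightarrow> gwa_eq \<sigma> h (Times u v) (Times u' v')"
| plus_assoc: "gwa_eq \<sigma> h (Plus (Plus u v) w) (Plus u (Plus v w))"
| plus_comm: "gwa_eq \<sigma> h (Plus u v) (Plus v u)"
| plus_zero: "gwa_eq \<sigma> h (Plus (Const 0) u) u"
| plus_neg: "gwa_eq \<sigma> h (Plus (Neg u) u) (Const 0)"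
| times_assoc: "gwa_eq \<sigma> h (Times (Times u v) w) (Times u (Times v w))"
| times_one_left: "gwa_eq \<sigma> h (Times (Const 1) u) u"
| times_one_right: "gwa_eq \<sigma> h (Times u (Const 1)) u"
| distrib_left: "gwa_eq \<sigma> h (Times u (Plus v w)) (Plus (Times u v) (Times u w))"
| distrib_right: "gwa_eq \<sigma> h (Times (Plus u v) w) (Plus (Times u w) (Times v w))"
| const_plus: "gwa_eq \<sigma> h (Plus (Const a) (Const b)) (Const (a + b))"
| const_times: "gwa_eq \<sigma> h (Times (Const a) (Const b)) (Const (a * b))"
| x_y: "gwa_eq \<sigma> h (Times GenX GenY) (Const h)"
| y_x: "gwa_eq \<sigma> h (Times GenY GenX) (Const (inv_into UNIV \<sigma> h))"
| x_const: "gwa_eq \<sigma> h (Times GenX (Const r)) (Times (Const (\<sigma> r)) GenX)"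
| y_const: "gwa_eq \<sigma> h (Times GenY (Const r)) (Times (Const (inv_into UNIV \<sigma> r)) GenY)"

definition gwa_class :: "('r::ring_1 \<Rightarrow> 'r) \<Rightarrow> 'r \<Rightarrow> 'r gwa_term \<Rightarrow> 'r gwa_term set" where
  "gwa_class \<sigma> h u = {v. gwa_eq \<sigma> h u v}"

definition gwa :: "('r::ring_1 \<Rightarrow> 'r) \<Rightarrow> 'r \<Rightarrow> 'r gwa_term set ring" where
  "gwa \<sigma> h = \<lparr>
     carrier = range (gwa_class \<sigma> h),
     monoid.mult = (\<lambda>A B. \<Union>u\<in>A. \<Union>v\<in>B. gwa_class \<sigma> h (Times u v)),
     one = gwa_class \<sigma> h (Const 1),
     zero = gwa_class \<sigma> h (Const 0),
     add = (\<lambda>A B. \<Union>u\<in>A. \<Union>v\<in>B. gwa_class \<sigma> h (Plus u v))\<rparr>"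

definition quantum_automorphism :: "'k::field \<Rightarrow> ('k poly \<Rightarrow> 'k poly) \<Rightarrow> bool" where
  "quantum_automorphism q \<sigma> \<longleftrightarrow> q \<noteq> 0 \<and> ring_automorphism \<sigma> \<and>
     (\<forall>c. \<sigma> [:c:] = [:c:]) \<and> \<sigma> [:0, 1:] = [:0, q:]"

section \<open>Rings and modules\<close>

definition ring_center :: "('b, 'm) ring_scheme \<Rightarrow> 'b set" where
  "ring_center B = {z \<in> carrier B. \<forall>b \<in> carrier B. z \<otimes>\<^bsub>B\<^esub> b = b \<otimes>\<^bsub>B\<^esub> z}"

definition prime_ring :: "('b, 'm) ring_scheme \<Rightarrow> bool" where
  "prime_ring B \<longleftrightarrow> ring B \<and> \<one>\<^bsub>B\<^esub> \<noteq> \<zero>\<^bsub>B\<^esub> \<and>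
     (\<forall>a \<in> carrier B. \<forall>b \<in> carrier B.
        (\<forall>x \<in> carrier B. a \<otimes>\<^bsub>B\<^esub> x \<otimes>\<^bsub>B\<^esub> b = \<zero>\<^bsub>B\<^esub>) \<longrightarrow> a = \<zero>\<^bsub>B\<^esub> \<or> b = \<zero>\<^bsub>B\<^esub>)"

text \<open>\<open>B\<close> as a module over any of its central subrings; \<open>mult_module R\<close> is \<open>R\<close> over itself.\<close>

definition mult_module :: "('b, 'm) ring_scheme \<Rightarrow> ('b, 'b) module" where
  "mult_module B = \<lparr>carrier = carrier B, monoid.mult = monoid.mult B, one = one B,
     zero = zero B, add = add B, module.smult = monoid.mult B\<rparr>"

text \<open>
  Maps are restricted to be \<^const>\<open>undefined\<close> off the module, so that equality of functions is
  equality of homomorphisms. The multiplicative fields of the record play no role in a module.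
\<close>

definition dual :: "('r, 'a) ring_scheme \<Rightarrow> ('r, 'm, 'c) module_scheme \<Rightarrow> ('r, 'm \<Rightarrow> 'r) module" where
  "dual R M = \<lparr>
     carrier = module_hom R M (mult_module R) \<inter> extensional (carrier M),
     monoid.mult = undefined, one = undefined,
     zero = (\<lambda>m \<in> carrier M. \<zero>\<^bsub>R\<^esub>),
     add = (\<lambda>f g. \<lambda>m \<in> carrier M. f m \<oplus>\<^bsub>R\<^esub> g m),
     module.smult = (\<lambda>r f. \<lambda>m \<in> carrier M. r \<otimes>\<^bsub>R\<^esub> f m)\<rparr>"

definition reflexive_module :: "('r, 'a) ring_scheme \<Rightarrow> ('r, 'm, 'c) module_scheme \<Rightarrow> bool" where
  "reflexive_module R M \<longleftrightarrow>
     bij_betw (\<lambda>m. \<lambda>\<phi> \<in> carrier (dual R M). \<phi> m) (carrier M) (carrier (dual R (dual R M)))"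

text \<open>
  For a submodule \<open>M\<close> of a reflexive module \<open>N\<close>: the image of \<open>M\<^sup>\<or>\<^sup>\<or>\<close> in \<open>N\<close> under
  \<open>M\<^sup>\<or>\<^sup>\<or> \<rightarrow> N\<^sup>\<or>\<^sup>\<or> \<cong> N\<close>. The first map is the bidual of the inclusion; it sends \<open>\<xi>\<close> to
  \<open>\<phi> \<mapsto> \<xi> (\<phi> restricted to M)\<close>.
\<close>

definition bidual_in ::
  "('r, 'a) ring_scheme \<Rightarrow> ('r, 'm, 'c) module_scheme \<Rightarrow> 'm set \<Rightarrow> 'm set" where
  "bidual_in R N M = {n \<in> carrier N. \<exists>\<xi> \<in> carrier (dual R (dual R (N\<lparr>carrier := M\<rparr>))).
     \<forall>\<phi> \<in> carrier (dual R N). \<xi> (restrict \<phi> M) = \<phi> n}"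

section \<open>Fraction field and extension of scalars\<close>

definition fraction_rel :: "('r, 'a) ring_scheme \<Rightarrow> (('r \<times> 'r) \<times> ('r \<times> 'r)) set" where
  "fraction_rel R = {((a, s), (b, t)).
     a \<in> carrier R \<and> b \<in> carrier R \<and> s \<in> carrier R - {\<zero>\<^bsub>R\<^esub>} \<and> t \<in> carrier R - {\<zero>\<^bsub>R\<^esub>} \<and>
     a \<otimes>\<^bsub>R\<^esub> t = b \<otimes>\<^bsub>R\<^esub> s}"

definition fraction :: "('r, 'a) ring_scheme \<Rightarrow> 'r \<Rightarrow> 'r \<Rightarrow> ('r \<times> 'r) set" where
  "fraction R a s = fraction_rel R `` {(a, s)}"

definition fraction_field :: "('r, 'a) ring_scheme \<Rightarrow> ('r \<times> 'r) set ring" where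
  "fraction_field R = \<lparr>
     carrier = (carrier R \<times> (carrier R - {\<zero>\<^bsub>R\<^esub>})) // fraction_rel R,
     monoid.mult = (\<lambda>P Q. \<Union>(a, s)\<in>P. \<Union>(b, t)\<in>Q. fraction R (a \<otimes>\<^bsub>R\<^esub> b) (s \<otimes>\<^bsub>R\<^esub> t)),
     one = fraction R \<one>\<^bsub>R\<^esub> \<one>\<^bsub>R\<^esub>,
     zero = fraction R \<zero>\<^bsub>R\<^esub> \<one>\<^bsub>R\<^esub>,
     add = (\<lambda>P Q. \<Union>(a, s)\<in>P. \<Union>(b, t)\<in>Q.
              fraction R (a \<otimes>\<^bsub>R\<^esub> t \<oplus>\<^bsub>R\<^esub> b \<otimes>\<^bsub>R\<^esub> s) (s \<otimes>\<^bsub>R\<^esub> t))\<rparr>"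

definition fraction_module :: "('r, 'a) ring_scheme \<Rightarrow> ('r, ('r \<times> 'r) set) module" where
  "fraction_module R = \<lparr>carrier = carrier (fraction_field R),
     monoid.mult = monoid.mult (fraction_field R), one = one (fraction_field R),
     zero = zero (fraction_field R), add = add (fraction_field R),
     module.smult = (\<lambda>r P. fraction R r \<one>\<^bsub>R\<^esub> \<otimes>\<^bsub>fraction_field R\<^esub> P)\<rparr>"

definition tensor_relations ::
  "('r, 'a) ring_scheme \<Rightarrow> ('r, 'm, 'c) module_scheme \<Rightarrow> ('r, 'n, 'd) module_scheme
     \<Rightarrow> ('m \<times> 'n \<Rightarrow>\<^sub>0 int) set" where
  "tensor_relations R M N =
     {frag_of (m \<oplus>\<^bsub>M\<^esub> m', n) - frag_of (m, n) - frag_of (m', n) | m m' n.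
        m \<in> carrier M \<and> m' \<in> carrier M \<and> n \<in> carrier N}
   \<union> {frag_of (m, n \<oplus>\<^bsub>N\<^esub> n') - frag_of (m, n) - frag_of (m, n') | m n n'.
        m \<in> carrier M \<and> n \<in> carrier N \<and> n' \<in> carrier N}
   \<union> {frag_of (r \<odot>\<^bsub>M\<^esub> m, n) - frag_of (m, r \<odot>\<^bsub>N\<^esub> n) | r m n.
        r \<in> carrier R \<and> m \<in> carrier M \<and> n \<in> carrier N}"

definition tensor_kernel ::
  "('r, 'a) ring_scheme \<Rightarrow> ('r, 'm, 'c) module_scheme \<Rightarrow> ('r, 'n, 'd) module_scheme
     \<Rightarrow> ('m \<times> 'n \<Rightarrow>\<^sub>0 int) set" where
  "tensor_kernel R M N =
     generate (free_Abelian_group (carrier M \<times> carrier N)) (tensor_relations R M N)"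

definition tensor_product ::
  "('r, 'a) ring_scheme \<Rightarrow> ('r, 'm, 'c) module_scheme \<Rightarrow> ('r, 'n, 'd) module_scheme
     \<Rightarrow> ('m \<times> 'n \<Rightarrow>\<^sub>0 int) set monoid" where
  "tensor_product R M N = free_Abelian_group (carrier M \<times> carrier N) Mod tensor_kernel R M N"

text \<open>The endomorphism \<open>f \<otimes> g\<close> of \<open>M \<otimes>\<^sub>R N\<close>, for \<open>R\<close>-linear \<open>f : M \<rightarrow> M\<close> and \<open>g : N \<rightarrow> N\<close>.\<close>

definition tensor_map ::
  "('r, 'a) ring_scheme \<Rightarrow> ('r, 'm, 'c) module_scheme \<Rightarrow> ('r, 'n, 'd) module_scheme
     \<Rightarrow> ('m \<Rightarrow> 'm) \<Rightarrow> ('n \<Rightarrow> 'n) \<Rightarrow> ('m \<times> 'n \<Rightarrow>\<^sub>0 int) set \<Rightarrow> ('m \<times> 'n \<Rightarrow>\<^sub>0 int) set" where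
  "tensor_map R M N f g T = (\<Union>c\<in>T.
     tensor_kernel R M N #>\<^bsub>free_Abelian_group (carrier M \<times> carrier N)\<^esub>
       frag_extend (\<lambda>(m, n). frag_of (f m, g n)) c)"

text \<open>\<open>M \<otimes>\<^sub>R F\<close> as a vector space over the fraction field \<open>F\<close> of \<open>R\<close>.\<close>

definition extend_scalars ::
  "('r, 'a) ring_scheme \<Rightarrow> ('r, 'm, 'c) module_scheme
     \<Rightarrow> (('r \<times> 'r) set, ('m \<times> ('r \<times> 'r) set \<Rightarrow>\<^sub>0 int) set) module" where
  "extend_scalars R M = \<lparr>
     carrier = carrier (tensor_product R M (fraction_module R)),
     monoid.mult = undefined, one = undefined,
     zero = one (tensor_product R M (fraction_module R)),
     add = monoid.mult (tensor_product R M (fraction_module R)),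
     module.smult = (\<lambda>P. tensor_map R M (fraction_module R) id (\<lambda>Q. P \<otimes>\<^bsub>fraction_field R\<^esub> Q))\<rparr>"

section \<open>Regular trace\<close>

text \<open>Trace of a linear endomorphism of a finite-dimensional space, read off from any basis \<open>A\<close>;
  \<open>c v\<close> is the coordinate vector of \<open>\<phi> v\<close>.\<close>

definition endo_trace :: "('f, 'a) ring_scheme \<Rightarrow> ('f, 'v, 'c) module_scheme \<Rightarrow> ('v \<Rightarrow> 'v) \<Rightarrow> 'f" where
  "endo_trace K V \<phi> = (THE \<tau>. \<exists>A c. finite A \<and> vectorspace.basis K V A \<and>
     (\<forall>v \<in> A. c v \<in> A \<rightarrow> carrier K \<and> \<phi> v = module.lincomb V (c v) A) \<and>
     \<tau> = (\<Oplus>\<^bsub>K\<^esub> v\<in>A. c v v))"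

text \<open>In the following, \<open>R\<close> is a central subring of \<open>B\<close>, given by its underlying set.\<close>

definition reg_trace :: "'b ring \<Rightarrow> 'b set \<Rightarrow> 'b \<Rightarrow> ('b \<times> 'b) set" where
  "reg_trace B R b =
     endo_trace (fraction_field (B\<lparr>carrier := R\<rparr>)) (extend_scalars (B\<lparr>carrier := R\<rparr>) (mult_module B))
       (tensor_map (B\<lparr>carrier := R\<rparr>) (mult_module B) (fraction_module (B\<lparr>carrier := R\<rparr>))
          (\<lambda>b'. b \<otimes>\<^bsub>B\<^esub> b') id)"

definition generic_rank :: "'b ring \<Rightarrow> 'b set \<Rightarrow> nat" where
  "generic_rank B R =
     vectorspace.dim (fraction_field (B\<lparr>carrier := R\<rparr>)) (extend_scalars (B\<lparr>carrier := R\<rparr>) (mult_module B))"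

section \<open>Reflexive discriminants\<close>

definition discriminant_setting :: "'b ring \<Rightarrow> 'b set \<Rightarrow> bool" where
  "discriminant_setting B R \<longleftrightarrow> prime_ring B \<and> subdomain R B \<and> R \<subseteq> ring_center B \<and>
     (\<exists>S. finite S \<and> S \<subseteq> carrier B \<and>
        module.span (B\<lparr>carrier := R\<rparr>) (mult_module B) S = carrier B) \<and>
     (\<forall>b \<in> carrier B. \<exists>r \<in> R. reg_trace B R b = fraction (B\<lparr>carrier := R\<rparr>) r \<one>\<^bsub>B\<^esub>)"

definition ring_det :: "('f, 'a) ring_scheme \<Rightarrow> nat \<Rightarrow> (nat \<Rightarrow> nat \<Rightarrow> 'f) \<Rightarrow> 'f" where
  "ring_det K w a = (\<Oplus>\<^bsub>K\<^esub> p\<in>{p. p permutes {..<w}}.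
     (if evenperm p then \<one>\<^bsub>K\<^esub> else \<ominus>\<^bsub>K\<^esub> \<one>\<^bsub>K\<^esub>) \<otimes>\<^bsub>K\<^esub> (\<Otimes>\<^bsub>K\<^esub> i\<in>{..<w}. a i (p i)))"

definition modified_discriminant :: "'b ring \<Rightarrow> 'b set \<Rightarrow> 'b set" where
  "modified_discriminant B R = genideal (B\<lparr>carrier := R\<rparr>)
     {d \<in> R. \<exists>u u'.
        u \<in> {..<generic_rank B R} \<rightarrow> carrier B \<and> inj_on u {..<generic_rank B R} \<and>
        u' \<in> {..<generic_rank B R} \<rightarrow> carrier B \<and> inj_on u' {..<generic_rank B R} \<and>
        fraction (B\<lparr>carrier := R\<rparr>) d \<one>\<^bsub>B\<^esub> =
          ring_det (fraction_field (B\<lparr>carrier := R\<rparr>)) (generic_rank B R)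
            (\<lambda>i j. reg_trace B R (u i \<otimes>\<^bsub>B\<^esub> u' j))}"

definition R_discriminant :: "'b ring \<Rightarrow> 'b set \<Rightarrow> 'b \<Rightarrow> bool" where
  "R_discriminant B R d \<longleftrightarrow> discriminant_setting B R \<and> d \<in> R \<and>
     bidual_in (B\<lparr>carrier := R\<rparr>) (mult_module (B\<lparr>carrier := R\<rparr>)) (modified_discriminant B R)
       = cgenideal (B\<lparr>carrier := R\<rparr>) d"

definition R_bar_discriminant :: "'b ring \<Rightarrow> 'b set \<Rightarrow> 'b \<Rightarrow> bool" where
  "R_bar_discriminant B R d \<longleftrightarrow> discriminant_setting B R \<and>
     reflexive_module (B\<lparr>carrier := R\<rparr>) (mult_module B) \<and>
     d \<in> carrier B \<and> d <#\<^bsub>B\<^esub> carrier B = carrier B #>\<^bsub>B\<^esub> d \<and>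
     bidual_in (B\<lparr>carrier := R\<rparr>) (mult_module B)
       (ideal_prod B (modified_discriminant B R) (carrier B)) = d <#\<^bsub>B\<^esub> carrier B"

definition eq_up_to_unit :: "('s, 'a) ring_scheme \<Rightarrow> 's \<Rightarrow> 's \<Rightarrow> bool" where
  "eq_up_to_unit S f g \<longleftrightarrow> (\<exists>c \<in> Units S. f = c \<otimes>\<^bsub>S\<^esub> g)"

end

theory Submission
  imports
    Defs
    "HOL-Computational_Algebra.Formal_Laurent_Series"
    "HOL-Computational_Algebra.Polynomial_Factorial"
    "Jordan_Normal_Form.Determinant"
begin

text \<open>
  The center of \<open>W\<close> is \<open>Z = k[t\<^sup>n][X, Y]\<close> with \<open>X = x\<^sup>n\<close> and \<open>Y = y\<^sup>n\<close>, where \<open>X Y\<close> is a nonzero element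
  of \<open>k[t\<^sup>n]\<close>. After inverting \<open>X\<close>, the algebra is free over the center on the elements \<open>t\<^sup>i x\<^sup>j\<close> with
  \<open>0 \<le> i, j < n\<close>, the regular trace is \<open>n\<^sup>2\<close> times the projection to the center, and the trace form
  pairs \<open>t\<^sup>i x\<^sup>j\<close> only with \<open>t\<^sup>i\<^sup>' x\<^sup>j\<^sup>'\<close> where \<open>i + i'\<close> and \<open>j + j'\<close> are divisible by \<open>n\<close>. Hence the
  discriminant of this basis is \<open>(t\<^sup>n)\<^sup>m X\<^sup>m\<close> up to a nonzero scalar, with \<open>m = n (n - 1)\<close>. The same holds
  for \<open>Y\<close> and the elements \<open>t\<^sup>i y\<^sup>j\<close>. Reflexive hulls may be computed after inverting \<open>X\<close> and after
  inverting \<open>Y\<close>, because \<open>Y a = X b\<close> implies that \<open>X\<close> divides \<open>a\<close>, in \<open>Z\<close> as well as in \<open>W\<close>. So both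
  hulls are generated by \<open>(t\<^sup>n)\<^sup>m\<close>, which is \<open>t\<close> to the power \<open>n\<^sup>2 (n - 1)\<close>.

  The rings \<open>Z\<close> and \<open>F\<close> and the tensor product are records without a type of their own. An embedding
  of \<open>Z\<close> into the field of Laurent series in \<open>X\<close> over \<open>k(t)\<close> moves computations with traces and
  determinants to a type.
\<close>

section \<open>Fraction fields and extension of scalars\<close>

text \<open>In general neither frame is a basis over \<open>Z\<close>, so no single determinant
  controls the discriminant ideal. The determinant of arbitrary elements is compared with each frame
  separately; clearing the coordinates costs a bounded power of \<open>X\<close>, respectively of
  \<open>Y\<close>, and the two comparisons are glued by the divisibility property. In
  \<open>Z\<close> this property says that \<open>Y\<close> is a nonzerodivisor modulo
  \<open>X\<close>: the quotient by \<open>X\<close> is \<open>k[t^n][Y]\<close> modulo the nonzero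
  element \<open>X Y\<close> of \<open>k[t^n]\<close>. In \<open>W\<close> it is read off from
  coefficients: writing \<open>y\<close> as \<open>x^-1 h\<close>, the coefficient of
  \<open>x^k\<close> is always divisible by a fixed \<open>p k\<close>, and these factors multiply
  under shifts by multiples of \<open>n\<close>. Such coefficients exist only because of a normal
  form. The algebra is a quotient of a term language, where spanning by monomials follows from the
  relations; independence is obtained from an action on sequences. The factor \<open>n^2\<close> of
  the trace has to be nonzero in \<open>k\<close>, which holds because \<open>q\<close> is a
  primitive root of unity of order \<open>n\<close>. The exponent \<open>m\<close> is the number of
  pairs \<open>(i, j)\<close> with \<open>i \<noteq> 0\<close>, and equally the number of those with
  \<open>j \<noteq> 0\<close>.\<close>

locale embedded_domain = cring R for R (structure) +
  fixes \<phi> :: "'a \<Rightarrow> 'l::field"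
  assumes emb_add: "\<lbrakk>a \<in> carrier R; b \<in> carrier R\<rbrakk> \<Longrightarrow> \<phi> (a \<oplus> b) = \<phi> a + \<phi> b"
    and emb_mult: "\<lbrakk>a \<in> carrier R; b \<in> carrier R\<rbrakk> \<Longrightarrow> \<phi> (a \<otimes> b) = \<phi> a * \<phi> b"
    and emb_one: "\<phi> \<one> = 1"
    and emb_inj: "inj_on \<phi> (carrier R)"
begin

abbreviation "F \<equiv> fraction_field R"

lemma emb_zero: "\<phi> \<zero> = 0"
  using emb_add[of \<zero> \<zero>] by (metis add_cancel_left_left l_zero zero_closed)

lemma emb_eq_iff: "\<lbrakk>a \<in> carrier R; b \<in> carrier R\<rbrakk> \<Longrightarrow> \<phi> a = \<phi> b \<longleftrightarrow> a = b"
  using emb_inj by (auto dest: inj_onD)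

lemma emb_eq_0_iff: "a \<in> carrier R \<Longrightarrow> \<phi> a = 0 \<longleftrightarrow> a = \<zero>"
  using emb_eq_iff[of a \<zero>] emb_zero by simp

lemma one_neq_zero: "\<one> \<noteq> \<zero>"
  using emb_one emb_zero by force

lemma emb_a_inv: "a \<in> carrier R \<Longrightarrow> \<phi> (\<ominus> a) = - \<phi> a"
  using emb_add[of a "\<ominus> a"] by (simp add: r_neg emb_zero eq_neg_iff_add_eq_0 add.commute)

lemma emb_finsum: "f \<in> A \<rightarrow> carrier R \<Longrightarrow> \<phi> (finsum R f A) = (\<Sum>x\<in>A. \<phi> (f x))"
proof (induction A rule: infinite_finite_induct)
  case (infinite A)
  then show ?case by (simp add: emb_zero finsum_def finprod_def)
next
  case empty
  then show ?case by (simp add: emb_zero)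
next
  case (insert x A)
  then show ?case by (subst finsum_insert) (auto simp: emb_add Pi_iff)
qed

lemma emb_finprod: "f \<in> A \<rightarrow> carrier R \<Longrightarrow> \<phi> (finprod R f A) = (\<Prod>x\<in>A. \<phi> (f x))"
proof (induction A rule: infinite_finite_induct)
  case (infinite A)
  then show ?case by (simp add: emb_one finprod_def)
next
  case empty
  then show ?case by (simp add: emb_one)
next
  case (insert x A)
  then show ?case by (subst finprod_insert) (auto simp: emb_mult Pi_iff)
qed

lemma emb_pow: "a \<in> carrier R \<Longrightarrow> \<phi> (a [^] (k::nat)) = \<phi> a ^ k"
  by (induction k) (simp_all add: emb_one emb_mult mult.commute)

lemma nonzero_mult: "\<lbrakk>a \<in> carrier R - {\<zero>}; b \<in> carrier R - {\<zero>}\<rbrakk> \<Longrightarrow> a \<otimes> b \<in> carrier R - {\<zero>}"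
  by (auto simp flip: emb_eq_0_iff simp: emb_mult)

lemma fraction_eq:
  assumes "a \<in> carrier R" "s \<in> carrier R - {\<zero>}"
  shows "fraction R a s = {(b, t). b \<in> carrier R \<and> t \<in> carrier R - {\<zero>} \<and> \<phi> b / \<phi> t = \<phi> a / \<phi> s}"
  using assms
  by (auto simp: fraction_def fraction_rel_def frac_eq_eq emb_eq_0_iff simp flip: emb_mult emb_eq_iff)

lemma carrier_F: "carrier F = {fraction R a s | a s. a \<in> carrier R \<and> s \<in> carrier R - {\<zero>}}"
  by (auto simp: fraction_field_def quotient_def fraction_def)

lemma fraction_closed: "\<lbrakk>a \<in> carrier R; s \<in> carrier R - {\<zero>}\<rbrakk> \<Longrightarrow> fraction R a s \<in> carrier F"
  by (auto simp: carrier_F)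

text \<open>The image of a fraction in the field \<open>'l\<close>, computed from an arbitrary
  representative. Since this map turns out to be injective, identities in \<open>F\<close> can be
  checked in \<open>'l\<close>.\<close>

definition val :: "('a \<times> 'a) set \<Rightarrow> 'l" where
  "val P = (let p = SOME p. p \<in> P in \<phi> (fst p) / \<phi> (snd p))"

lemma val_fraction:
  assumes "a \<in> carrier R" "s \<in> carrier R - {\<zero>}"
  shows "val (fraction R a s) = \<phi> a / \<phi> s"
proof -
  have "(a, s) \<in> fraction R a s"
    using assms by (simp add: fraction_eq)
  then have "(SOME p. p \<in> fraction R a s) \<in> fraction R a s"
    by (rule someI)
  then show ?thesis
    using assms by (auto simp: val_def Let_def fraction_eq split_beta)
qed

lemma val_inj: "inj_on val (carrier F)"
proof (rule inj_onI)
  fix P Q assume "P \<in> carrier F" "Q \<in> carrier F" and eq: "val P = val Q"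
  then obtain a s b t where *: "a \<in> carrier R" "s \<in> carrier R - {\<zero>}" "P = fraction R a s"
    "b \<in> carrier R" "t \<in> carrier R - {\<zero>}" "Q = fraction R b t"
    by (auto simp: carrier_F)
  with eq have "\<phi> a / \<phi> s = \<phi> b / \<phi> t"
    by (simp add: val_fraction)
  with * show "P = Q"
    by (simp add: fraction_eq)
qed

lemma val_eq_iff: "\<lbrakk>P \<in> carrier F; Q \<in> carrier F\<rbrakk> \<Longrightarrow> val P = val Q \<longleftrightarrow> P = Q"
  using val_inj by (auto dest: inj_onD)

text \<open>Operations on classes are unions over all representatives; once the result is
  independent of the representatives, the union collapses to it.\<close>

lemma UN_UN_const:
  assumes "x \<in> A" "y \<in> B" "\<And>x y. x \<in> A \<Longrightarrow> y \<in> B \<Longrightarrow> f x y = c"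
  shows "(\<Union>x\<in>A. \<Union>y\<in>B. f x y) = c"
  using assms by blast

lemma fraction_mult:
  assumes "a \<in> carrier R" "s \<in> carrier R - {\<zero>}" "b \<in> carrier R" "t \<in> carrier R - {\<zero>}"
  shows "fraction R a s \<otimes>\<^bsub>F\<^esub> fraction R b t = fraction R (a \<otimes> b) (s \<otimes> t)"
  unfolding fraction_field_def monoid.simps split_beta
proof (rule UN_UN_const)
  show "(a, s) \<in> fraction R a s" "(b, t) \<in> fraction R b t"
    using assms by (simp_all add: fraction_eq)
  fix x y assume xy: "x \<in> fraction R a s" "y \<in> fraction R b t"
  then have "fst x \<in> carrier R" "snd x \<in> carrier R - {\<zero>}" "fst y \<in> carrier R" "snd y \<in> carrier R - {\<zero>}"
      "\<phi> (fst x) / \<phi> (snd x) = \<phi> a / \<phi> s" "\<phi> (fst y) / \<phi> (snd y) = \<phi> b / \<phi> t"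
    using assms by (auto simp: fraction_eq)
  moreover from this have "\<phi> (fst x) * \<phi> (fst y) / (\<phi> (snd x) * \<phi> (snd y)) = \<phi> a * \<phi> b / (\<phi> s * \<phi> t)"
    by (metis times_divide_times_eq)
  ultimately show "fraction R (fst x \<otimes> fst y) (snd x \<otimes> snd y) = fraction R (a \<otimes> b) (s \<otimes> t)"
    using assms nonzero_mult by (simp add: fraction_eq emb_mult)
qed

lemma fraction_add:
  assumes "a \<in> carrier R" "s \<in> carrier R - {\<zero>}" "b \<in> carrier R" "t \<in> carrier R - {\<zero>}"
  shows "fraction R a s \<oplus>\<^bsub>F\<^esub> fraction R b t = fraction R (a \<otimes> t \<oplus> b \<otimes> s) (s \<otimes> t)"
  unfolding fraction_field_def ring_record_simps split_beta
proof (rule UN_UN_const)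
  show "(a, s) \<in> fraction R a s" "(b, t) \<in> fraction R b t"
    using assms by (simp_all add: fraction_eq)
  have *: "\<phi> (a \<otimes> t \<oplus> b \<otimes> s) / \<phi> (s \<otimes> t) = \<phi> a / \<phi> s + \<phi> b / \<phi> t"
    if "a \<in> carrier R" "s \<in> carrier R - {\<zero>}" "b \<in> carrier R" "t \<in> carrier R - {\<zero>}" for a b s t
    using that emb_eq_0_iff by (simp add: emb_mult emb_add add_frac_eq mult.commute)
  fix x y assume xy: "x \<in> fraction R a s" "y \<in> fraction R b t"
  then have "fst x \<in> carrier R" "snd x \<in> carrier R - {\<zero>}" "fst y \<in> carrier R" "snd y \<in> carrier R - {\<zero>}"
      "\<phi> (fst x) / \<phi> (snd x) = \<phi> a / \<phi> s" "\<phi> (fst y) / \<phi> (snd y) = \<phi> b / \<phi> t"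
    using assms by (auto simp: fraction_eq)
  then show "fraction R (fst x \<otimes> snd y \<oplus> fst y \<otimes> snd x) (snd x \<otimes> snd y)
      = fraction R (a \<otimes> t \<oplus> b \<otimes> s) (s \<otimes> t)"
    using assms nonzero_mult by (subst (1 2) fraction_eq) (auto simp: *)
qed

lemma F_carrierE:
  assumes "P \<in> carrier F"
  obtains a s where "a \<in> carrier R" "s \<in> carrier R - {\<zero>}" "P = fraction R a s"
  using assms by (auto simp: carrier_F)

lemma F_mult_closed: "\<lbrakk>P \<in> carrier F; Q \<in> carrier F\<rbrakk> \<Longrightarrow> P \<otimes>\<^bsub>F\<^esub> Q \<in> carrier F"
  by (elim F_carrierE) (simp add: fraction_mult fraction_closed nonzero_mult del: Diff_iff)

lemma F_add_closed: "\<lbrakk>P \<in> carrier F; Q \<in> carrier F\<rbrakk> \<Longrightarrow> P \<oplus>\<^bsub>F\<^esub> Q \<in> carrier F"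
  by (elim F_carrierE) (metis fraction_add fraction_closed nonzero_mult DiffD1 m_closed a_closed)

lemma val_mult: "\<lbrakk>P \<in> carrier F; Q \<in> carrier F\<rbrakk> \<Longrightarrow> val (P \<otimes>\<^bsub>F\<^esub> Q) = val P * val Q"
  by (elim F_carrierE) (use nonzero_mult in \<open>simp add: fraction_mult val_fraction emb_mult\<close>)

lemma val_add: "\<lbrakk>P \<in> carrier F; Q \<in> carrier F\<rbrakk> \<Longrightarrow> val (P \<oplus>\<^bsub>F\<^esub> Q) = val P + val Q"
proof (elim F_carrierE)
  fix a s b t
  assume *: "a \<in> carrier R" "s \<in> carrier R - {\<zero>}" "P = fraction R a s"
    "b \<in> carrier R" "t \<in> carrier R - {\<zero>}" "Q = fraction R b t"
  then have "a \<otimes> t \<oplus> b \<otimes> s \<in> carrier R"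
    by auto
  with * show "val (P \<oplus>\<^bsub>F\<^esub> Q) = val P + val Q"
    using nonzero_mult[of s t]
    by (simp add: fraction_add val_fraction emb_mult emb_add emb_eq_0_iff add_frac_eq mult.commute)
qed

lemma one_nonzero: "\<one> \<in> carrier R - {\<zero>}"
  using one_neq_zero by simp

lemma F_one: "\<one>\<^bsub>F\<^esub> = fraction R \<one> \<one>" and F_zero: "\<zero>\<^bsub>F\<^esub> = fraction R \<zero> \<one>"
  by (simp_all add: fraction_field_def)

lemma F_one_closed: "\<one>\<^bsub>F\<^esub> \<in> carrier F" and F_zero_closed: "\<zero>\<^bsub>F\<^esub> \<in> carrier F"
  using one_nonzero by (simp_all add: F_one F_zero fraction_closed)

lemma val_one: "val \<one>\<^bsub>F\<^esub> = 1" and val_zero: "val \<zero>\<^bsub>F\<^esub> = 0"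
  using one_nonzero by (simp_all add: F_one F_zero val_fraction emb_one emb_zero)

text \<open>Each axiom is an equation between elements of \<open>F\<close>, and \<open>val\<close>
  carries it to the same equation in the field \<open>'l\<close>.\<close>

lemma F_cring: "cring F"
proof (rule cringI)
  show "abelian_group F"
  proof (rule abelian_groupI)
    fix P assume "P \<in> carrier F"
    then obtain a s where *: "a \<in> carrier R" "s \<in> carrier R - {\<zero>}" "P = fraction R a s"
      by (rule F_carrierE)
    then have c: "fraction R (\<ominus> a) s \<in> carrier F"
      by (intro fraction_closed) auto
    with * have "val (fraction R (\<ominus> a) s \<oplus>\<^bsub>F\<^esub> P) = val \<zero>\<^bsub>F\<^esub>"
      by (simp add: val_add val_zero val_fraction emb_a_inv fraction_closed)
    then have "fraction R (\<ominus> a) s \<oplus>\<^bsub>F\<^esub> P = \<zero>\<^bsub>F\<^esub>"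
      using c \<open>P \<in> carrier F\<close> by (subst (asm) val_eq_iff) (auto intro: F_add_closed F_zero_closed)
    with c show "\<exists>Q\<in>carrier F. Q \<oplus>\<^bsub>F\<^esub> P = \<zero>\<^bsub>F\<^esub>"
      by blast
  qed (simp_all add: F_zero_closed F_add_closed val_add val_zero algebra_simps flip: val_eq_iff)
  show "comm_monoid F"
    by (rule comm_monoidI)
      (simp_all add: F_one_closed F_mult_closed val_mult val_one algebra_simps flip: val_eq_iff)
qed (simp_all add: F_add_closed F_mult_closed val_mult val_add algebra_simps flip: val_eq_iff)

lemma F_field: "field F"
proof -
  interpret F: cring F by (rule F_cring)
  show ?thesis
  proof (rule F.cring_fieldI)
    show "Units F = carrier F - {\<zero>\<^bsub>F\<^esub>}"
    proof (intro equalityI subsetI)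
      fix P assume P: "P \<in> Units F"
      then obtain Q where "Q \<in> carrier F" "P \<otimes>\<^bsub>F\<^esub> Q = \<one>\<^bsub>F\<^esub>" "P \<in> carrier F"
        by (auto simp: Units_def)
      moreover from this have "val P * val Q = 1"
        using val_mult val_one by metis
      ultimately show "P \<in> carrier F - {\<zero>\<^bsub>F\<^esub>}"
        using val_zero by auto
    next
      fix P assume P: "P \<in> carrier F - {\<zero>\<^bsub>F\<^esub>}"
      then obtain a s where *: "a \<in> carrier R" "s \<in> carrier R - {\<zero>}" "P = fraction R a s"
        using F_carrierE[of P] by (metis DiffD1)
      with P one_nonzero have a: "a \<in> carrier R - {\<zero>}"
        by (auto simp: F_zero fraction_eq emb_zero)
      then have Q: "fraction R s a \<in> carrier F"
        using * by (intro fraction_closed) auto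
      have "val (P \<otimes>\<^bsub>F\<^esub> fraction R s a) = val \<one>\<^bsub>F\<^esub>"
        using P Q * a by (simp add: val_mult val_one val_fraction emb_eq_0_iff)
      then have "P \<otimes>\<^bsub>F\<^esub> fraction R s a = \<one>\<^bsub>F\<^esub>"
        using P Q by (subst (asm) val_eq_iff) auto
      then show "P \<in> Units F"
        unfolding Units_def using P Q F.m_comm by blast
    qed
  qed
qed

text \<open>Makes the facts about an embedded ring applicable to \<open>F\<close> itself, as used
  for traces and determinants with entries in \<open>F\<close>.\<close>

lemma embedded_F: "embedded_domain F val"
proof -
  interpret F: cring F by (rule F_cring)
  show ?thesis
    by unfold_locales (simp_all add: val_add val_mult val_one val_inj)
qed

end

section \<open>Evaluation of formal integer combinations\<close>

definition frag_eval :: "('x \<Rightarrow> 'l::comm_ring_1) \<Rightarrow> ('x \<Rightarrow>\<^sub>0 int) \<Rightarrow> 'l" where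
  "frag_eval g c = (\<Sum>x\<in>Poly_Mapping.keys c. of_int (Poly_Mapping.lookup c x) * g x)"

lemma frag_eval_superset:
  assumes "finite A" "Poly_Mapping.keys c \<subseteq> A"
  shows "frag_eval g c = (\<Sum>x\<in>A. of_int (Poly_Mapping.lookup c x) * g x)"
  unfolding frag_eval_def using assms by (intro sum.mono_neutral_left) (auto simp: in_keys_iff)

lemma frag_eval_0 [simp]: "frag_eval g 0 = 0"
  and frag_eval_of [simp]: "frag_eval g (frag_of x) = g x"
  by (simp_all add: frag_eval_def)

lemma frag_eval_diff: "frag_eval g (c - d) = frag_eval g c - frag_eval g d"
proof -
  let ?A = "Poly_Mapping.keys c \<union> Poly_Mapping.keys d"
  have "frag_eval g (c - d) = (\<Sum>x\<in>?A. of_int (Poly_Mapping.lookup (c - d) x) * g x)"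
    by (rule frag_eval_superset) (auto simp: keys_diff)
  also have "\<dots> = (\<Sum>x\<in>?A. of_int (Poly_Mapping.lookup c x) * g x)
      - (\<Sum>x\<in>?A. of_int (Poly_Mapping.lookup d x) * g x)"
    by (simp add: lookup_minus algebra_simps sum_subtractf)
  also have "\<dots> = frag_eval g c - frag_eval g d"
    by (simp add: frag_eval_superset[of ?A])
  finally show ?thesis .
qed

lemma frag_eval_add: "frag_eval g (c + d) = frag_eval g c + frag_eval g d"
  using frag_eval_diff[of g "c + d" d] by simp

section \<open>Extension of scalars to the fraction field as a vector space\<close>

locale embedded_module = embedded_domain R \<phi> + module R M
  for R :: "('a, 'q) ring_scheme" (structure) and \<phi> :: "'a \<Rightarrow> 'l::field"
    and M :: "('a, 'b, 'c) module_scheme" (structure)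
begin

abbreviation "N \<equiv> fraction_module R"
abbreviation "S \<equiv> carrier M \<times> carrier F"
abbreviation "G \<equiv> free_Abelian_group S"
abbreviation "Kn \<equiv> tensor_kernel R M N"
abbreviation "V \<equiv> extend_scalars R M"
abbreviation "cls c \<equiv> Kn #>\<^bsub>G\<^esub> c"
abbreviation "ext f g \<equiv> frag_extend (\<lambda>(m, n). frag_of (f m, g n))"

lemma N_simps [simp]: "carrier N = carrier F" "add N = add F"
  "module.smult N = (\<lambda>r P. fraction R r \<one> \<otimes>\<^bsub>F\<^esub> P)"
  by (simp_all add: fraction_module_def)

sublocale F: field F
  by (rule F_field)

lemma frac1_closed [simp]: "r \<in> carrier R \<Longrightarrow> fraction R r \<one> \<in> carrier F"
  using one_nonzero by (simp add: fraction_closed)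

lemma tensor_relationsE:
  assumes "x \<in> tensor_relations R M N"
  obtains m m' n where "m \<in> carrier M" "m' \<in> carrier M" "n \<in> carrier F"
      "x = frag_of (m \<oplus>\<^bsub>M\<^esub> m', n) - frag_of (m, n) - frag_of (m', n)"
    | m n n' where "m \<in> carrier M" "n \<in> carrier F" "n' \<in> carrier F"
      "x = frag_of (m, n \<oplus>\<^bsub>F\<^esub> n') - frag_of (m, n) - frag_of (m, n')"
    | r m n where "r \<in> carrier R" "m \<in> carrier M" "n \<in> carrier F"
      "x = frag_of (r \<odot>\<^bsub>M\<^esub> m, n) - frag_of (m, fraction R r \<one> \<otimes>\<^bsub>F\<^esub> n)"
  using assms unfolding tensor_relations_def N_simps
  by (elim UnE CollectE exE conjE) (rule that; assumption)+

lemma relations_closed: "tensor_relations R M N \<subseteq> carrier G"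
proof
  fix x assume "x \<in> tensor_relations R M N"
  moreover have 1: "Poly_Mapping.keys (a - b - c) \<subseteq> S"
    if "Poly_Mapping.keys a \<subseteq> S" "Poly_Mapping.keys b \<subseteq> S" "Poly_Mapping.keys c \<subseteq> S"
    for a b c :: "'b \<times> ('a \<times> 'a) set \<Rightarrow>\<^sub>0 int"
    using that keys_diff[of "a - b" c] keys_diff[of a b] by blast
  moreover have 2: "Poly_Mapping.keys (a - b) \<subseteq> S"
    if "Poly_Mapping.keys a \<subseteq> S" "Poly_Mapping.keys b \<subseteq> S"
    for a b :: "'b \<times> ('a \<times> 'a) set \<Rightarrow>\<^sub>0 int"
    using that keys_diff[of a b] by blast
  ultimately show "x \<in> carrier G"
    unfolding tensor_relations_def carrier_free_Abelian_group_iff N_simps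
    by (elim UnE CollectE exE conjE; hypsubst; intro 1 2; simp)
qed

lemma Kn_subgroup: "subgroup Kn G"
  unfolding tensor_kernel_def N_simps
  by (rule group.generate_is_subgroup) (use relations_closed in auto)

lemma Kn_carrier: "c \<in> Kn \<Longrightarrow> Poly_Mapping.keys c \<subseteq> S"
  using subgroup.subset[OF Kn_subgroup] by (auto simp: subset_iff)

lemma Kn_0: "0 \<in> Kn"
  using subgroup.one_closed[OF Kn_subgroup] by simp

lemma Kn_add: "\<lbrakk>c \<in> Kn; d \<in> Kn\<rbrakk> \<Longrightarrow> c + d \<in> Kn"
  using subgroup.m_closed[OF Kn_subgroup] by simp

lemma Kn_uminus: "c \<in> Kn \<Longrightarrow> - c \<in> Kn"
  using subgroup.m_inv_closed[OF Kn_subgroup, of c] Kn_carrier[of c] by simp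

lemma Kn_diff: "\<lbrakk>c \<in> Kn; d \<in> Kn\<rbrakk> \<Longrightarrow> c - d \<in> Kn"
  using Kn_add[of c "- d"] Kn_uminus[of d] by simp

lemma Kn_rel: "x \<in> tensor_relations R M N \<Longrightarrow> x \<in> Kn"
  unfolding tensor_kernel_def by (rule generate.incl)

lemma Kn_rel_simps:
  "\<lbrakk>m \<in> carrier M; m' \<in> carrier M; n \<in> carrier F\<rbrakk>
    \<Longrightarrow> frag_of (m \<oplus>\<^bsub>M\<^esub> m', n) - frag_of (m, n) - frag_of (m', n) \<in> Kn"
  "\<lbrakk>m \<in> carrier M; n \<in> carrier F; n' \<in> carrier F\<rbrakk>
    \<Longrightarrow> frag_of (m, n \<oplus>\<^bsub>F\<^esub> n') - frag_of (m, n) - frag_of (m, n') \<in> Kn"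
  "\<lbrakk>r \<in> carrier R; m \<in> carrier M; n \<in> carrier F\<rbrakk>
    \<Longrightarrow> frag_of (r \<odot>\<^bsub>M\<^esub> m, n) - frag_of (m, fraction R r \<one> \<otimes>\<^bsub>F\<^esub> n) \<in> Kn"
  by (rule Kn_rel, unfold tensor_relations_def N_simps, blast)+

text \<open>Differences suffice: subtracting from zero gives inverses, and subtracting an inverse
  gives sums, so a property closed under differences passes from the relations to the subgroup that
  they generate.\<close>

lemma Kn_induct [consumes 1, case_names zero rel diff]:
  assumes "c \<in> Kn" "P 0" "\<And>x. x \<in> tensor_relations R M N \<Longrightarrow> P x"
    "\<And>x y. \<lbrakk>x \<in> Kn; y \<in> Kn; P x; P y\<rbrakk> \<Longrightarrow> P (x - y)"
  shows "P c"
proof -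
  have *: "P (- x)" if "x \<in> Kn" "P x" for x
    using assms(4)[OF Kn_0 that(1) assms(2) that(2)] by simp
  have "c \<in> generate G (tensor_relations R M N)"
    using assms(1) by (simp add: tensor_kernel_def)
  then show ?thesis
  proof induction
    case one then show ?case using assms(2) by simp
  next
    case (incl h) then show ?case using assms(3) by simp
  next
    case (inv h)
    then have "h \<in> Kn" by (rule Kn_rel)
    then show ?case
      using *[of h] assms(3)[OF inv] Kn_carrier[of h] by simp
  next
    case (eng h1 h2)
    then have "h1 \<in> Kn" "h2 \<in> Kn" by (simp_all add: tensor_kernel_def)
    then show ?case
      using assms(4)[of h1 "- h2"] *[of h2] eng Kn_uminus[of h2] by simp
  qed
qed

lemma cls_def: "cls c = {k + c | k. k \<in> Kn}"
  by (auto simp: r_coset_def)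

lemma cls_self: "c \<in> cls c"
  using Kn_0 by (auto simp: cls_def)

lemma cls_eq_iff: "cls c = cls d \<longleftrightarrow> c - d \<in> Kn"
proof
  assume "cls c = cls d"
  then obtain k where "k \<in> Kn" "c = k + d"
    using cls_self[of c] by (auto simp: cls_def)
  then show "c - d \<in> Kn" by simp
next
  assume *: "c - d \<in> Kn"
  show "cls c = cls d"
  proof (intro equalityI subsetI)
    fix x assume "x \<in> cls c"
    then obtain k where "k \<in> Kn" "x = k + c" by (auto simp: cls_def)
    then show "x \<in> cls d"
      using Kn_add[OF _ *, of k] by (simp add: cls_def) (metis add.assoc diff_add_cancel)
  next
    fix x assume "x \<in> cls d"
    then obtain k where "k \<in> Kn" "x = k + d" by (auto simp: cls_def)
    then show "x \<in> cls c"
      using Kn_diff[OF _ *, of k] by (simp add: cls_def) (metis add.assoc diff_add_cancel)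
  qed
qed

lemma mem_cls_iff: "d \<in> cls c \<longleftrightarrow> cls d = cls c"
  unfolding cls_eq_iff by (auto simp: cls_def) (metis diff_add_cancel)

lemma carrier_V: "carrier V = cls ` {c. Poly_Mapping.keys c \<subseteq> S}"
  by (force simp: extend_scalars_def tensor_product_def carrier_FactGroup)

lemma cls_closed: "Poly_Mapping.keys c \<subseteq> S \<Longrightarrow> cls c \<in> carrier V"
  by (auto simp: carrier_V)

lemma V_carrierE:
  assumes "T \<in> carrier V"
  obtains c where "Poly_Mapping.keys c \<subseteq> S" "T = cls c"
  using assms by (auto simp: carrier_V)

lemma V_zero: "\<zero>\<^bsub>V\<^esub> = cls 0"
  by (simp add: extend_scalars_def tensor_product_def cls_def)

lemma V_add: "cls c \<oplus>\<^bsub>V\<^esub> cls d = cls (c + d)"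
proof -
  have "cls c \<oplus>\<^bsub>V\<^esub> cls d = {x + y | x y. x \<in> cls c \<and> y \<in> cls d}"
    by (auto simp: extend_scalars_def tensor_product_def set_mult_def)
  also have "\<dots> = cls (c + d)"
  proof (intro equalityI subsetI)
    fix z assume "z \<in> {x + y | x y. x \<in> cls c \<and> y \<in> cls d}"
    then obtain k l where "k \<in> Kn" "l \<in> Kn" "z = (k + c) + (l + d)"
      by (auto simp: cls_def)
    moreover from this have "z = (k + l) + (c + d)"
      by (simp add: algebra_simps)
    ultimately show "z \<in> cls (c + d)"
      using Kn_add[of k l] unfolding cls_def by blast
  next
    fix z assume "z \<in> cls (c + d)"
    then obtain k where "k \<in> Kn" "z = (k + c) + (0 + d)"
      by (auto simp: cls_def algebra_simps)
    then show "z \<in> {x + y | x y. x \<in> cls c \<and> y \<in> cls d}"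
      using Kn_0 unfolding cls_def by blast
  qed
  finally show ?thesis .
qed

lemma ext_closed:
  assumes "f \<in> carrier M \<rightarrow> carrier M" "g \<in> carrier F \<rightarrow> carrier F" "Poly_Mapping.keys c \<subseteq> S"
  shows "Poly_Mapping.keys (ext f g c) \<subseteq> S"
proof -
  have "Poly_Mapping.keys (ext f g c) \<subseteq> (\<Union>x\<in>Poly_Mapping.keys c. Poly_Mapping.keys (case x of (m, n) \<Rightarrow> frag_of (f m, g n)))"
    by (rule keys_frag_extend)
  also have "\<dots> \<subseteq> S"
    using assms by (auto simp: Pi_iff)
  finally show ?thesis .
qed

text \<open>Linear maps send each defining relation of the tensor product to a relation of the same
  kind, so the map between formal combinations descends to classes.\<close>

lemma ext_kernel:
  assumes f: "f \<in> module_hom R M M" and g: "g \<in> module_hom R N N" and c: "c \<in> Kn"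
  shows "ext f g c \<in> Kn"
  using c
proof (induction rule: Kn_induct)
  case zero then show ?case by (simp add: Kn_0)
next
  case (diff x y) then show ?case by (simp add: frag_extend_diff Kn_diff)
next
  case (rel x)
  then show ?case
    using f g unfolding tensor_relations_def module_hom_def
    by (auto simp: frag_extend_diff Pi_iff intro!: Kn_rel_simps)
qed

lemma tensor_map_cls:
  assumes f: "f \<in> module_hom R M M" and g: "g \<in> module_hom R N N"
  shows "tensor_map R M N f g (cls c) = cls (ext f g c)"
proof -
  have *: "cls (ext f g d) = cls (ext f g c)" if "d \<in> cls c" for d
    using that ext_kernel[OF f g, of "d - c"] by (auto simp: mem_cls_iff cls_eq_iff frag_extend_diff)
  then show ?thesis
    unfolding tensor_map_def N_simps using cls_self[of c] by blast
qed

lemma id_hom: "id \<in> module_hom R M M" "id \<in> module_hom R N N"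
  by (auto simp: module_hom_def)

lemma frac_mult_hom: "P \<in> carrier F \<Longrightarrow> (\<lambda>Q. P \<otimes>\<^bsub>F\<^esub> Q) \<in> module_hom R N N"
  by (auto simp: module_hom_def F.r_distr F.m_lcomm)

lemma V_smult: "P \<in> carrier F \<Longrightarrow> P \<odot>\<^bsub>V\<^esub> cls c = cls (ext id (\<lambda>Q. P \<otimes>\<^bsub>F\<^esub> Q) c)"
  using tensor_map_cls[OF id_hom(1) frac_mult_hom] by (simp add: extend_scalars_def)

lemma ext_frac_closed:
  "\<lbrakk>P \<in> carrier F; Poly_Mapping.keys c \<subseteq> S\<rbrakk> \<Longrightarrow> Poly_Mapping.keys (ext id (\<lambda>Q. P \<otimes>\<^bsub>F\<^esub> Q) c) \<subseteq> S"
  by (rule ext_closed) auto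

lemma V_smult_closed:
  assumes "P \<in> carrier F" "T \<in> carrier V"
  shows "P \<odot>\<^bsub>V\<^esub> T \<in> carrier V"
proof -
  obtain c where c: "Poly_Mapping.keys c \<subseteq> S" "T = cls c"
    using assms by (auto elim: V_carrierE)
  show ?thesis
    unfolding c(2) V_smult[OF assms(1)] by (intro cls_closed ext_frac_closed assms c)
qed

lemma vectorspace_V: "vectorspace F V"
proof -
  have keys: "Poly_Mapping.keys (c + d) \<subseteq> S" if "Poly_Mapping.keys c \<subseteq> S" "Poly_Mapping.keys d \<subseteq> S" for c d
    using that keys_add[of c d] by blast
  have "module F V"
  proof (rule module_criteria)
    show "cring F" by (rule F_cring)
    show "\<zero>\<^bsub>V\<^esub> \<in> carrier V"
      unfolding V_zero by (rule cls_closed) simp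
    show "\<forall>v w. v \<in> carrier V \<and> w \<in> carrier V \<longrightarrow> v \<oplus>\<^bsub>V\<^esub> w \<in> carrier V"
      by (auto elim!: V_carrierE simp: V_add intro!: cls_closed dest!: subsetD[OF keys_add])
    show "\<forall>v\<in>carrier V. \<exists>w\<in>carrier V. v \<oplus>\<^bsub>V\<^esub> w = \<zero>\<^bsub>V\<^esub>"
    proof
      fix v assume "v \<in> carrier V"
      then obtain c where "Poly_Mapping.keys c \<subseteq> S" "v = cls c"
        by (rule V_carrierE)
      then show "\<exists>w\<in>carrier V. v \<oplus>\<^bsub>V\<^esub> w = \<zero>\<^bsub>V\<^esub>"
        by (intro bexI[of _ "cls (- c)"] cls_closed) (simp_all add: V_add V_zero)
    qed
    show "\<forall>c v. c \<in> carrier F \<and> v \<in> carrier V \<longrightarrow> c \<odot>\<^bsub>V\<^esub> v \<in> carrier V"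
      using V_smult_closed by blast
    show "\<forall>v w. v \<in> carrier V \<and> w \<in> carrier V \<longrightarrow> v \<oplus>\<^bsub>V\<^esub> w = w \<oplus>\<^bsub>V\<^esub> v"
      by (auto elim!: V_carrierE simp: V_add add.commute)
    show "\<forall>v w x. v \<in> carrier V \<and> w \<in> carrier V \<and> x \<in> carrier V
        \<longrightarrow> (v \<oplus>\<^bsub>V\<^esub> w) \<oplus>\<^bsub>V\<^esub> x = v \<oplus>\<^bsub>V\<^esub> (w \<oplus>\<^bsub>V\<^esub> x)"
      by (auto elim!: V_carrierE simp: V_add add.assoc)
    show "\<forall>v\<in>carrier V. v \<oplus>\<^bsub>V\<^esub> \<zero>\<^bsub>V\<^esub> = v"
      by (auto elim!: V_carrierE simp: V_add V_zero)
    have "ext id (\<lambda>Q. P \<otimes>\<^bsub>F\<^esub> P' \<otimes>\<^bsub>F\<^esub> Q) c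
        = ext id (\<lambda>Q. P \<otimes>\<^bsub>F\<^esub> Q) (ext id (\<lambda>Q. P' \<otimes>\<^bsub>F\<^esub> Q) c)"
      if "Poly_Mapping.keys c \<subseteq> S" "P \<in> carrier F" "P' \<in> carrier F" for c P P'
      using that by (induction c rule: free_Abelian_group_induct[consumes 1])
        (auto simp: frag_extend_diff F.m_assoc)
    then show "\<forall>a b v. a \<in> carrier F \<and> b \<in> carrier F \<and> v \<in> carrier V
        \<longrightarrow> (a \<otimes>\<^bsub>F\<^esub> b) \<odot>\<^bsub>V\<^esub> v = a \<odot>\<^bsub>V\<^esub> (b \<odot>\<^bsub>V\<^esub> v)"
      by (auto elim!: V_carrierE simp: V_smult)
    have "ext id (\<lambda>Q. \<one>\<^bsub>F\<^esub> \<otimes>\<^bsub>F\<^esub> Q) c = c" if "Poly_Mapping.keys c \<subseteq> S" for c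
      using that by (induction c rule: free_Abelian_group_induct[consumes 1])
        (auto simp: frag_extend_diff)
    then show "\<forall>v\<in>carrier V. \<one>\<^bsub>F\<^esub> \<odot>\<^bsub>V\<^esub> v = v"
      by (auto elim!: V_carrierE simp: V_smult)
    \<comment> \<open>The other identities hold already for representatives; additivity in the
      scalar holds only modulo the relations for sums in the second factor.\<close>
    have "ext id (\<lambda>Q. (P \<oplus>\<^bsub>F\<^esub> P') \<otimes>\<^bsub>F\<^esub> Q) c
        - (ext id (\<lambda>Q. P \<otimes>\<^bsub>F\<^esub> Q) c + ext id (\<lambda>Q. P' \<otimes>\<^bsub>F\<^esub> Q) c) \<in> Kn"
      if "Poly_Mapping.keys c \<subseteq> S" and P: "P \<in> carrier F" "P' \<in> carrier F" for c P P'
      using that(1)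
    proof (induction c rule: free_Abelian_group_induct[consumes 1])
      case 1 then show ?case by (simp add: Kn_0)
    next
      case (2 x y)
      from Kn_diff[OF 2(3,4)] show ?case
        by (simp add: frag_extend_diff algebra_simps)
    next
      case (3 a)
      then show ?case
        using P Kn_rel_simps(2)[of "fst a" "P \<otimes>\<^bsub>F\<^esub> snd a" "P' \<otimes>\<^bsub>F\<^esub> snd a"]
        by (auto simp: F.l_distr diff_diff_eq)
    qed
    then have "(a \<oplus>\<^bsub>F\<^esub> b) \<odot>\<^bsub>V\<^esub> cls c = a \<odot>\<^bsub>V\<^esub> cls c \<oplus>\<^bsub>V\<^esub> b \<odot>\<^bsub>V\<^esub> cls c"
      if "a \<in> carrier F" "b \<in> carrier F" "Poly_Mapping.keys c \<subseteq> S" for a b c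
      using that by (simp only: V_smult V_add cls_eq_iff F.a_closed)
    then show "\<forall>a b v. a \<in> carrier F \<and> b \<in> carrier F \<and> v \<in> carrier V
        \<longrightarrow> (a \<oplus>\<^bsub>F\<^esub> b) \<odot>\<^bsub>V\<^esub> v = a \<odot>\<^bsub>V\<^esub> v \<oplus>\<^bsub>V\<^esub> b \<odot>\<^bsub>V\<^esub> v"
      by (metis V_carrierE)
    show "\<forall>a v w. a \<in> carrier F \<and> v \<in> carrier V \<and> w \<in> carrier V
        \<longrightarrow> a \<odot>\<^bsub>V\<^esub> (v \<oplus>\<^bsub>V\<^esub> w) = a \<odot>\<^bsub>V\<^esub> v \<oplus>\<^bsub>V\<^esub> a \<odot>\<^bsub>V\<^esub> w"
      by (auto elim!: V_carrierE simp: V_smult V_add frag_extend_add)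
  qed
  then show ?thesis
    by (simp add: vectorspace_def F.field_axioms)
qed

sublocale VS: vectorspace F V
  by (rule vectorspace_V)

lemma tensor_map_hom:
  assumes f: "f \<in> module_hom R M M"
  shows "tensor_map R M N f id \<in> module_hom F V V"
proof -
  have fM: "f \<in> carrier M \<rightarrow> carrier M"
    using f by (simp add: module_hom_def)
  have "ext f id (ext id (\<lambda>Q. P \<otimes>\<^bsub>F\<^esub> Q) c) = ext id (\<lambda>Q. P \<otimes>\<^bsub>F\<^esub> Q) (ext f id c)" for P c
    using subset_UNIV[of "Poly_Mapping.keys c"]
    by (induction c rule: frag_induction) (auto simp: frag_extend_diff)
  moreover have "tensor_map R M N f id T \<in> carrier V" if T: "T \<in> carrier V" for T
  proof -
    obtain c where c: "Poly_Mapping.keys c \<subseteq> S" "T = cls c"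
      using T by (rule V_carrierE)
    show ?thesis
      unfolding c(2) tensor_map_cls[OF f id_hom(2)] by (intro cls_closed ext_closed fM c) auto
  qed
  ultimately show ?thesis
    unfolding module_hom_def
    by (auto elim!: V_carrierE simp: V_smult V_add tensor_map_cls[OF f id_hom(2)] frag_extend_add)
qed

section \<open>Pure tensors and functionals on the tensor product\<close>

definition ten :: "'b \<Rightarrow> ('a \<times> 'a) set \<Rightarrow> ('b \<times> ('a \<times> 'a) set \<Rightarrow>\<^sub>0 int) set" where
  "ten m P = cls (frag_of (m, P))"

lemma ten_closed: "\<lbrakk>m \<in> carrier M; P \<in> carrier F\<rbrakk> \<Longrightarrow> ten m P \<in> carrier V"
  by (simp add: ten_def cls_closed)

lemma ten_add:
  "\<lbrakk>m \<in> carrier M; m' \<in> carrier M; P \<in> carrier F\<rbrakk> \<Longrightarrow> ten (m \<oplus>\<^bsub>M\<^esub> m') P = ten m P \<oplus>\<^bsub>V\<^esub> ten m' P"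
  using Kn_rel_simps(1)[of m m' P] by (simp add: ten_def V_add cls_eq_iff diff_diff_eq)

lemma ten_smult:
  "\<lbrakk>r \<in> carrier R; m \<in> carrier M; P \<in> carrier F\<rbrakk> \<Longrightarrow> ten (r \<odot>\<^bsub>M\<^esub> m) P = ten m (fraction R r \<one> \<otimes>\<^bsub>F\<^esub> P)"
  by (simp add: ten_def cls_eq_iff Kn_rel_simps)

lemma smult_ten: "P \<in> carrier F \<Longrightarrow> P \<odot>\<^bsub>V\<^esub> ten m Q = ten m (P \<otimes>\<^bsub>F\<^esub> Q)"
  by (simp add: ten_def V_smult)

lemma ten_finsum:
  assumes "finite A" "f \<in> A \<rightarrow> carrier M" "P \<in> carrier F"
  shows "ten (finsum M f A) P = finsum V (\<lambda>i. ten (f i) P) A"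
  using assms
proof (induction A)
  case empty
  have "ten \<zero>\<^bsub>M\<^esub> P \<oplus>\<^bsub>V\<^esub> ten \<zero>\<^bsub>M\<^esub> P = ten \<zero>\<^bsub>M\<^esub> P"
    using ten_add[of "\<zero>\<^bsub>M\<^esub>" "\<zero>\<^bsub>M\<^esub>" P] empty by simp
  then have "ten \<zero>\<^bsub>M\<^esub> P = \<zero>\<^bsub>V\<^esub>"
    using empty by (simp add: ten_closed)
  then show ?case by simp
next
  case (insert x A)
  then show ?case
    by (subst M.finsum_insert, simp_all, subst VS.M.finsum_insert)
      (auto simp: ten_add ten_closed Pi_iff)
qed

text \<open>The functional on the tensor product induced by an \<open>R\<close>-linear \<psi>,
  sending the tensor of \<open>m\<close> and \<open>P\<close> to \<open>\<psi> m * val P\<close>.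
  Its values lie in \<open>'l\<close>, so that coordinates with a denominator can be written
  directly.\<close>

definition lin :: "('b \<Rightarrow> 'l) \<Rightarrow> ('b \<times> ('a \<times> 'a) set \<Rightarrow>\<^sub>0 int) set \<Rightarrow> 'l" where
  "lin \<psi> T = frag_eval (\<lambda>(m, P). \<psi> m * val P) (SOME c. c \<in> T)"

context
  fixes \<psi>
  assumes psi_add: "\<And>m m'. \<lbrakk>m \<in> carrier M; m' \<in> carrier M\<rbrakk> \<Longrightarrow> \<psi> (m \<oplus>\<^bsub>M\<^esub> m') = \<psi> m + \<psi> m'"
    and psi_smult: "\<And>r m. \<lbrakk>r \<in> carrier R; m \<in> carrier M\<rbrakk> \<Longrightarrow> \<psi> (r \<odot>\<^bsub>M\<^esub> m) = \<phi> r * \<psi> m"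
begin

lemma frag_eval_kernel: "c \<in> Kn \<Longrightarrow> frag_eval (\<lambda>(m, P). \<psi> m * val P) c = 0"
proof (induction rule: Kn_induct)
  case (diff x y) then show ?case by (simp add: frag_eval_diff)
next
  case (rel x)
  then show ?case
    by (rule tensor_relationsE)
      (simp_all add: frag_eval_diff psi_add psi_smult val_add val_mult val_fraction emb_one
        one_neq_zero ring_distribs mult.left_commute)
qed simp

lemma lin_cls: "lin \<psi> (cls c) = frag_eval (\<lambda>(m, P). \<psi> m * val P) c"
proof -
  have "(SOME d. d \<in> cls c) \<in> cls c"
    using cls_self by (rule someI)
  then show ?thesis
    using frag_eval_kernel[of "(SOME d. d \<in> cls c) - c"]
    by (simp add: lin_def mem_cls_iff cls_eq_iff frag_eval_diff)
qed

lemma lin_ten: "lin \<psi> (ten m P) = \<psi> m * val P"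
  by (simp add: ten_def lin_cls)

lemma lin_add: "\<lbrakk>T \<in> carrier V; T' \<in> carrier V\<rbrakk> \<Longrightarrow> lin \<psi> (T \<oplus>\<^bsub>V\<^esub> T') = lin \<psi> T + lin \<psi> T'"
  by (auto elim!: V_carrierE simp: V_add lin_cls frag_eval_add)

lemma lin_smult:
  assumes "P \<in> carrier F" "T \<in> carrier V"
  shows "lin \<psi> (P \<odot>\<^bsub>V\<^esub> T) = val P * lin \<psi> T"
proof -
  obtain c where c: "Poly_Mapping.keys c \<subseteq> S" "T = cls c"
    using assms by (auto elim: V_carrierE)
  have "frag_eval (\<lambda>(m, P). \<psi> m * val P) (ext id (\<lambda>Q. P \<otimes>\<^bsub>F\<^esub> Q) c)
      = val P * frag_eval (\<lambda>(m, P). \<psi> m * val P) c"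
    using c(1) by (induction c rule: free_Abelian_group_induct[consumes 1])
      (auto simp: frag_extend_diff frag_eval_diff val_mult assms algebra_simps)
  then show ?thesis
    using c assms by (simp add: V_smult lin_cls)
qed

end

end

section \<open>Traces and frames\<close>

lemma (in module) functional_lincomb:
  fixes l :: "'c \<Rightarrow> 'l::comm_ring_1" and v :: "'a \<Rightarrow> 'l"
  assumes add: "\<And>x y. \<lbrakk>x \<in> carrier M; y \<in> carrier M\<rbrakk> \<Longrightarrow> l (x \<oplus>\<^bsub>M\<^esub> y) = l x + l y"
    and smult: "\<And>a x. \<lbrakk>a \<in> carrier R; x \<in> carrier M\<rbrakk> \<Longrightarrow> l (a \<odot>\<^bsub>M\<^esub> x) = v a * l x"
    and A: "finite A" "A \<subseteq> carrier M" "a \<in> A \<rightarrow> carrier R"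
  shows "l (lincomb a A) = (\<Sum>x\<in>A. v (a x) * l x)"
proof -
  have "l \<zero>\<^bsub>M\<^esub> = 0"
    using add[of "\<zero>\<^bsub>M\<^esub>" "\<zero>\<^bsub>M\<^esub>"] by (metis M.l_zero M.zero_closed add_cancel_left_left)
  with A show ?thesis
  proof (induction A)
    case empty
    then show ?case by (simp add: lincomb_def)
  next
    case (insert x A)
    then have "lincomb a (insert x A) = a x \<odot>\<^bsub>M\<^esub> x \<oplus>\<^bsub>M\<^esub> lincomb a A"
      using lincomb_insert[of A a x] by simp
    with insert show ?case
      by (simp add: add smult)
  qed
qed

lemma (in module) lincomb_eqD:
  assumes "lin_indpt A" "finite A" "A \<subseteq> carrier M" "a \<in> A \<rightarrow> carrier R" "b \<in> A \<rightarrow> carrier R"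
    "lincomb a A = lincomb b A" "x \<in> A"
  shows "a x = b x"
proof (rule ccontr)
  assume "a x \<noteq> b x"
  moreover have "a x \<in> carrier R" "b x \<in> carrier R"
    using assms by auto
  ultimately have "a x \<ominus> b x \<noteq> \<zero>"
    by simp
  moreover have "lincomb (\<lambda>v. a v \<ominus> b v) A = \<zero>\<^bsub>M\<^esub>"
    using assms by (subst lincomb_diff) (simp_all add: M.minus_eq M.r_neg)
  ultimately have "lin_dep A"
    using assms by (intro lin_dep_crit[of A A "\<lambda>v. a v \<ominus> b v" x]) auto
  with assms(1) show False ..
qed

text \<open>The trace is a definite description over all finite bases, so independence of the basis
  has to be shown. With \<open>k b\<close> the coordinates in an arbitrary basis \<open>A\<close>
  and \<open>l i\<close> those dual to \<epsilon>, the double sum of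
  \<open>k b (\<epsilon> i) * l i (f b)\<close> is the trace in \<epsilon> or in \<open>A\<close>,
  depending on which index is summed first.\<close>

lemma endo_trace_functionals:
  fixes val :: "'f \<Rightarrow> 'l::field" and l :: "'i \<Rightarrow> 'v \<Rightarrow> 'l"
  assumes vs: "vectorspace K V" and emb: "embedded_domain K val"
    and basis: "vectorspace.basis K V (\<epsilon> ` I)" and I: "finite I" "inj_on \<epsilon> I"
    and l_add: "\<And>i x y. \<lbrakk>i \<in> I; x \<in> carrier V; y \<in> carrier V\<rbrakk> \<Longrightarrow> l i (x \<oplus>\<^bsub>V\<^esub> y) = l i x + l i y"
    and l_smult: "\<And>i a x. \<lbrakk>i \<in> I; a \<in> carrier K; x \<in> carrier V\<rbrakk> \<Longrightarrow> l i (a \<odot>\<^bsub>V\<^esub> x) = val a * l i x"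
    and l_delta: "\<And>i j. \<lbrakk>i \<in> I; j \<in> I\<rbrakk> \<Longrightarrow> l i (\<epsilon> j) = (if i = j then 1 else 0)"
    and f: "f \<in> module_hom K V V"
  shows "endo_trace K V f \<in> carrier K" "val (endo_trace K V f) = (\<Sum>i\<in>I. l i (f (\<epsilon> i)))"
proof -
  interpret vectorspace K V by fact
  interpret E: embedded_domain K val by fact
  have f_closed: "f x \<in> carrier V" if "x \<in> carrier V" for x
    using f that by (auto simp: module_hom_def)
  have coords: "\<exists>\<kappa>. \<forall>x\<in>carrier V. \<kappa> x \<in> A \<rightarrow> carrier K \<and> x = lincomb (\<kappa> x) A"
    if "finite A" "basis A" for A
    using that finite_in_span[of A] unfolding basis_def by metis
  have trace: "val (\<Oplus>\<^bsub>K\<^esub>v\<in>A. c v v) = (\<Sum>i\<in>I. l i (f (\<epsilon> i)))"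
    if A: "finite A" "basis A" and c: "\<And>v. v \<in> A \<Longrightarrow> c v \<in> A \<rightarrow> carrier K \<and> f v = lincomb (c v) A"
    for A c
  proof -
    have Ali: "lin_indpt A" and AV: "A \<subseteq> carrier V"
      using A by (auto simp: basis_def)
    obtain \<kappa> where \<kappa>: "\<And>x. x \<in> carrier V \<Longrightarrow> \<kappa> x \<in> A \<rightarrow> carrier K"
      "\<And>x. x \<in> carrier V \<Longrightarrow> lincomb (\<kappa> x) A = x"
      using coords[OF A] by metis
    note uniq = lincomb_eqD[OF Ali A(1) AV]
    define k where "k b x = val (\<kappa> x b)" for b x
    have k_add: "k b (x \<oplus>\<^bsub>V\<^esub> y) = k b x + k b y"
      if "b \<in> A" "x \<in> carrier V" "y \<in> carrier V" for b x y
    proof -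
      have "\<kappa> (x \<oplus>\<^bsub>V\<^esub> y) b = \<kappa> x b \<oplus>\<^bsub>K\<^esub> \<kappa> y b"
      proof (rule uniq)
        show "lincomb (\<kappa> (x \<oplus>\<^bsub>V\<^esub> y)) A = lincomb (\<lambda>b. \<kappa> x b \<oplus>\<^bsub>K\<^esub> \<kappa> y b) A"
          using that \<kappa> by (simp add: lincomb_sum[OF A(1) AV])
      qed (use that \<kappa> in auto)
      then show ?thesis
        using that \<kappa>(1)[of x] \<kappa>(1)[of y] by (simp add: k_def E.emb_add Pi_iff)
    qed
    have k_smult: "k b (a \<odot>\<^bsub>V\<^esub> x) = val a * k b x"
      if "b \<in> A" "a \<in> carrier K" "x \<in> carrier V" for b a x
    proof -
      have "\<kappa> (a \<odot>\<^bsub>V\<^esub> x) b = a \<otimes>\<^bsub>K\<^esub> \<kappa> x b"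
      proof (rule uniq)
        show "lincomb (\<kappa> (a \<odot>\<^bsub>V\<^esub> x)) A = lincomb (\<lambda>b. a \<otimes>\<^bsub>K\<^esub> \<kappa> x b) A"
          using that \<kappa> by (simp add: lincomb_smult[OF AV])
      qed (use that \<kappa> in auto)
      then show ?thesis
        using that \<kappa>(1)[of x] by (simp add: k_def E.emb_mult Pi_iff)
    qed
    have \<epsilon>V: "\<epsilon> ` I \<subseteq> carrier V"
      using basis by (simp add: basis_def)
    \<comment> \<open>The coordinates of \<open>x\<close> in the basis \<epsilon> are the values
      \<open>l i x\<close>, by duality.\<close>
    have k_expand: "k b x = (\<Sum>i\<in>I. l i x * k b (\<epsilon> i))" if bx: "b \<in> A" "x \<in> carrier V" for b x
    proof -
      obtain a where a: "a \<in> \<epsilon> ` I \<rightarrow> carrier K" "x = lincomb a (\<epsilon> ` I)"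
        using coords[of "\<epsilon> ` I"] basis I bx(2) by blast
      have "k b x = (\<Sum>y\<in>\<epsilon> ` I. val (a y) * k b y)"
        unfolding a(2) by (rule functional_lincomb) (use that k_add k_smult a \<epsilon>V I in auto)
      also have "\<dots> = (\<Sum>i\<in>I. val (a (\<epsilon> i)) * k b (\<epsilon> i))"
        using I by (simp add: sum.reindex)
      also have "\<dots> = (\<Sum>i\<in>I. l i x * k b (\<epsilon> i))"
      proof (rule sum.cong[OF HOL.refl])
        fix i assume 1: "i \<in> I"
        have "l i x = (\<Sum>y\<in>\<epsilon> ` I. val (a y) * l i y)"
          unfolding a(2) by (rule functional_lincomb) (use 1 l_add l_smult a \<epsilon>V I in auto)
        also have "\<dots> = (\<Sum>j\<in>I. val (a (\<epsilon> j)) * l i (\<epsilon> j))"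
          using I by (simp add: sum.reindex)
        also have "\<dots> = val (a (\<epsilon> i))"
          using I 1 by (simp add: l_delta if_distrib sum.If_cases cong: if_cong)
        finally show "val (a (\<epsilon> i)) * k b (\<epsilon> i) = l i x * k b (\<epsilon> i)" by simp
      qed
      finally show ?thesis .
    qed
    have "l i (f (\<epsilon> i)) = (\<Sum>b\<in>A. k b (\<epsilon> i) * l i (f b))" if "i \<in> I" for i
    proof -
      have "\<epsilon> i \<in> carrier V"
        using \<epsilon>V that by auto
      then have "l i (f (\<epsilon> i)) = l i (f (lincomb (\<kappa> (\<epsilon> i)) A))"
        by (simp add: \<kappa>)
      also have "\<dots> = (\<Sum>b\<in>A. val (\<kappa> (\<epsilon> i) b) * l i (f b))"
        by (rule functional_lincomb[where l = "\<lambda>x. l i (f x)"])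
          (use f f_closed that A AV \<kappa> \<open>\<epsilon> i \<in> carrier V\<close> in \<open>auto simp: module_hom_def l_add l_smult\<close>)
      finally show ?thesis by (simp add: k_def)
    qed
    then have "(\<Sum>i\<in>I. l i (f (\<epsilon> i))) = (\<Sum>b\<in>A. \<Sum>i\<in>I. l i (f b) * k b (\<epsilon> i))"
      by (subst sum.swap) (simp add: mult.commute)
    also have "\<dots> = (\<Sum>b\<in>A. k b (f b))"
      using AV f_closed by (intro sum.cong HOL.refl k_expand[symmetric]) auto
    also have "\<dots> = (\<Sum>b\<in>A. val (c b b))"
    proof (rule sum.cong[OF HOL.refl])
      fix b assume b: "b \<in> A"
      have "\<kappa> (f b) b = c b b"
        by (rule uniq) (use b c \<kappa> f_closed AV in auto)
      then show "k b (f b) = val (c b b)"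
        by (simp add: k_def)
    qed
    also have "\<dots> = val (\<Oplus>\<^bsub>K\<^esub>v\<in>A. c v v)"
      using c by (subst E.emb_finsum) auto
    finally show ?thesis by simp
  qed
  let ?P = "\<lambda>\<tau>. \<exists>A c. finite A \<and> basis A \<and>
     (\<forall>v \<in> A. c v \<in> A \<rightarrow> carrier K \<and> f v = lincomb (c v) A) \<and> \<tau> = (\<Oplus>\<^bsub>K\<^esub> v\<in>A. c v v)"
  have P: "\<tau> \<in> carrier K \<and> val \<tau> = (\<Sum>i\<in>I. l i (f (\<epsilon> i)))" if P: "?P \<tau>" for \<tau>
    using P by (auto simp: trace intro!: R.finsum_closed)
  \<comment> \<open>The description is not empty: coordinates in the basis \<epsilon> itself give an
    admissible value.\<close>
  obtain \<kappa> where \<kappa>: "\<forall>x\<in>carrier V. \<kappa> x \<in> \<epsilon> ` I \<rightarrow> carrier K \<and> x = lincomb (\<kappa> x) (\<epsilon> ` I)"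
    using coords[of "\<epsilon> ` I"] basis I by blast
  have "\<forall>v\<in>\<epsilon> ` I. f v \<in> carrier V"
    using basis f_closed by (auto simp: basis_def)
  then have "\<forall>v\<in>\<epsilon> ` I. \<kappa> (f v) \<in> \<epsilon> ` I \<rightarrow> carrier K \<and> f v = lincomb (\<kappa> (f v)) (\<epsilon> ` I)"
    using \<kappa> by blast
  moreover have "finite (\<epsilon> ` I)"
    using I by simp
  ultimately have ex: "?P (\<Oplus>\<^bsub>K\<^esub> v\<in>\<epsilon> ` I. \<kappa> (f v) v)"
    using basis by (intro exI[of _ "\<epsilon> ` I"] exI[of _ "\<lambda>v. \<kappa> (f v)"] conjI HOL.refl)
  have "endo_trace K V f = (\<Oplus>\<^bsub>K\<^esub> v\<in>\<epsilon> ` I. \<kappa> (f v) v)"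
    unfolding endo_trace_def
  proof (rule the_equality)
    show "?P (\<Oplus>\<^bsub>K\<^esub> v\<in>\<epsilon> ` I. \<kappa> (f v) v)" by (rule ex)
  next
    fix \<tau> assume "?P \<tau>"
    with P[of \<tau>] P[OF ex] show "\<tau> = (\<Oplus>\<^bsub>K\<^esub> v\<in>\<epsilon> ` I. \<kappa> (f v) v)"
      by (simp add: E.emb_eq_iff flip: E.emb_eq_iff)
  qed
  with P[OF ex] show "endo_trace K V f \<in> carrier K" "val (endo_trace K V f) = (\<Sum>i\<in>I. l i (f (\<epsilon> i)))"
    by simp_all
qed

text \<open>
  A frame exhibits \<open>M\<close> as free on \<open>e\<close> after inverting \<open>v\<close>: the coordinates of \<open>m\<close> are \<open>\<alpha> i m / v\<close>.
\<close>

definition frame ::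
  "('a, 'q) ring_scheme \<Rightarrow> ('a, 'b, 'c) module_scheme \<Rightarrow> nat \<Rightarrow> 'a \<Rightarrow> (nat \<Rightarrow> 'b) \<Rightarrow> (nat \<Rightarrow> 'b \<Rightarrow> 'a) \<Rightarrow> bool"
  where "frame R M w v e \<alpha> \<longleftrightarrow> v \<in> carrier R \<and> v \<noteq> \<zero>\<^bsub>R\<^esub> \<and> e \<in> {..<w} \<rightarrow> carrier M
    \<and> (\<forall>i<w. \<alpha> i \<in> carrier (dual R M))
    \<and> (\<forall>m\<in>carrier M. v \<odot>\<^bsub>M\<^esub> m = (\<Oplus>\<^bsub>M\<^esub>i\<in>{..<w}. \<alpha> i m \<odot>\<^bsub>M\<^esub> e i))
    \<and> (\<forall>i<w. \<forall>j<w. \<alpha> i (e j) = (if i = j then v else \<zero>\<^bsub>R\<^esub>))"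

lemma dual_iff: "f \<in> carrier (dual R M) \<longleftrightarrow>
    f \<in> extensional (carrier M) \<and> (\<forall>x\<in>carrier M. f x \<in> carrier R)
    \<and> (\<forall>x\<in>carrier M. \<forall>y\<in>carrier M. f (x \<oplus>\<^bsub>M\<^esub> y) = f x \<oplus>\<^bsub>R\<^esub> f y)
    \<and> (\<forall>r\<in>carrier R. \<forall>x\<in>carrier M. f (r \<odot>\<^bsub>M\<^esub> x) = r \<otimes>\<^bsub>R\<^esub> f x)"
  by (auto simp: dual_def module_hom_def mult_module_def Pi_iff)

section \<open>The basis of the extended module given by a frame\<close>

context embedded_module
begin

context
  fixes w v e \<alpha>
  assumes frame: "frame R M w v e \<alpha>"
begin

lemma frame_v: "v \<in> carrier R - {\<zero>}" and frame_e: "i < w \<Longrightarrow> e i \<in> carrier M"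
  and frame_dual: "i < w \<Longrightarrow> \<alpha> i \<in> carrier (dual R M)"
  and frame_expand: "m \<in> carrier M \<Longrightarrow> v \<odot>\<^bsub>M\<^esub> m = (\<Oplus>\<^bsub>M\<^esub>i\<in>{..<w}. \<alpha> i m \<odot>\<^bsub>M\<^esub> e i)"
  and frame_delta: "\<lbrakk>i < w; j < w\<rbrakk> \<Longrightarrow> \<alpha> i (e j) = (if i = j then v else \<zero>)"
  using frame by (auto simp: frame_def)

lemma frame_closed: "\<lbrakk>i < w; m \<in> carrier M\<rbrakk> \<Longrightarrow> \<alpha> i m \<in> carrier R"
  using frame_dual[of i] by (simp add: dual_iff)

abbreviation "\<epsilon> i \<equiv> ten (e i) \<one>\<^bsub>F\<^esub>"
abbreviation "coord i \<equiv> lin (\<lambda>m. \<phi> (\<alpha> i m) / \<phi> v)"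

lemma coord_ten: "i < w \<Longrightarrow> coord i (ten m P) = \<phi> (\<alpha> i m) / \<phi> v * val P"
  and coord_add: "\<lbrakk>i < w; T \<in> carrier V; T' \<in> carrier V\<rbrakk> \<Longrightarrow> coord i (T \<oplus>\<^bsub>V\<^esub> T') = coord i T + coord i T'"
  and coord_smult: "\<lbrakk>i < w; P \<in> carrier F; T \<in> carrier V\<rbrakk> \<Longrightarrow> coord i (P \<odot>\<^bsub>V\<^esub> T) = val P * coord i T"
  using frame_dual[of i]
  by (simp_all add: lin_ten lin_add lin_smult dual_iff emb_add emb_mult add_divide_distrib)

lemma coord_delta: "\<lbrakk>i < w; j < w\<rbrakk> \<Longrightarrow> coord i (\<epsilon> j) = (if i = j then 1 else 0)"
  using frame_v by (simp add: coord_ten frame_delta val_one emb_zero emb_eq_0_iff)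

lemma \<epsilon>_closed: "i < w \<Longrightarrow> \<epsilon> i \<in> carrier V"
  by (simp add: ten_closed frame_e)

lemma \<epsilon>_inj: "inj_on \<epsilon> {..<w}"
proof (rule inj_onI)
  fix i j assume "i \<in> {..<w}" "j \<in> {..<w}" "\<epsilon> i = \<epsilon> j"
  then show "i = j"
    using coord_delta[of i i] coord_delta[of i j] by (auto split: if_splits)
qed

text \<open>The denominator moves across the tensor sign: the tensor of \<open>m\<close> and
  \<open>P\<close> equals that of \<open>v m\<close> and \<open>P / v\<close>, and
  \<open>v m\<close> is an \<open>R\<close>-combination of the frame.\<close>

lemma ten_in_span:
  assumes m: "m \<in> carrier M" and P: "P \<in> carrier F"
  shows "ten m P \<in> VS.span (\<epsilon> ` {..<w})"
proof -
  interpret sub: submodule F "VS.span (\<epsilon> ` {..<w})" V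
    by (rule VS.span_is_submodule) (use \<epsilon>_closed in auto)
  let ?Q = "fraction R \<one> v \<otimes>\<^bsub>F\<^esub> P"
  have v: "v \<in> carrier R" "v \<noteq> \<zero>"
    using frame_v by auto
  have c: "fraction R \<one> v \<in> carrier F"
    using v by (simp add: fraction_closed)
  have "val (fraction R v \<one> \<otimes>\<^bsub>F\<^esub> ?Q) = val P"
    using v P c one_neq_zero by (simp add: val_mult val_fraction emb_one emb_eq_0_iff)
  then have eq: "fraction R v \<one> \<otimes>\<^bsub>F\<^esub> ?Q = P"
    using v P c by (subst (asm) val_eq_iff) auto
  have Q: "?Q \<in> carrier F"
    using P c by simp
  have "ten m P = ten (v \<odot>\<^bsub>M\<^esub> m) ?Q"
    using v m P c by (simp add: ten_smult eq)
  also have "\<dots> = (\<Oplus>\<^bsub>V\<^esub>i\<in>{..<w}. ten (\<alpha> i m \<odot>\<^bsub>M\<^esub> e i) ?Q)"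
    unfolding frame_expand[OF m] by (rule ten_finsum) (use m Q frame_closed frame_e in auto)
  also have "\<dots> = (\<Oplus>\<^bsub>V\<^esub>i\<in>{..<w}. (fraction R (\<alpha> i m) \<one> \<otimes>\<^bsub>F\<^esub> ?Q) \<odot>\<^bsub>V\<^esub> \<epsilon> i)"
  proof (rule VS.M.finsum_cong'[OF HOL.refl])
    show "(\<lambda>i. (fraction R (\<alpha> i m) \<one> \<otimes>\<^bsub>F\<^esub> ?Q) \<odot>\<^bsub>V\<^esub> \<epsilon> i) \<in> {..<w} \<rightarrow> carrier V"
      using Q m frame_closed \<epsilon>_closed by auto
    fix i assume "i \<in> {..<w}"
    then show "ten (\<alpha> i m \<odot>\<^bsub>M\<^esub> e i) ?Q = (fraction R (\<alpha> i m) \<one> \<otimes>\<^bsub>F\<^esub> ?Q) \<odot>\<^bsub>V\<^esub> \<epsilon> i"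
      using Q m frame_closed[of i m] frame_e[of i] by (simp add: ten_smult smult_ten)
  qed
  also have "\<dots> \<in> VS.span (\<epsilon> ` {..<w})"
  proof -
    have "(\<Oplus>\<^bsub>V\<^esub>i\<in>A. (fraction R (\<alpha> i m) \<one> \<otimes>\<^bsub>F\<^esub> ?Q) \<odot>\<^bsub>V\<^esub> \<epsilon> i) \<in> VS.span (\<epsilon> ` {..<w})"
      if "finite A" "A \<subseteq> {..<w}" for A
      using that
    proof (induction A)
      case (insert x A)
      have "\<epsilon> x \<in> VS.span (\<epsilon> ` {..<w})"
        using insert \<epsilon>_closed by (intro VS.in_own_span[THEN subsetD]) auto
      moreover have "fraction R (\<alpha> i m) \<one> \<otimes>\<^bsub>F\<^esub> ?Q \<in> carrier F" if "i < w" for i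
        using that m P c by (simp add: frame_closed)
      ultimately show ?case
        using insert \<epsilon>_closed by (subst VS.M.finsum_insert) (auto intro!: VS.smult_closed)
    qed simp
    then show ?thesis by simp
  qed
  finally show ?thesis .
qed

text \<open>Independence holds because \<open>coord j\<close> extracts the \<open>j\<close>-th
  coefficient. Spanning reduces to pure tensors, since these generate the tensor product as a
  group.\<close>

lemma \<epsilon>_basis: "VS.basis (\<epsilon> ` {..<w})"
  unfolding VS.basis_def
proof (intro conjI)
  show sub: "\<epsilon> ` {..<w} \<subseteq> carrier V"
    using \<epsilon>_closed by auto
  show "VS.lin_indpt (\<epsilon> ` {..<w})"
  proof (rule VS.finite_lin_indpt2[OF _ sub])
    fix a assume a: "a \<in> \<epsilon> ` {..<w} \<rightarrow> carrier F" "VS.lincomb a (\<epsilon> ` {..<w}) = \<zero>\<^bsub>V\<^esub>"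
    show "\<forall>x\<in>\<epsilon> ` {..<w}. a x = \<zero>\<^bsub>F\<^esub>"
    proof clarify
      fix j assume j: "j < w"
      have "coord j \<zero>\<^bsub>V\<^esub> = 0"
        using coord_add[OF j, of "\<zero>\<^bsub>V\<^esub>" "\<zero>\<^bsub>V\<^esub>"] by (metis VS.M.l_zero VS.M.zero_closed add_cancel_left_left)
      then have "0 = coord j (VS.lincomb a (\<epsilon> ` {..<w}))"
        by (simp add: a)
      also have "\<dots> = (\<Sum>x\<in>\<epsilon> ` {..<w}. val (a x) * coord j x)"
        by (rule VS.functional_lincomb) (use sub a j coord_add coord_smult in auto)
      also have "\<dots> = (\<Sum>i<w. val (a (\<epsilon> i)) * coord j (\<epsilon> i))"
        using \<epsilon>_inj by (simp add: sum.reindex)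
      also have "\<dots> = (\<Sum>i<w. if j = i then val (a (\<epsilon> i)) else 0)"
        using j by (intro sum.cong) (auto simp: coord_delta)
      also have "\<dots> = val (a (\<epsilon> j))"
        using j by simp
      finally show "a (\<epsilon> j) = \<zero>\<^bsub>F\<^esub>"
        using a(1) j val_eq_iff[of "a (\<epsilon> j)" "\<zero>\<^bsub>F\<^esub>"] by (auto simp: val_zero)
    qed
  qed simp
  interpret sub: submodule F "VS.span (\<epsilon> ` {..<w})" V
    by (rule VS.span_is_submodule) (use sub in auto)
  have "cls c \<in> VS.span (\<epsilon> ` {..<w})" if "Poly_Mapping.keys c \<subseteq> S" for c
    using that
  proof (induction c rule: free_Abelian_group_induct[consumes 1])
    case 1
    then show ?case using sub.zero_closed by (simp add: V_zero)
  next
    case (2 x y)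
    have "cls (x - y) = cls x \<oplus>\<^bsub>V\<^esub> (\<ominus>\<^bsub>F\<^esub> \<one>\<^bsub>F\<^esub>) \<odot>\<^bsub>V\<^esub> cls y"
    proof -
      have "cls (x - y) \<oplus>\<^bsub>V\<^esub> cls y = cls x"
        by (simp add: V_add)
      moreover have "cls x \<in> carrier V" "cls y \<in> carrier V" "cls (x - y) \<in> carrier V"
        using 2 keys_diff[of x y] by (auto intro!: cls_closed)
      ultimately show ?thesis
        by (simp add: VS.smult_minus_1 VS.M.add.inv_solve_right)
    qed
    then show ?case
      using 2 by simp
  next
    case (3 a)
    then show ?case
      using ten_in_span[of "fst a" "snd a"] by (auto simp: ten_def)
  qed
  then show "VS.span (\<epsilon> ` {..<w}) = carrier V"
    using sub.subset by (auto simp: carrier_V)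
qed

lemma frame_dim: "VS.dim = w"
  using VS.dim_basis[OF _ \<epsilon>_basis] \<epsilon>_inj by (simp add: card_image)

text \<open>The induced endomorphism sends \<open>\<epsilon> i\<close> to the pure tensor of
  \<open>f (e i)\<close> and \<open>1\<close>, whose \<open>i\<close>-th coordinate is the diagonal
  entry \<open>\<alpha> i (f (e i)) / v\<close>.\<close>

lemma frame_trace:
  assumes f: "f \<in> module_hom R M M"
  shows "endo_trace F V (tensor_map R M N f id) \<in> carrier F"
    "val (endo_trace F V (tensor_map R M N f id)) = (\<Sum>i<w. \<phi> (\<alpha> i (f (e i))) / \<phi> v)"
proof -
  note * = endo_trace_functionals[OF vectorspace_V embedded_F \<epsilon>_basis _ \<epsilon>_inj, where l = coord,
      OF _ coord_add coord_smult coord_delta tensor_map_hom[OF f]]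
  show "endo_trace F V (tensor_map R M N f id) \<in> carrier F"
    by (rule *) auto
  have "val (endo_trace F V (tensor_map R M N f id)) = (\<Sum>i<w. coord i (tensor_map R M N f id (\<epsilon> i)))"
    by (rule *) auto
  also have "\<dots> = (\<Sum>i<w. \<phi> (\<alpha> i (f (e i))) / \<phi> v)"
  proof (rule sum.cong[OF HOL.refl])
    fix i assume "i \<in> {..<w}"
    then have "tensor_map R M N f id (\<epsilon> i) = ten (f (e i)) \<one>\<^bsub>F\<^esub>"
      using tensor_map_cls[OF f id_hom(2)] by (simp add: ten_def)
    then show "coord i (tensor_map R M N f id (\<epsilon> i)) = \<phi> (\<alpha> i (f (e i))) / \<phi> v"
      using \<open>i \<in> {..<w}\<close> by (simp add: coord_ten val_one)
  qed
  finally show "val (endo_trace F V (tensor_map R M N f id)) = (\<Sum>i<w. \<phi> (\<alpha> i (f (e i))) / \<phi> v)" .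
qed

end

end

section \<open>The discriminant ideal\<close>

lemma det_scale_rows:
  "det (mat w w (\<lambda>(i, j). D i * a i j)) = (\<Prod>i<w. D i) * det (mat w w (\<lambda>(i, j). a i j))"
    for D :: "nat \<Rightarrow> 'l::comm_ring_1"
proof -
  have "det (mat w w (\<lambda>(i, j). D i * a i j))
      = (\<Sum>p | p permutes {0..<w}. signof p * (\<Prod>i = 0..<w. D i * a i (p i)))"
    by (subst det_def'[of _ w]) (auto intro!: sum.cong prod.cong simp: permutes_in_image)
  also have "\<dots> = (\<Prod>i = 0..<w. D i) * (\<Sum>p | p permutes {0..<w}. signof p * (\<Prod>i = 0..<w. a i (p i)))"
    by (simp add: prod.distrib sum_distrib_left mult.left_commute)
  also have "(\<Sum>p | p permutes {0..<w}. signof p * (\<Prod>i = 0..<w. a i (p i))) = det (mat w w (\<lambda>(i, j). a i j))"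
    by (subst det_def'[of _ w]) (auto intro!: sum.cong prod.cong simp: permutes_in_image)
  finally show ?thesis
    by (simp add: lessThan_atLeast0)
qed

lemma det_diagonal: "det (mat w w (\<lambda>(i, j). if i = j then D i else 0)) = (\<Prod>i<w. D i)"
    for D :: "nat \<Rightarrow> 'l::comm_ring_1"
proof -
  have "mat w w (\<lambda>(i, j). if i = j then D i else 0) = mat w w (\<lambda>(i, j). D i * (if i = j then 1 else 0))"
    by (intro cong_mat) auto
  moreover have "mat w w (\<lambda>(i, j). if i = j then 1 else 0) = (1\<^sub>m w :: 'l mat)"
    by (auto simp: one_mat_def)
  ultimately show ?thesis
    by (simp add: det_scale_rows)
qed

text \<open>The map \<phi> respects the Leibniz formula term by term. This moves determinants over
  \<open>R\<close> to matrix determinants over \<open>'l\<close>, whose multiplicativity is used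
  later.\<close>

lemma (in embedded_domain)
  assumes a: "\<And>i j. \<lbrakk>i < w; j < w\<rbrakk> \<Longrightarrow> a i j \<in> carrier R"
  shows ring_det_closed: "ring_det R w a \<in> carrier R"
    and emb_ring_det: "\<phi> (ring_det R w a) = det (mat w w (\<lambda>(i, j). \<phi> (a i j)))"
proof -
  let ?s = "\<lambda>p. if evenperm p then \<one> else \<ominus> \<one>"
  let ?t = "\<lambda>p. ?s p \<otimes> (\<Otimes>i\<in>{..<w}. a i (p i))"
  have P: "a i (p i) \<in> carrier R" if "p permutes {..<w}" "i < w" for p i
    using that a permutes_in_image[of p "{..<w}" i] by auto
  have t: "?t p \<in> carrier R" if "p permutes {..<w}" for p
    using P[OF that] by (auto intro!: m_closed finprod_closed)
  then show "ring_det R w a \<in> carrier R"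
    unfolding ring_det_def by (intro finsum_closed) auto
  have "\<phi> (ring_det R w a) = (\<Sum>p | p permutes {..<w}. \<phi> (?t p))"
    unfolding ring_det_def using t by (intro emb_finsum) auto
  also have "\<dots> = (\<Sum>p | p permutes {..<w}. signof p * (\<Prod>i<w. \<phi> (a i (p i))))"
  proof (intro sum.cong HOL.refl)
    fix p assume "p \<in> {p. p permutes {..<w}}"
    then have p: "p permutes {..<w}" by simp
    have "\<phi> (?t p) = \<phi> (?s p) * \<phi> (\<Otimes>i\<in>{..<w}. a i (p i))"
      using P[OF p] by (intro emb_mult finprod_closed) auto
    also have "\<phi> (?s p) = signof p"
      by (simp add: emb_one emb_a_inv sign_def)
    also have "\<phi> (\<Otimes>i\<in>{..<w}. a i (p i)) = (\<Prod>i<w. \<phi> (a i (p i)))"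
      using P[OF p] by (intro emb_finprod) auto
    finally show "\<phi> (?t p) = signof p * (\<Prod>i<w. \<phi> (a i (p i)))" .
  qed
  also have "\<dots> = det (mat w w (\<lambda>(i, j). \<phi> (a i j)))"
    by (subst det_def'[of _ w]) (auto intro!: sum.cong prod.cong simp: permutes_in_image lessThan_atLeast0)
  finally show "\<phi> (ring_det R w a) = det (mat w w (\<lambda>(i, j). \<phi> (a i j)))" .
qed

section \<open>Algebras over a central subdomain\<close>

lemma mult_module_simps [simp]:
  "carrier (mult_module B) = carrier B" "add (mult_module B) = add B" "zero (mult_module B) = zero B"
  "module.smult (mult_module B) = monoid.mult B"
  by (simp_all add: mult_module_def)

lemma finsum_mult_module: "finsum (mult_module B) f A = finsum B f A"
  by (simp add: finsum_def finprod_def)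

lemma (in ring) module_over_central_subring:
  assumes "cring (R\<lparr>carrier := Z\<rparr>)" "Z \<subseteq> ring_center R"
  shows "module (R\<lparr>carrier := Z\<rparr>) (mult_module R)"
proof (rule moduleI)
  have Z: "z \<in> carrier R" if "z \<in> Z" for z
    using assms(2) that by (auto simp: ring_center_def)
  show "abelian_group (mult_module R)"
    by (rule abelian_groupI) (auto simp: a_ac intro: l_neg)
qed (use assms in \<open>auto simp: ring_center_def l_distr r_distr m_assoc subset_iff\<close>)

text \<open>Only the central subring is embedded in the field. The algebra \<open>B\<close> may be
  noncommutative and enters through functionals with values in \<open>'l\<close>.\<close>

locale central_subdomain = B?: ring B + Z?: embedded_domain "B\<lparr>carrier := Z\<rparr>" \<phi>
  for B :: "'b ring" (structure) and Z and \<phi> :: "'b \<Rightarrow> 'l::field" +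
  assumes center: "Z \<subseteq> ring_center B"
begin

abbreviation "R \<equiv> B\<lparr>carrier := Z\<rparr>"
abbreviation "M \<equiv> mult_module B"

sublocale ZM: embedded_module R \<phi> M
  using B.module_over_central_subring[OF Z.cring_axioms center]
  by (simp add: embedded_module_def Z.embedded_domain_axioms)

lemma Z_closed: "z \<in> Z \<Longrightarrow> z \<in> carrier B"
  and Z_comm: "\<lbrakk>z \<in> Z; b \<in> carrier B\<rbrakk> \<Longrightarrow> z \<otimes> b = b \<otimes> z"
  using center by (auto simp: ring_center_def)

lemma Z_lcomm:
  assumes "z \<in> Z" "x \<in> carrier B" "y \<in> carrier B"
  shows "x \<otimes> (z \<otimes> y) = z \<otimes> (x \<otimes> y)"
proof -
  have "x \<otimes> (z \<otimes> y) = (x \<otimes> z) \<otimes> y"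
    using assms Z_closed by (simp add: B.m_assoc)
  also have "\<dots> = (z \<otimes> x) \<otimes> y"
    using assms Z_comm by simp
  also have "\<dots> = z \<otimes> (x \<otimes> y)"
    using assms Z_closed by (simp add: B.m_assoc)
  finally show ?thesis .
qed

lemma left_mult_hom: "b \<in> carrier B \<Longrightarrow> (\<lambda>x. b \<otimes> x) \<in> module_hom R M M"
  using Z_closed by (auto simp: module_hom_def B.r_distr Z_lcomm)

text \<open>Apply \<open>l\<close> to the expansion of \<open>v x\<close> in the frame: up to the
  denominator, a \<open>Z\<close>-linear functional is determined by its values on the
  \<open>e i\<close>.\<close>

lemma frame_functional:
  fixes l :: "'b \<Rightarrow> 'l"
  assumes frame: "frame R M w v e \<alpha>"
    and add: "\<And>x y. \<lbrakk>x \<in> carrier B; y \<in> carrier B\<rbrakk> \<Longrightarrow> l (x \<oplus> y) = l x + l y"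
    and smult: "\<And>z x. \<lbrakk>z \<in> Z; x \<in> carrier B\<rbrakk> \<Longrightarrow> l (z \<otimes> x) = \<phi> z * l x"
    and x: "x \<in> carrier B"
  shows "\<phi> v * l x = (\<Sum>i<w. \<phi> (\<alpha> i x) * l (e i))"
proof -
  have l0: "l \<zero> = 0"
    using add[of \<zero> \<zero>] by (metis B.l_zero B.zero_closed add_cancel_left_left)
  have sum: "l (finsum B f A) = (\<Sum>i\<in>A. l (f i))" if "finite A" "f \<in> A \<rightarrow> carrier B" for f and A :: "nat set"
    using that by (induction A) (auto simp: l0 add Pi_iff)
  note F = ZM.frame_v[OF frame] ZM.frame_e[OF frame] ZM.frame_closed[OF frame] ZM.frame_expand[OF frame]
  have "\<phi> v * l x = l (v \<otimes> x)"
    using F(1) x by (simp add: smult)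
  also have "v \<otimes> x = (\<Oplus>i\<in>{..<w}. \<alpha> i x \<otimes> e i)"
    using F(4)[of x] x by (simp add: finsum_mult_module)
  also have "l \<dots> = (\<Sum>i<w. l (\<alpha> i x \<otimes> e i))"
    using F x Z_closed by (intro sum) (auto intro!: B.m_closed)
  also have "\<dots> = (\<Sum>i<w. \<phi> (\<alpha> i x) * l (e i))"
    using F x by (intro sum.cong HOL.refl smult) auto
  finally show ?thesis .
qed

context
  fixes w v e \<alpha> \<tau>
  assumes frame: "frame R M w v e \<alpha>"
    and trace: "\<And>b. b \<in> carrier B \<Longrightarrow> \<tau> b \<in> Z"
      "\<And>b. b \<in> carrier B \<Longrightarrow> (\<Sum>i<w. \<phi> (\<alpha> i (b \<otimes> e i))) = \<phi> v * \<phi> (\<tau> b)"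
begin

lemma generic_rank_eq: "generic_rank B Z = w"
  unfolding generic_rank_def by (rule ZM.frame_dim[OF frame])

text \<open>The hypothesis on \<tau> is the trace formula with its denominator cleared, since the
  frame gives the trace of left multiplication by \<open>b\<close> as the sum of the
  \<open>\<alpha> i (b e i) / v\<close>.\<close>

lemma reg_trace_eq:
  assumes "b \<in> carrier B"
  shows "reg_trace B Z b = fraction R (\<tau> b) \<one>"
proof -
  note * = ZM.frame_trace[OF frame left_mult_hom[OF assms]]
  have "\<phi> v \<noteq> 0"
    using ZM.frame_v[OF frame] by (simp add: Z.emb_eq_0_iff)
  then have "Z.val (reg_trace B Z b) = \<phi> (\<tau> b)"
    unfolding reg_trace_def *(2) using trace(2)[OF assms] by (simp flip: sum_divide_distrib)
  also have "\<dots> = Z.val (fraction R (\<tau> b) \<one>)"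
    using trace(1)[OF assms] Z.one_nonzero Z.val_fraction[of "\<tau> b" \<one>] Z.emb_one by simp
  finally show ?thesis
    using *(1) trace(1)[OF assms] Z.one_nonzero Z.fraction_closed[of "\<tau> b" \<one>]
    by (subst (asm) Z.val_eq_iff) (auto simp: reg_trace_def)
qed

text \<open>Replaces the determinant over the fraction field by a determinant over \<open>'l\<close>
  in the values of \<tau>, so that the discriminant ideal can be handled without tensor
  products.\<close>

lemma discriminant_generators:
  "{d \<in> Z. \<exists>u u'.
        u \<in> {..<generic_rank B Z} \<rightarrow> carrier B \<and> inj_on u {..<generic_rank B Z} \<and>
        u' \<in> {..<generic_rank B Z} \<rightarrow> carrier B \<and> inj_on u' {..<generic_rank B Z} \<and>
        fraction R d \<one> = ring_det (fraction_field R) (generic_rank B Z) (\<lambda>i j. reg_trace B Z (u i \<otimes> u' j))}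
   = {d \<in> Z. \<exists>u u'. u \<in> {..<w} \<rightarrow> carrier B \<and> inj_on u {..<w} \<and> u' \<in> {..<w} \<rightarrow> carrier B \<and> inj_on u' {..<w}
        \<and> \<phi> d = det (mat w w (\<lambda>(i, j). \<phi> (\<tau> (u i \<otimes> u' j))))}"
proof -
  interpret F: embedded_domain "fraction_field R" Z.val
    by (rule Z.embedded_F)
  have "fraction R d \<one> = ring_det (fraction_field R) w (\<lambda>i j. reg_trace B Z (u i \<otimes> u' j))
      \<longleftrightarrow> \<phi> d = det (mat w w (\<lambda>(i, j). \<phi> (\<tau> (u i \<otimes> u' j))))"
    if d: "d \<in> Z" and u: "u \<in> {..<w} \<rightarrow> carrier B" "u' \<in> {..<w} \<rightarrow> carrier B" for d u u'
  proof -
    have uu: "u i \<otimes> u' j \<in> carrier B" if "i < w" "j < w" for i j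
      using u that by auto
    have fr: "fraction R z \<one> \<in> carrier (fraction_field R)" "Z.val (fraction R z \<one>) = \<phi> z" if "z \<in> Z" for z
      using that Z.one_nonzero Z.fraction_closed[of z \<one>] Z.val_fraction[of z \<one>] Z.emb_one by simp_all
    have rt: "reg_trace B Z (u i \<otimes> u' j) \<in> carrier (fraction_field R)"
        "Z.val (reg_trace B Z (u i \<otimes> u' j)) = \<phi> (\<tau> (u i \<otimes> u' j))" if "i < w" "j < w" for i j
      using uu[OF that] trace(1) by (simp_all add: reg_trace_eq fr)
    have "Z.val (ring_det (fraction_field R) w (\<lambda>i j. reg_trace B Z (u i \<otimes> u' j)))
        = det (mat w w (\<lambda>(i, j). \<phi> (\<tau> (u i \<otimes> u' j))))"
      by (subst F.emb_ring_det) (auto simp: rt intro!: arg_cong[where f = det] cong_mat)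
    moreover have "ring_det (fraction_field R) w (\<lambda>i j. reg_trace B Z (u i \<otimes> u' j)) \<in> carrier (fraction_field R)"
      by (rule F.ring_det_closed) (rule rt)
    ultimately show ?thesis
      using Z.val_eq_iff fr[OF d] by metis
  qed
  then show ?thesis
    unfolding generic_rank_eq by blast
qed

end

text \<open>
  The last hypothesis makes the matrix of the trace form monomial in the basis \<open>e\<close>, so that the
  discriminant of this basis is the product of the \<open>D i\<close>.
\<close>

context
  fixes w v e \<alpha> \<tau> \<rho> D
  assumes frame: "frame R M w v e \<alpha>"
    and trace_closed: "\<And>b. b \<in> carrier B \<Longrightarrow> \<tau> b \<in> Z"
    and trace_add: "\<And>a b. \<lbrakk>a \<in> carrier B; b \<in> carrier B\<rbrakk> \<Longrightarrow> \<phi> (\<tau> (a \<oplus> b)) = \<phi> (\<tau> a) + \<phi> (\<tau> b)"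
    and trace_smult: "\<And>z b. \<lbrakk>z \<in> Z; b \<in> carrier B\<rbrakk> \<Longrightarrow> \<phi> (\<tau> (z \<otimes> b)) = \<phi> z * \<phi> (\<tau> b)"
    and \<rho>: "\<rho> permutes {..<w}"
    and D: "\<And>i j. \<lbrakk>i < w; j < w\<rbrakk> \<Longrightarrow> \<phi> (\<tau> (e i \<otimes> e (\<rho> j))) = (if i = j then D i else 0)"
begin

lemma \<rho>_less: "i < w \<Longrightarrow> \<rho> i < w"
  using permutes_in_image[OF \<rho>, of i] by simp

text \<open>Take \<open>e\<close> as the first family and \<open>e\<close> composed with \<rho> as
  the second. Listing the second copy of the basis in the order \<rho> makes the matrix of the trace
  form diagonal, so that no sign of \<rho> appears.\<close>

lemma frame_discriminant:
  "\<exists>u u'. u \<in> {..<w} \<rightarrow> carrier B \<and> inj_on u {..<w} \<and> u' \<in> {..<w} \<rightarrow> carrier B \<and> inj_on u' {..<w}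
    \<and> (\<Prod>i<w. D i) = det (mat w w (\<lambda>(i, j). \<phi> (\<tau> (u i \<otimes> u' j))))"
proof (intro exI conjI)
  note F = ZM.frame_v[OF frame] ZM.frame_e[OF frame] ZM.frame_delta[OF frame]
  show "e \<in> {..<w} \<rightarrow> carrier B"
    using F by auto
  \<comment> \<open>Equal basis elements at different indices would make
    \<open>\<alpha> i (e i) = v\<close> equal to zero.\<close>
  show inj: "inj_on e {..<w}"
  proof (rule inj_onI)
    fix i j assume "i \<in> {..<w}" "j \<in> {..<w}" "e i = e j"
    then show "i = j"
      using F(3)[of i i] F(3)[of i j] F(1) by (auto split: if_splits)
  qed
  show "e \<circ> \<rho> \<in> {..<w} \<rightarrow> carrier B"
    using F \<rho>_less by auto
  show "inj_on (e \<circ> \<rho>) {..<w}"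
    using inj permutes_image[OF \<rho>] permutes_inj_on[OF \<rho>] by (intro comp_inj_on) auto
  have "mat w w (\<lambda>(i, j). \<phi> (\<tau> (e i \<otimes> (e \<circ> \<rho>) j))) = mat w w (\<lambda>(i, j). if i = j then D i else 0)"
    by (intro cong_mat) (auto simp: D)
  then show "(\<Prod>i<w. D i) = det (mat w w (\<lambda>(i, j). \<phi> (\<tau> (e i \<otimes> (e \<circ> \<rho>) j))))"
    by (simp add: det_diagonal)
qed

text \<open>With \<open>A\<close> and \<open>C\<close> the numerators of the coordinates of both
  families, \<open>v^2\<close> times the matrix of the trace form is \<open>A diag(D) C\<close>.
  Each of the \<open>w\<close> rows contributes \<open>v^2\<close>, hence the exponent
  \<open>2 * w\<close>. The cofactor \<open>r\<close> is the product of the determinants of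
  \<open>A\<close> and \<open>C\<close>, which lies in \<open>Z\<close> because the entries
  do.\<close>

lemma discriminant_divisible:
  assumes u: "u \<in> {..<w} \<rightarrow> carrier B" "u' \<in> {..<w} \<rightarrow> carrier B"
  shows "\<exists>r\<in>Z. \<phi> v ^ (2 * w) * det (mat w w (\<lambda>(i, j). \<phi> (\<tau> (u i \<otimes> u' j)))) = (\<Prod>i<w. D i) * \<phi> r"
proof -
  note F = ZM.frame_v[OF frame] ZM.frame_e[OF frame] ZM.frame_closed[OF frame]
  let ?T = "\<lambda>x y. \<phi> (\<tau> (x \<otimes> y))"
  have T_left: "\<phi> v * ?T x y = (\<Sum>c<w. \<phi> (\<alpha> c x) * ?T (e c) y)" if "x \<in> carrier B" "y \<in> carrier B" for x y
    by (rule frame_functional[OF frame, where l = "\<lambda>x. ?T x y"])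
      (use that in \<open>auto simp: B.l_distr trace_add trace_smult Z_closed B.m_assoc\<close>)
  have T_right: "\<phi> v * ?T x y = (\<Sum>c<w. \<phi> (\<alpha> c y) * ?T x (e c))" if "x \<in> carrier B" "y \<in> carrier B" for x y
  proof (rule frame_functional[OF frame, where l = "?T x"])
    fix z y assume "z \<in> Z" "y \<in> carrier B"
    then show "?T x (z \<otimes> y) = \<phi> z * ?T x y"
      using that by (subst Z_lcomm) (simp_all add: trace_smult)
  qed (use that in \<open>auto simp: B.r_distr trace_add\<close>)
  \<comment> \<open>After reindexing the sum by \<rho>, the form vanishes at all indices but
    \<open>c\<close>.\<close>
  have e_right: "\<phi> v * ?T (e c) y = D c * \<phi> (\<alpha> (\<rho> c) y)" if "c < w" "y \<in> carrier B" for c y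
  proof -
    have "\<phi> v * ?T (e c) y = (\<Sum>d<w. \<phi> (\<alpha> d y) * ?T (e c) (e d))"
      using that F by (intro T_right) auto
    also have "\<dots> = (\<Sum>d<w. \<phi> (\<alpha> (\<rho> d) y) * ?T (e c) (e (\<rho> d)))"
      using sum.permute[OF \<rho>, of "\<lambda>d. \<phi> (\<alpha> d y) * ?T (e c) (e d)"] by (simp add: comp_def)
    also have "\<dots> = (\<Sum>d<w. if c = d then \<phi> (\<alpha> (\<rho> d) y) * D c else 0)"
      using that by (intro sum.cong HOL.refl) (auto simp: D)
    also have "\<dots> = D c * \<phi> (\<alpha> (\<rho> c) y)"
      using that by simp
    finally show ?thesis .
  qed
  define A where "A a c = \<alpha> c (u a)" for a c
  define C where "C c b = \<alpha> (\<rho> c) (u' b)" for c b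
  have AC: "A a c \<in> Z" "C a c \<in> Z" if "a < w" "c < w" for a c
    using that u F(3) \<rho>_less by (auto simp: A_def C_def Pi_iff)
  let ?A = "mat w w (\<lambda>(i, j). \<phi> (A i j))" and ?C = "mat w w (\<lambda>(i, j). D i * \<phi> (C i j))"
  have "(\<phi> v ^ 2) \<cdot>\<^sub>m mat w w (\<lambda>(i, j). ?T (u i) (u' j)) = ?A * ?C"
  proof (rule eq_matI)
    fix a b assume "a < dim_row (?A * ?C)" "b < dim_col (?A * ?C)"
    then have ab: "a < w" "b < w" by auto
    then have ub: "u a \<in> carrier B" "u' b \<in> carrier B"
      using u by auto
    have "\<phi> v ^ 2 * ?T (u a) (u' b) = \<phi> v * (\<Sum>c<w. \<phi> (\<alpha> c (u a)) * ?T (e c) (u' b))"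
      using T_left[OF ub] by (simp add: power2_eq_square mult.assoc)
    also have "\<dots> = (\<Sum>c<w. \<phi> (\<alpha> c (u a)) * (\<phi> v * ?T (e c) (u' b)))"
      by (simp add: sum_distrib_left mult.left_commute)
    also have "\<dots> = (\<Sum>c<w. \<phi> (A a c) * (D c * \<phi> (C c b)))"
      using ub by (intro sum.cong HOL.refl) (simp add: A_def C_def e_right)
    finally show "((\<phi> v ^ 2) \<cdot>\<^sub>m mat w w (\<lambda>(i, j). ?T (u i) (u' j))) $$ (a, b) = (?A * ?C) $$ (a, b)"
      using ab by (simp add: scalar_prod_def lessThan_atLeast0)
  qed auto
  then have "det ((\<phi> v ^ 2) \<cdot>\<^sub>m mat w w (\<lambda>(i, j). ?T (u i) (u' j))) = det ?A * det ?C"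
    by (simp add: det_mult[of _ w])
  then have "\<phi> v ^ (2 * w) * det (mat w w (\<lambda>(i, j). ?T (u i) (u' j)))
      = (\<Prod>i<w. D i) * (det ?A * det (mat w w (\<lambda>(i, j). \<phi> (C i j))))"
    by (simp add: det_scale_rows power_mult mult.left_commute)
  also have "det ?A = \<phi> (ring_det R w A)"
    by (subst Z.emb_ring_det) (simp_all add: AC)
  also have "det (mat w w (\<lambda>(i, j). \<phi> (C i j))) = \<phi> (ring_det R w C)"
    by (subst Z.emb_ring_det) (simp_all add: AC)
  also have "\<phi> (ring_det R w A) * \<phi> (ring_det R w C) = \<phi> (ring_det R w A \<otimes> ring_det R w C)"
    using Z.ring_det_closed[of w A] Z.ring_det_closed[of w C] AC Z.emb_mult by simp
  finally have eq: "\<phi> v ^ (2 * w) * det (mat w w (\<lambda>(i, j). ?T (u i) (u' j)))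
      = (\<Prod>i<w. D i) * \<phi> (ring_det R w A \<otimes> ring_det R w C)" .
  have "ring_det R w A \<otimes> ring_det R w C \<in> Z"
    using Z.ring_det_closed[of w A] Z.ring_det_closed[of w C] AC
      Z.m_closed[of "ring_det R w A" "ring_det R w C"] by simp
  with eq show ?thesis ..
qed

end

end

section \<open>Reflexive modules and reflexive hulls\<close>

lemma dual_simps [simp]:
  "f \<oplus>\<^bsub>dual R M\<^esub> g = (\<lambda>m\<in>carrier M. f m \<oplus>\<^bsub>R\<^esub> g m)"
  "r \<odot>\<^bsub>dual R M\<^esub> f = (\<lambda>m\<in>carrier M. r \<otimes>\<^bsub>R\<^esub> f m)"
  by (simp_all add: dual_def)

lemma dual_closed: "\<lbrakk>f \<in> carrier (dual R M); m \<in> carrier M\<rbrakk> \<Longrightarrow> f m \<in> carrier R"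
  and dual_add: "\<lbrakk>f \<in> carrier (dual R M); m \<in> carrier M; m' \<in> carrier M\<rbrakk>
    \<Longrightarrow> f (m \<oplus>\<^bsub>M\<^esub> m') = f m \<oplus>\<^bsub>R\<^esub> f m'"
  and dual_smult: "\<lbrakk>f \<in> carrier (dual R M); r \<in> carrier R; m \<in> carrier M\<rbrakk>
    \<Longrightarrow> f (r \<odot>\<^bsub>M\<^esub> m) = r \<otimes>\<^bsub>R\<^esub> f m"
  and dual_extensional: "f \<in> carrier (dual R M) \<Longrightarrow> f \<in> extensional (carrier M)"
  by (simp_all add: dual_iff)

lemma (in module) dual_plus_closed:
  "\<lbrakk>f \<in> carrier (dual R M); g \<in> carrier (dual R M)\<rbrakk> \<Longrightarrow> (\<lambda>m\<in>carrier M. f m \<oplus> g m) \<in> carrier (dual R M)"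
  by (auto simp: dual_iff R.a_ac R.r_distr)

lemma (in module) dual_scale_closed:
  "\<lbrakk>r \<in> carrier R; f \<in> carrier (dual R M)\<rbrakk> \<Longrightarrow> (\<lambda>m\<in>carrier M. r \<otimes> f m) \<in> carrier (dual R M)"
  by (auto simp: dual_iff R.r_distr R.m_lcomm)

lemma (in module) dual_finsum:
  assumes f: "f \<in> carrier (dual R M)" and A: "finite A" "g \<in> A \<rightarrow> carrier M"
  shows "f (finsum M g A) = (\<Oplus>i\<in>A. f (g i))"
  using A
proof (induction A)
  case empty
  have "f \<zero>\<^bsub>M\<^esub> = \<zero>"
    using dual_smult[OF f, of "\<zero>" "\<zero>\<^bsub>M\<^esub>"] dual_closed[OF f] by simp
  then show ?case by simp
next
  case (insert x A)
  then have "f (g x) \<in> carrier R" "(\<lambda>i. f (g i)) \<in> A \<rightarrow> carrier R"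
    using dual_closed[OF f] by auto
  with insert show ?case
    by (simp add: dual_add[OF f] Pi_iff)
qed

lemma (in module) smult_lcomm:
  assumes "r \<in> carrier R" "s \<in> carrier R" "m \<in> carrier M"
  shows "r \<odot>\<^bsub>M\<^esub> (s \<odot>\<^bsub>M\<^esub> m) = s \<odot>\<^bsub>M\<^esub> (r \<odot>\<^bsub>M\<^esub> m)"
  using assms smult_assoc1[of r s m] smult_assoc1[of s r m] R.m_comm[of r s] by simp

text \<open>Membership and value are proved together, because additivity of \<xi> applies only to
  summands known to lie in the dual.\<close>

lemma (in module) bidual_lincomb:
  assumes \<xi>: "\<xi> \<in> carrier (dual R (dual R M))"
    and A: "finite A" "c \<in> A \<rightarrow> carrier R" "\<And>i. i \<in> A \<Longrightarrow> a i \<in> carrier (dual R M)"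
  shows "(\<lambda>m\<in>carrier M. \<Oplus>i\<in>A. c i \<otimes> a i m) \<in> carrier (dual R M)
    \<and> \<xi> (\<lambda>m\<in>carrier M. \<Oplus>i\<in>A. c i \<otimes> a i m) = (\<Oplus>i\<in>A. c i \<otimes> \<xi> (a i))"
  using A
proof (induction A)
  case empty
  let ?z = "\<lambda>m\<in>carrier M. \<zero>"
  have z: "?z \<in> carrier (dual R M)"
    by (auto simp: dual_iff)
  have "(\<lambda>m\<in>carrier M. \<zero> \<otimes> ?z m) = ?z"
    by (auto simp: restrict_def)
  then have "\<xi> ?z = \<zero>"
    using dual_smult[OF \<xi>, of "\<zero>" ?z] dual_closed[OF \<xi> z] z by simp
  with z show ?case by (simp add: restrict_def)
next
  case (insert x A)
  let ?g = "\<lambda>m\<in>carrier M. \<Oplus>i\<in>A. c i \<otimes> a i m" and ?h = "\<lambda>m\<in>carrier M. c x \<otimes> a x m"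
  have g: "?g \<in> carrier (dual R M)" "\<xi> ?g = (\<Oplus>i\<in>A. c i \<otimes> \<xi> (a i))"
    using insert.IH insert.prems by blast+
  have h: "?h \<in> carrier (dual R M)" "\<xi> ?h = c x \<otimes> \<xi> (a x)"
    using insert dual_smult[OF \<xi>, of "c x" "a x"] by (auto intro!: dual_scale_closed)
  have eq: "(\<lambda>m\<in>carrier M. \<Oplus>i\<in>insert x A. c i \<otimes> a i m) = (\<lambda>m\<in>carrier M. ?h m \<oplus> ?g m)"
  proof (rule restrict_ext)
    fix m assume m: "m \<in> carrier M"
    then show "(\<Oplus>i\<in>insert x A. c i \<otimes> a i m) = ?h m \<oplus> ?g m"
      using insert dual_closed[OF _ m] by (subst R.finsum_insert) (auto simp: Pi_iff)
  qed
  have sum: "(\<Oplus>i\<in>insert x A. c i \<otimes> \<xi> (a i))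
      = c x \<otimes> \<xi> (a x) \<oplus> (\<Oplus>i\<in>A. c i \<otimes> \<xi> (a i))"
    using insert dual_closed[OF \<xi>] by (subst R.finsum_insert) (auto simp: Pi_iff)
  have "\<xi> (\<lambda>m\<in>carrier M. ?h m \<oplus> ?g m) = \<xi> ?h \<oplus> \<xi> ?g"
    using dual_add[OF \<xi> h(1) g(1)] unfolding dual_simps .
  then show ?case
    unfolding eq sum h(2) g(2) using dual_plus_closed[OF h(1) g(1)] by (rule conjI[rotated])
qed

text \<open>For every \<open>f\<close> in the dual, the frame writes \<open>v f\<close> as the
  combination of the \<open>\<alpha> i\<close> with coefficients \<open>f (e i)\<close>. Hence
  \<open>v \<xi>\<close> is evaluation at the vector with coefficients
  \<open>\<xi> (\<alpha> i)\<close>.\<close>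

lemma (in module) frame_bidual:
  assumes frame: "frame R M w v e \<alpha>"
    and \<xi>: "\<xi> \<in> carrier (dual R (dual R M))"
  shows "\<exists>m\<in>carrier M. \<forall>f\<in>carrier (dual R M). f m = v \<otimes> \<xi> f"
proof
  have v: "v \<in> carrier R" and e: "\<And>i. i < w \<Longrightarrow> e i \<in> carrier M"
    and \<alpha>: "\<And>i. i < w \<Longrightarrow> \<alpha> i \<in> carrier (dual R M)"
    and expand: "\<And>m. m \<in> carrier M \<Longrightarrow> v \<odot>\<^bsub>M\<^esub> m = (\<Oplus>\<^bsub>M\<^esub>i\<in>{..<w}. \<alpha> i m \<odot>\<^bsub>M\<^esub> e i)"
    using frame by (auto simp: frame_def)
  let ?m = "\<Oplus>\<^bsub>M\<^esub>i\<in>{..<w}. \<xi> (\<alpha> i) \<odot>\<^bsub>M\<^esub> e i"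
  have \<xi>\<alpha>: "\<xi> (\<alpha> i) \<in> carrier R" if "i < w" for i
    using dual_closed[OF \<xi>] \<alpha> that by simp
  show "?m \<in> carrier M"
    using e \<xi>\<alpha> by (intro M.finsum_closed) auto
  show "\<forall>f\<in>carrier (dual R M). f ?m = v \<otimes> \<xi> f"
  proof
    fix f assume f: "f \<in> carrier (dual R M)"
    have fe: "f (e i) \<in> carrier R" if "i < w" for i
      using dual_closed[OF f] e that by simp
    have "f ?m = (\<Oplus>i\<in>{..<w}. f (\<xi> (\<alpha> i) \<odot>\<^bsub>M\<^esub> e i))"
      using e \<xi>\<alpha> by (intro dual_finsum[OF f]) auto
    also have "\<dots> = (\<Oplus>i\<in>{..<w}. f (e i) \<otimes> \<xi> (\<alpha> i))"
      using e \<xi>\<alpha> fe by (intro R.finsum_cong') (auto simp: dual_smult[OF f] R.m_comm)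
    also have "\<dots> = \<xi> (\<lambda>m\<in>carrier M. \<Oplus>i\<in>{..<w}. f (e i) \<otimes> \<alpha> i m)"
      using bidual_lincomb[OF \<xi>, of "{..<w}" "\<lambda>i. f (e i)" \<alpha>] fe \<alpha> by auto
    also have "(\<lambda>m\<in>carrier M. \<Oplus>i\<in>{..<w}. f (e i) \<otimes> \<alpha> i m) = (\<lambda>m\<in>carrier M. v \<otimes> f m)"
    proof (rule restrict_ext)
      fix m assume m: "m \<in> carrier M"
      have \<alpha>m: "\<alpha> i m \<in> carrier R" if "i < w" for i
        using dual_closed[OF \<alpha>[OF that] m] .
      have "v \<otimes> f m = f (\<Oplus>\<^bsub>M\<^esub>i\<in>{..<w}. \<alpha> i m \<odot>\<^bsub>M\<^esub> e i)"
        using m v by (simp add: dual_smult[OF f, symmetric] expand)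
      also have "\<dots> = (\<Oplus>i\<in>{..<w}. f (\<alpha> i m \<odot>\<^bsub>M\<^esub> e i))"
        using e \<alpha>m by (intro dual_finsum[OF f]) auto
      also have "\<dots> = (\<Oplus>i\<in>{..<w}. f (e i) \<otimes> \<alpha> i m)"
        using e \<alpha>m fe by (intro R.finsum_cong') (auto simp: dual_smult[OF f] R.m_comm)
      finally show "(\<Oplus>i\<in>{..<w}. f (e i) \<otimes> \<alpha> i m) = v \<otimes> f m"
        by simp
    qed
    also have "\<xi> \<dots> = v \<otimes> \<xi> f"
      using dual_smult[OF \<xi> v f] by simp
    finally show "f ?m = v \<otimes> \<xi> f" .
  qed
qed

text \<open>
  The depth condition \<open>reg\<close> glues the two vectors that the frames at \<open>p\<close> and \<open>q\<close> produce from an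
  element of the bidual.
\<close>

lemma (in module) reflexive_if_two_frames:
  assumes dom: "domain R"
    and frames: "frame R M w p e \<alpha>" "frame R M w' q f \<beta>"
    and cancel: "\<And>m. \<lbrakk>m \<in> carrier M; p \<odot>\<^bsub>M\<^esub> m = \<zero>\<^bsub>M\<^esub>\<rbrakk> \<Longrightarrow> m = \<zero>\<^bsub>M\<^esub>"
    and reg: "\<And>m m'. \<lbrakk>m \<in> carrier M; m' \<in> carrier M; q \<odot>\<^bsub>M\<^esub> m = p \<odot>\<^bsub>M\<^esub> m'\<rbrakk>
      \<Longrightarrow> \<exists>m''\<in>carrier M. m = p \<odot>\<^bsub>M\<^esub> m''"
  shows "reflexive_module R M"
proof -
  interpret D: domain R by fact
  have p: "p \<in> carrier R" "p \<noteq> \<zero>" and q: "q \<in> carrier R"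
    and \<alpha>: "\<And>i. i < w \<Longrightarrow> \<alpha> i \<in> carrier (dual R M)"
    and e: "\<And>i. i < w \<Longrightarrow> e i \<in> carrier M"
    and expand: "\<And>m. m \<in> carrier M \<Longrightarrow> p \<odot>\<^bsub>M\<^esub> m = (\<Oplus>\<^bsub>M\<^esub>i\<in>{..<w}. \<alpha> i m \<odot>\<^bsub>M\<^esub> e i)"
    using frames by (auto simp: frame_def)
  \<comment> \<open>The \<open>\<alpha> i\<close> alone separate points: they determine
    \<open>p m\<close>, and \<open>p\<close> acts injectively.\<close>
  have separate: "m = m'"
    if m: "m \<in> carrier M" "m' \<in> carrier M" and eq: "\<And>g. g \<in> carrier (dual R M) \<Longrightarrow> g m = g m'" for m m'
  proof -
    have "p \<odot>\<^bsub>M\<^esub> m = p \<odot>\<^bsub>M\<^esub> m'"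
      unfolding expand[OF m(1)] expand[OF m(2)]
      using \<alpha> e m dual_closed[OF \<alpha> m(2)] by (intro M.finsum_cong') (auto simp: eq)
    then have "p \<odot>\<^bsub>M\<^esub> (m \<ominus>\<^bsub>M\<^esub> m') = \<zero>\<^bsub>M\<^esub>"
      using m p by (simp add: M.minus_eq smult_r_distr smult_r_minus M.r_neg)
    then have "m \<ominus>\<^bsub>M\<^esub> m' = \<zero>\<^bsub>M\<^esub>"
      using cancel m by simp
    then show ?thesis
      using m by simp
  qed
  show ?thesis
    unfolding reflexive_module_def bij_betw_def
  proof (intro conjI equalityI subsetI)
    show "inj_on (\<lambda>m. \<lambda>f\<in>carrier (dual R M). f m) (carrier M)"
    proof (rule inj_onI)
      fix m m' assume m: "m \<in> carrier M" "m' \<in> carrier M"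
        and eq: "(\<lambda>f\<in>carrier (dual R M). f m) = (\<lambda>f\<in>carrier (dual R M). f m')"
      show "m = m'"
      proof (rule separate[OF m])
        fix g assume "g \<in> carrier (dual R M)"
        then show "g m = g m'"
          using fun_cong[OF eq, of g] by simp
      qed
    qed
  next
    fix \<xi> assume "\<xi> \<in> (\<lambda>m. \<lambda>f\<in>carrier (dual R M). f m) ` carrier M"
    then obtain m where m: "m \<in> carrier M" "\<xi> = (\<lambda>f\<in>carrier (dual R M). f m)" by blast
    then show "\<xi> \<in> carrier (dual R (dual R M))"
      using dual_plus_closed dual_scale_closed by (simp add: dual_iff[of _ R "dual R M"] dual_closed)
  next
    fix \<xi> assume \<xi>: "\<xi> \<in> carrier (dual R (dual R M))"
    obtain a where a: "a \<in> carrier M" "\<And>g. g \<in> carrier (dual R M) \<Longrightarrow> g a = p \<otimes> \<xi> g"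
      using frame_bidual[OF frames(1) \<xi>] by blast
    obtain b where b: "b \<in> carrier M" "\<And>g. g \<in> carrier (dual R M) \<Longrightarrow> g b = q \<otimes> \<xi> g"
      using frame_bidual[OF frames(2) \<xi>] by blast
    \<comment> \<open>Every functional takes on both sides the value of
      \<open>p q \<xi>\<close>.\<close>
    have "q \<odot>\<^bsub>M\<^esub> a = p \<odot>\<^bsub>M\<^esub> b"
    proof (rule separate)
      fix g assume g: "g \<in> carrier (dual R M)"
      show "g (q \<odot>\<^bsub>M\<^esub> a) = g (p \<odot>\<^bsub>M\<^esub> b)"
        using g p q a(1) b(1) a(2)[OF g] b(2)[OF g] dual_closed[OF \<xi> g]
        by (simp add: dual_smult R.m_lcomm)
    qed (use a b p q in auto)
    then obtain m where m: "m \<in> carrier M" "a = p \<odot>\<^bsub>M\<^esub> m"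
      using reg a b by blast
    have "\<xi> g = g m" if g: "g \<in> carrier (dual R M)" for g
    proof -
      have "p \<otimes> \<xi> g = p \<otimes> g m"
        using a(2)[OF g] g m p by (simp add: dual_smult)
      then show ?thesis
        using D.m_lcancel[of p "\<xi> g" "g m"] p g m dual_closed[OF \<xi> g] dual_closed[OF g m(1)] by simp
    qed
    then have "\<xi> = (\<lambda>g\<in>carrier (dual R M). g m)"
      using dual_extensional[OF \<xi>] by (intro extensionalityI[of _ "carrier (dual R M)"]) simp_all
    then show "\<xi> \<in> (\<lambda>m. \<lambda>f\<in>carrier (dual R M). f m) ` carrier M"
      using m by blast
  qed
qed

text \<open>A functional on \<open>N\<close> determines a value at each \<open>n\<close> in
  \<open>d M\<close>: the elements \<open>p n\<close> and \<open>q n\<close> lie in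
  \<open>N\<close>, and the condition \<open>reg\<close> allows division of the value at
  \<open>p n\<close> by \<open>p\<close>. So \<open>d M\<close> is contained in the hull of
  \<open>N\<close>. Conversely \<open>N\<close> lies in \<open>d M\<close>, a copy of the reflexive
  module \<open>M\<close>, and so does its hull.\<close>

lemma (in module) bidual_in_eq_scaled:
  assumes dom: "domain R" and refl: "reflexive_module R M"
    and N: "submodule R N M" and d: "d \<in> carrier R" and p: "p \<in> carrier R" "p \<noteq> \<zero>" and q: "q \<in> carrier R"
    and N_sub: "\<And>x. x \<in> N \<Longrightarrow> \<exists>m\<in>carrier M. x = d \<odot>\<^bsub>M\<^esub> m"
    and N_sup: "\<And>m. m \<in> carrier M \<Longrightarrow> p \<odot>\<^bsub>M\<^esub> (d \<odot>\<^bsub>M\<^esub> m) \<in> N" "\<And>m. m \<in> carrier M \<Longrightarrow> q \<odot>\<^bsub>M\<^esub> (d \<odot>\<^bsub>M\<^esub> m) \<in> N"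
    and cancel: "\<And>m m'. \<lbrakk>m \<in> carrier M; m' \<in> carrier M; d \<odot>\<^bsub>M\<^esub> m = d \<odot>\<^bsub>M\<^esub> m'\<rbrakk> \<Longrightarrow> m = m'"
    and reg: "\<And>a b. \<lbrakk>a \<in> carrier R; b \<in> carrier R; q \<otimes> a = p \<otimes> b\<rbrakk> \<Longrightarrow> \<exists>c\<in>carrier R. a = p \<otimes> c"
  shows "bidual_in R M N = {d \<odot>\<^bsub>M\<^esub> m | m. m \<in> carrier M}"
proof (intro equalityI subsetI)
  interpret D: domain R by fact
  interpret N: submodule R N M by fact
  interpret MN: module R "M\<lparr>carrier := N\<rparr>"
    by (rule submodule_is_module) fact
  have bij: "bij_betw (\<lambda>m. \<lambda>f\<in>carrier (dual R M). f m) (carrier M) (carrier (dual R (dual R M)))"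
    using refl by (simp add: reflexive_module_def)
  have NM: "x \<in> carrier M" if "x \<in> N" for x
    using that N.subset by auto
  {
    fix n assume "n \<in> bidual_in R M N"
    then obtain \<xi> where n: "n \<in> carrier M" and \<xi>: "\<xi> \<in> carrier (dual R (dual R (M\<lparr>carrier := N\<rparr>)))"
      and \<xi>n: "\<And>f. f \<in> carrier (dual R M) \<Longrightarrow> \<xi> (restrict f N) = f n"
      by (auto simp: bidual_in_def)
    \<comment> \<open>Division by \<open>d\<close>, unambiguous by \<open>cancel\<close>.\<close>
    define \<delta> where "\<delta> x = (SOME m. m \<in> carrier M \<and> x = d \<odot>\<^bsub>M\<^esub> m)" for x
    have \<delta>': "\<delta> x \<in> carrier M \<and> x = d \<odot>\<^bsub>M\<^esub> \<delta> x" if "x \<in> N" for x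
      unfolding \<delta>_def by (rule someI_ex) (use N_sub[OF that] in blast)
    have \<delta>: "\<delta> x \<in> carrier M" "d \<odot>\<^bsub>M\<^esub> \<delta> x = x" if "x \<in> N" for x
      using conjunct1[OF \<delta>'[OF that]] conjunct2[OF \<delta>'[OF that], symmetric] .
    have \<delta>_eq: "\<delta> x = m" if "x \<in> N" "m \<in> carrier M" "x = d \<odot>\<^bsub>M\<^esub> m" for x m
      by (rule cancel) (use that \<delta>[of x] in auto)
    have \<delta>_add: "\<delta> (x \<oplus>\<^bsub>M\<^esub> y) = \<delta> x \<oplus>\<^bsub>M\<^esub> \<delta> y" if "x \<in> N" "y \<in> N" for x y
      by (rule \<delta>_eq) (use that \<delta>[of x] \<delta>[of y] d in \<open>auto simp: smult_r_distr\<close>)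
    have \<delta>_smult: "\<delta> (r \<odot>\<^bsub>M\<^esub> x) = r \<odot>\<^bsub>M\<^esub> \<delta> x" if "r \<in> carrier R" "x \<in> N" for r x
    proof (rule \<delta>_eq)
      have "r \<odot>\<^bsub>M\<^esub> x = r \<odot>\<^bsub>M\<^esub> (d \<odot>\<^bsub>M\<^esub> \<delta> x)"
        using \<delta>(2)[OF that(2)] by simp
      also have "\<dots> = d \<odot>\<^bsub>M\<^esub> (r \<odot>\<^bsub>M\<^esub> \<delta> x)"
        using that d \<delta> by (intro smult_lcomm) auto
      finally show "r \<odot>\<^bsub>M\<^esub> x = d \<odot>\<^bsub>M\<^esub> (r \<odot>\<^bsub>M\<^esub> \<delta> x)" .
    qed (use that \<delta> in auto)
    \<comment> \<open>Pullback of functionals along the division map from \<open>N\<close> to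
      \<open>M\<close>. Composed with it, \<xi> becomes an element of the bidual of
      \<open>M\<close>, hence evaluation at some \<open>m\<close>.\<close>
    define \<psi> where "\<psi> f = (\<lambda>x\<in>N. f (\<delta> x))" for f :: "'c \<Rightarrow> 'a"
    have \<psi>: "\<psi> f \<in> carrier (dual R (M\<lparr>carrier := N\<rparr>))" if "f \<in> carrier (dual R M)" for f
      using that \<delta> by (auto simp: \<psi>_def dual_iff \<delta>_add \<delta>_smult)
    have "(\<lambda>f\<in>carrier (dual R M). \<xi> (\<psi> f)) \<in> carrier (dual R (dual R M))"
      unfolding dual_iff[of _ R "dual R M"]
    proof (intro conjI ballI)
      fix f g assume f: "f \<in> carrier (dual R M)" and g: "g \<in> carrier (dual R M)"
      have "\<psi> (\<lambda>m\<in>carrier M. f m \<oplus> g m) = (\<lambda>x\<in>N. \<psi> f x \<oplus> \<psi> g x)"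
        using \<delta> by (auto simp: \<psi>_def)
      then show "(\<lambda>f\<in>carrier (dual R M). \<xi> (\<psi> f)) (f \<oplus>\<^bsub>dual R M\<^esub> g)
          = (\<lambda>f\<in>carrier (dual R M). \<xi> (\<psi> f)) f \<oplus> (\<lambda>f\<in>carrier (dual R M). \<xi> (\<psi> f)) g"
        using f g dual_add[OF \<xi> \<psi>[OF f] \<psi>[OF g]] by (simp add: dual_plus_closed)
    next
      fix r f assume r: "r \<in> carrier R" and f: "f \<in> carrier (dual R M)"
      have "\<psi> (\<lambda>m\<in>carrier M. r \<otimes> f m) = (\<lambda>x\<in>N. r \<otimes> \<psi> f x)"
        using \<delta> by (auto simp: \<psi>_def)
      then show "(\<lambda>f\<in>carrier (dual R M). \<xi> (\<psi> f)) (r \<odot>\<^bsub>dual R M\<^esub> f)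
          = r \<otimes> (\<lambda>f\<in>carrier (dual R M). \<xi> (\<psi> f)) f"
        using r f dual_smult[OF \<xi> r \<psi>[OF f]] by (simp add: dual_scale_closed)
    qed (use \<psi> dual_closed[OF \<xi>] in auto)
    then obtain m where m: "m \<in> carrier M"
      "(\<lambda>f\<in>carrier (dual R M). \<xi> (\<psi> f)) = (\<lambda>f\<in>carrier (dual R M). f m)"
      using bij unfolding bij_betw_def by blast
    have "f n = f (d \<odot>\<^bsub>M\<^esub> m)" if f: "f \<in> carrier (dual R M)" for f
    proof -
      \<comment> \<open>On \<open>N\<close>, the functional \<open>f\<close> is \<open>d\<close>
        times its own pullback, so \<open>f n\<close> becomes \<open>d\<close> times
        \<open>f m\<close>.\<close>
      have "restrict f N = (\<lambda>x\<in>N. d \<otimes> \<psi> f x)"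
      proof (rule restrict_ext)
        fix x assume x: "x \<in> N"
        have "f x = f (d \<odot>\<^bsub>M\<^esub> \<delta> x)"
          using \<delta>(2)[OF x] by simp
        also have "\<dots> = d \<otimes> f (\<delta> x)"
          using f d \<delta>(1)[OF x] by (rule dual_smult)
        finally show "f x = d \<otimes> \<psi> f x"
          using x by (simp add: \<psi>_def)
      qed
      then have "f n = d \<otimes> \<xi> (\<psi> f)"
        using \<xi>n[OF f] dual_smult[OF \<xi> d \<psi>[OF f]] by simp
      also have "\<xi> (\<psi> f) = f m"
        using fun_cong[OF m(2), of f] f by simp
      finally show ?thesis
        using f d m by (simp add: dual_smult)
    qed
    then have "(\<lambda>f\<in>carrier (dual R M). f n) = (\<lambda>f\<in>carrier (dual R M). f (d \<odot>\<^bsub>M\<^esub> m))"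
      by (intro restrict_ext) simp
    then have "n = d \<odot>\<^bsub>M\<^esub> m"
      using bij n m d unfolding bij_betw_def by (auto dest: inj_onD)
    with m show "n \<in> {d \<odot>\<^bsub>M\<^esub> m | m. m \<in> carrier M}" by blast
  next
    fix n assume "n \<in> {d \<odot>\<^bsub>M\<^esub> m | m. m \<in> carrier M}"
    then obtain m where m: "m \<in> carrier M" "n = d \<odot>\<^bsub>M\<^esub> m" by blast
    then have n: "n \<in> carrier M" and pn: "p \<odot>\<^bsub>M\<^esub> n \<in> N" and qn: "q \<odot>\<^bsub>M\<^esub> n \<in> N"
      using d N_sup by auto
    let ?D = "dual R (M\<lparr>carrier := N\<rparr>)"
    \<comment> \<open>Both \<open>q \<psi>(p n)\<close> and \<open>p \<psi>(q n)\<close> are the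
      value of \<psi> at \<open>p q n\<close>, so \<open>reg\<close> divides out
      \<open>p\<close>.\<close>
    have "\<exists>c\<in>carrier R. \<psi> (p \<odot>\<^bsub>M\<^esub> n) = p \<otimes> c" if \<psi>: "\<psi> \<in> carrier ?D" for \<psi>
    proof (rule reg)
      show "\<psi> (p \<odot>\<^bsub>M\<^esub> n) \<in> carrier R" "\<psi> (q \<odot>\<^bsub>M\<^esub> n) \<in> carrier R"
        using dual_closed[OF \<psi>] pn qn by simp_all
      have "q \<otimes> \<psi> (p \<odot>\<^bsub>M\<^esub> n) = \<psi> (q \<odot>\<^bsub>M\<^esub> (p \<odot>\<^bsub>M\<^esub> n))"
        using dual_smult[OF \<psi> q, of "p \<odot>\<^bsub>M\<^esub> n"] pn by simp
      also have "q \<odot>\<^bsub>M\<^esub> (p \<odot>\<^bsub>M\<^esub> n) = p \<odot>\<^bsub>M\<^esub> (q \<odot>\<^bsub>M\<^esub> n)"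
        using n p q by (intro smult_lcomm)
      also have "\<psi> \<dots> = p \<otimes> \<psi> (q \<odot>\<^bsub>M\<^esub> n)"
        using dual_smult[OF \<psi> p(1), of "q \<odot>\<^bsub>M\<^esub> n"] qn by simp
      finally show "q \<otimes> \<psi> (p \<odot>\<^bsub>M\<^esub> n) = p \<otimes> \<psi> (q \<odot>\<^bsub>M\<^esub> n)" .
    qed
    note ex = this
    \<comment> \<open>The value that a functional on \<open>N\<close> would take at
      \<open>n\<close>. As a function of the functional, this is the element of the bidual that
      witnesses membership of \<open>n\<close> in the hull.\<close>
    define c where "c \<psi> = (SOME a. a \<in> carrier R \<and> \<psi> (p \<odot>\<^bsub>M\<^esub> n) = p \<otimes> a)" for \<psi> :: "'c \<Rightarrow> 'a"
    have "c \<psi> \<in> carrier R \<and> \<psi> (p \<odot>\<^bsub>M\<^esub> n) = p \<otimes> c \<psi>" if "\<psi> \<in> carrier ?D" for \<psi>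
      unfolding c_def by (rule someI_ex) (use ex[OF that] in blast)
    then have c: "\<And>\<psi>. \<psi> \<in> carrier ?D \<Longrightarrow> c \<psi> \<in> carrier R"
      "\<And>\<psi>. \<psi> \<in> carrier ?D \<Longrightarrow> \<psi> (p \<odot>\<^bsub>M\<^esub> n) = p \<otimes> c \<psi>"
      by blast+
    have c_eq: "c \<psi> = a" if "\<psi> \<in> carrier ?D" "a \<in> carrier R" "\<psi> (p \<odot>\<^bsub>M\<^esub> n) = p \<otimes> a" for \<psi> a
      using that c[of \<psi>] D.m_lcancel[of p "c \<psi>" a] p by simp
    have "restrict c (carrier ?D) \<in> carrier (dual R ?D)"
      unfolding dual_iff[of _ R ?D]
    proof (intro conjI ballI)
      fix f g assume fg: "f \<in> carrier ?D" "g \<in> carrier ?D"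
      then have "f \<oplus>\<^bsub>?D\<^esub> g \<in> carrier ?D"
        using MN.dual_plus_closed by simp
      moreover from this have "c (f \<oplus>\<^bsub>?D\<^esub> g) = c f \<oplus> c g"
        by (rule c_eq) (use fg c[OF fg(1)] c[OF fg(2)] pn p in \<open>simp_all add: R.r_distr\<close>)
      ultimately show "restrict c (carrier ?D) (f \<oplus>\<^bsub>?D\<^esub> g) = restrict c (carrier ?D) f \<oplus> restrict c (carrier ?D) g"
        using fg by simp
    next
      fix r f assume rf: "r \<in> carrier R" "f \<in> carrier ?D"
      then have "r \<odot>\<^bsub>?D\<^esub> f \<in> carrier ?D"
        using MN.dual_scale_closed by simp
      moreover from this have "c (r \<odot>\<^bsub>?D\<^esub> f) = r \<otimes> c f"
        by (rule c_eq) (use rf c[OF rf(2)] pn p in \<open>simp_all add: R.m_lcomm\<close>)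
      ultimately show "restrict c (carrier ?D) (r \<odot>\<^bsub>?D\<^esub> f) = r \<otimes> restrict c (carrier ?D) f"
        using rf by simp
    qed (use c in auto)
    moreover have "restrict c (carrier ?D) (restrict f N) = f n" if f: "f \<in> carrier (dual R M)" for f
    proof -
      have r: "restrict f N \<in> carrier ?D"
        using f NM by (auto simp: dual_iff)
      moreover have "c (restrict f N) = f n"
        by (rule c_eq) (use f n p pn r in \<open>simp_all add: dual_closed dual_smult\<close>)
      ultimately show ?thesis by simp
    qed
    ultimately show "n \<in> bidual_in R M N"
      unfolding bidual_in_def using n by blast
  }
qed

section \<open>Normal forms in generalized Weyl algebras\<close>

lemma gwa_class_eq_iff: "gwa_class \<sigma> h u = gwa_class \<sigma> h v \<longleftrightarrow> gwa_eq \<sigma> h u v"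
  unfolding gwa_class_def set_eq_iff mem_Collect_eq
  by (blast intro: gwa_eq.refl gwa_eq.sym gwa_eq.trans)

lemma gwa_class_self: "u \<in> gwa_class \<sigma> h u"
  by (simp add: gwa_class_def gwa_eq.refl)

lemma gwa_UN_class:
  assumes "\<And>u' v'. \<lbrakk>gwa_eq \<sigma> h u u'; gwa_eq \<sigma> h v v'\<rbrakk> \<Longrightarrow> gwa_eq \<sigma> h (f u' v') (f u v)"
  shows "(\<Union>u'\<in>gwa_class \<sigma> h u. \<Union>v'\<in>gwa_class \<sigma> h v. gwa_class \<sigma> h (f u' v')) = gwa_class \<sigma> h (f u v)"
proof -
  have "gwa_class \<sigma> h (f u' v') = gwa_class \<sigma> h (f u v)"
    if "u' \<in> gwa_class \<sigma> h u" "v' \<in> gwa_class \<sigma> h v" for u' v'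
    using that assms unfolding gwa_class_eq_iff by (simp add: gwa_class_def)
  then show ?thesis
    using gwa_class_self[of u \<sigma> h] gwa_class_self[of v \<sigma> h] by blast
qed

lemma gwa_simps:
  "carrier (gwa \<sigma> h) = range (gwa_class \<sigma> h)"
  "\<one>\<^bsub>gwa \<sigma> h\<^esub> = gwa_class \<sigma> h (Const 1)" "\<zero>\<^bsub>gwa \<sigma> h\<^esub> = gwa_class \<sigma> h (Const 0)"
  "gwa_class \<sigma> h u \<otimes>\<^bsub>gwa \<sigma> h\<^esub> gwa_class \<sigma> h v = gwa_class \<sigma> h (Times u v)"
  "gwa_class \<sigma> h u \<oplus>\<^bsub>gwa \<sigma> h\<^esub> gwa_class \<sigma> h v = gwa_class \<sigma> h (Plus u v)"
  unfolding gwa_def by (simp_all add: gwa_UN_class gwa_eq.cong_plus gwa_eq.cong_times gwa_eq.sym)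

lemma gwa_class_eqs:
  "gwa_class \<sigma> h (Plus (Plus u v) w) = gwa_class \<sigma> h (Plus u (Plus v w))"
  "gwa_class \<sigma> h (Plus (Const 0) u) = gwa_class \<sigma> h u"
  "gwa_class \<sigma> h (Plus (Neg u) u) = gwa_class \<sigma> h (Const 0)"
  "gwa_class \<sigma> h (Times (Times u v) w) = gwa_class \<sigma> h (Times u (Times v w))"
  "gwa_class \<sigma> h (Times (Const 1) u) = gwa_class \<sigma> h u"
  "gwa_class \<sigma> h (Times u (Const 1)) = gwa_class \<sigma> h u"
  "gwa_class \<sigma> h (Times u (Plus v w)) = gwa_class \<sigma> h (Plus (Times u v) (Times u w))"
  "gwa_class \<sigma> h (Times (Plus u v) w) = gwa_class \<sigma> h (Plus (Times u w) (Times v w))"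
  unfolding gwa_class_eq_iff
  by (rule gwa_eq.plus_assoc gwa_eq.plus_zero gwa_eq.plus_neg gwa_eq.times_assoc gwa_eq.times_one_left
      gwa_eq.times_one_right gwa_eq.distrib_left gwa_eq.distrib_right)+

lemma gwa_class_plus_comm: "gwa_class \<sigma> h (Plus u v) = gwa_class \<sigma> h (Plus v u)"
  unfolding gwa_class_eq_iff by (rule gwa_eq.plus_comm)

lemma ring_gwa: "ring (gwa \<sigma> h)"
proof (rule ringI)
  show "abelian_group (gwa \<sigma> h)"
  proof (rule abelian_groupI)
    fix x assume "x \<in> carrier (gwa \<sigma> h)"
    then obtain u where "x = gwa_class \<sigma> h u" by (auto simp: gwa_simps)
    then show "\<exists>y\<in>carrier (gwa \<sigma> h). y \<oplus>\<^bsub>gwa \<sigma> h\<^esub> x = \<zero>\<^bsub>gwa \<sigma> h\<^esub>"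
      by (intro bexI[of _ "gwa_class \<sigma> h (Neg u)"]) (simp_all add: gwa_simps gwa_class_eqs)
  next
    fix x y assume "x \<in> carrier (gwa \<sigma> h)" "y \<in> carrier (gwa \<sigma> h)"
    then obtain u v where "x = gwa_class \<sigma> h u" "y = gwa_class \<sigma> h v"
      by (auto simp: gwa_simps)
    then show "x \<oplus>\<^bsub>gwa \<sigma> h\<^esub> y = y \<oplus>\<^bsub>gwa \<sigma> h\<^esub> x"
      by (simp add: gwa_simps gwa_class_plus_comm[of _ _ u v])
  qed (auto simp: gwa_simps gwa_class_eqs)
  show "monoid (gwa \<sigma> h)"
    by (rule monoidI) (auto simp: gwa_simps gwa_class_eqs)
qed (auto simp: gwa_simps gwa_class_eqs)

section \<open>Substitution of \<open>a t\<close> for \<open>t\<close> in polynomials\<close>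

definition scale_var :: "'k::field \<Rightarrow> 'k poly \<Rightarrow> 'k poly" where
  "scale_var a f = f \<circ>\<^sub>p [:0, a:]"

lemma coeff_scale_var [simp]: "coeff (scale_var a f) m = a ^ m * coeff f m"
proof (induction f arbitrary: m)
  case (pCons c f)
  then show ?case
    by (cases m) (simp_all add: scale_var_def pcompose_pCons mult.assoc)
qed (simp add: scale_var_def)

lemma scale_var_add [simp]: "scale_var a (f + g) = scale_var a f + scale_var a g"
  and scale_var_mult [simp]: "scale_var a (f * g) = scale_var a f * scale_var a g"
  and scale_var_uminus [simp]: "scale_var a (- f) = - scale_var a f"
  and scale_var_0 [simp]: "scale_var a 0 = 0" and scale_var_1 [simp]: "scale_var a 1 = 1"
  and scale_var_sum: "scale_var a (\<Sum>i\<in>A. s i) = (\<Sum>i\<in>A. scale_var a (s i))"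
  and scale_var_prod: "scale_var a (\<Prod>i\<in>A. s i) = (\<Prod>i\<in>A. scale_var a (s i))"
  by (simp_all add: scale_var_def pcompose_add pcompose_mult pcompose_uminus pcompose_1
      pcompose_sum pcompose_prod)

lemma scale_var_scale_var [simp]: "scale_var a (scale_var b f) = scale_var (a * b) f"
  by (rule poly_eqI) (simp add: power_mult_distrib)

lemma scale_var_by_1 [simp]: "scale_var 1 f = f"
  by (rule poly_eqI) simp

lemma scale_var_eq_0_iff [simp]: "a \<noteq> 0 \<Longrightarrow> scale_var a f = 0 \<longleftrightarrow> f = 0"
  by (simp add: poly_eq_iff)

lemma scale_var_const [simp]: "scale_var a [:c:] = [:c:]"
  by (simp add: scale_var_def)

lemma quantum_automorphism_eq:
  assumes "quantum_automorphism q \<sigma>"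
  shows "\<sigma> = scale_var q"
proof
  fix f
  have \<sigma>: "\<sigma> (a + b) = \<sigma> a + \<sigma> b" "\<sigma> (a * b) = \<sigma> a * \<sigma> b" "\<sigma> [:c:] = [:c:]" "\<sigma> [:0, 1:] = [:0, q:]" for a b c
    using assms by (auto simp: quantum_automorphism_def ring_automorphism_def)
  show "\<sigma> f = scale_var q f"
  proof (induction f)
    case 0
    then show ?case using \<sigma>(3)[of 0] by simp
  next
    case (pCons c f)
    have "pCons c f = [:c:] + [:0, 1:] * f"
      by simp
    then have "\<sigma> (pCons c f) = [:c:] + [:0, q:] * \<sigma> f"
      using \<sigma> by metis
    then show ?case
      by (simp add: pCons scale_var_def pcompose_pCons)
  qed
qed

section \<open>Normal forms for an arbitrary nonzero \<open>q\<close>\<close>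

locale quantum_gwa =
  fixes q :: "'k::field" and h :: "'k poly"
  assumes q: "q \<noteq> 0" and h: "h \<noteq> 0"
begin

abbreviation "W \<equiv> gwa (scale_var q) h"
abbreviation "cl u \<equiv> gwa_class (scale_var q) h u"
abbreviation "sg k \<equiv> scale_var (q powi k)"

lemma inv_scale_var: "inv_into UNIV (scale_var q) = sg (- 1)"
proof (rule inv_unique_comp)
  show "scale_var q \<circ> sg (- 1) = id" "sg (- 1) \<circ> scale_var q = id"
    using q by (auto simp: power_int_minus)
qed

lemma sg_sg [simp]: "sg k (sg l f) = sg (k + l) f"
  using q by (simp add: power_int_add)

text \<open>
  The algebra acts on sequences of polynomials, thought of as formal sums of \<open>f k x\<^sup>k\<close> over all
  integers \<open>k\<close>, with \<open>y\<close> acting as \<open>x\<^sup>-\<^sup>1 h\<close>.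
\<close>

primrec ev :: "'k poly gwa_term \<Rightarrow> (int \<Rightarrow> 'k poly) \<Rightarrow> int \<Rightarrow> 'k poly" where
  "ev (Const r) f = (\<lambda>k. r * f k)"
| "ev GenX f = (\<lambda>k. scale_var q (f (k - 1)))"
| "ev GenY f = (\<lambda>k. sg (- 1) (h * f (k + 1)))"
| "ev (Plus u v) f = (\<lambda>k. ev u f k + ev v f k)"
| "ev (Neg u) f = (\<lambda>k. - ev u f k)"
| "ev (Times u v) f = ev u (ev v f)"

lemma ev_add: "ev u (\<lambda>k. f k + g k) = (\<lambda>k. ev u f k + ev u g k)"
  by (induction u arbitrary: f g) (simp_all add: algebra_simps)

text \<open>The operators satisfy the ring axioms and the four defining relations, so the algebra
  acts on sequences. The axiom \<open>distrib_left\<close> is the one that uses additivity of the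
  operators.\<close>

lemma ev_sound: "gwa_eq (scale_var q) h u v \<Longrightarrow> ev u f = ev v f"
  by (induction arbitrary: f rule: gwa_eq.induct)
    (use q in \<open>simp_all add: ev_add inv_scale_var algebra_simps power_int_minus\<close>)

definition act :: "'k poly gwa_term set \<Rightarrow> (int \<Rightarrow> 'k poly) \<Rightarrow> int \<Rightarrow> 'k poly" where
  "act w = ev (SOME u. u \<in> w)"

text \<open>The element applied to the formal sum \<open>1\<close>. The result is the coefficient
  sequence after \<open>y^j\<close> has been rewritten as a polynomial times
  \<open>x^-j\<close>.\<close>

definition cf :: "'k poly gwa_term set \<Rightarrow> int \<Rightarrow> 'k poly" where
  "cf w = act w (\<lambda>k. if k = 0 then 1 else 0)"

lemma act_cl: "act (cl u) f = ev u f"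
proof -
  have "(SOME v. v \<in> cl u) \<in> cl u"
    using gwa_class_self by (rule someI)
  then have "gwa_eq (scale_var q) h u (SOME v. v \<in> cl u)"
    unfolding gwa_class_def[of _ _ u, THEN eqset_imp_iff, simplified] .
  then show ?thesis
    unfolding act_def by (rule ev_sound[symmetric])
qed

sublocale W: ring W
  by (rule ring_gwa)

lemma W_carrierE:
  assumes "w \<in> carrier W"
  obtains u where "w = cl u"
  using assms by (auto simp: gwa_simps)

lemma cl_closed [simp]: "cl u \<in> carrier W"
  by (simp add: gwa_simps)

lemma act_mult: "\<lbrakk>a \<in> carrier W; b \<in> carrier W\<rbrakk> \<Longrightarrow> act (a \<otimes>\<^bsub>W\<^esub> b) f = act a (act b f)"
  and act_add: "\<lbrakk>a \<in> carrier W; b \<in> carrier W\<rbrakk> \<Longrightarrow> act (a \<oplus>\<^bsub>W\<^esub> b) f = (\<lambda>k. act a f k + act b f k)"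
  and act_zero: "act \<zero>\<^bsub>W\<^esub> f = (\<lambda>k. 0)" and act_one: "act \<one>\<^bsub>W\<^esub> f = f"
  by (auto elim!: W_carrierE simp: gwa_simps act_cl)

lemma act_finsum:
  "\<lbrakk>finite A; g \<in> A \<rightarrow> carrier W\<rbrakk> \<Longrightarrow> act (finsum W g A) f = (\<lambda>k. \<Sum>i\<in>A. act (g i) f k)"
  by (induction A rule: finite_induct) (auto simp: act_zero act_add Pi_iff)

definition C :: "'k poly \<Rightarrow> 'k poly gwa_term set" where "C r = cl (Const r)"
definition X1 :: "'k poly gwa_term set" where "X1 = cl GenX"
definition Y1 :: "'k poly gwa_term set" where "Y1 = cl GenY"

lemma C_closed [simp]: "C r \<in> carrier W" and X1_closed [simp]: "X1 \<in> carrier W"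
  and Y1_closed [simp]: "Y1 \<in> carrier W"
  by (simp_all add: C_def X1_def Y1_def)

lemma C_mult: "C r \<otimes>\<^bsub>W\<^esub> C s = C (r * s)" and C_add: "C r \<oplus>\<^bsub>W\<^esub> C s = C (r + s)"
  and C_0: "C 0 = \<zero>\<^bsub>W\<^esub>" and C_1: "C 1 = \<one>\<^bsub>W\<^esub>"
  and X1_C: "X1 \<otimes>\<^bsub>W\<^esub> C r = C (scale_var q r) \<otimes>\<^bsub>W\<^esub> X1"
  and Y1_C: "Y1 \<otimes>\<^bsub>W\<^esub> C r = C (sg (- 1) r) \<otimes>\<^bsub>W\<^esub> Y1"
  and X1_Y1: "X1 \<otimes>\<^bsub>W\<^esub> Y1 = C h" and Y1_X1: "Y1 \<otimes>\<^bsub>W\<^esub> X1 = C (sg (- 1) h)"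
  unfolding C_def X1_def Y1_def gwa_simps gwa_class_eq_iff inv_scale_var[symmetric]
  by (rule gwa_eq.const_times gwa_eq.const_plus gwa_eq.x_const gwa_eq.y_const gwa_eq.x_y gwa_eq.y_x
      gwa_eq.refl)+

definition mon :: "int \<Rightarrow> 'k poly gwa_term set" where
  "mon k = (if k \<ge> 0 then X1 [^]\<^bsub>W\<^esub> nat k else Y1 [^]\<^bsub>W\<^esub> nat (- k))"

text \<open>The factor \<open>p (- j)\<close> is determined by \<open>y\<^sup>j = p (- j) x\<^sup>-\<^sup>j\<close>.\<close>

definition p :: "int \<Rightarrow> 'k poly" where
  "p k = (\<Prod>i = 1..nat (- k). sg (- int i) h)"

lemma mon_closed [simp]: "mon k \<in> carrier W"
  unfolding mon_def by (auto simp del: pow_nat)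

lemma p_nonneg [simp]: "k \<ge> 0 \<Longrightarrow> p k = 1"
  by (simp add: p_def)

lemma p_nonzero [simp]: "p k \<noteq> 0"
  using q h by (simp add: p_def)

lemma act_mon: "act (mon k) f m = p k * sg k (f (m - k))"
proof (cases "k \<ge> 0")
  case True
  have "act (X1 [^]\<^bsub>W\<^esub> j) f m = sg (int j) (f (m - int j))" for j
  proof (induction j arbitrary: f m)
    case (Suc j)
    then show ?case
      using q by (simp add: act_mult X1_def act_cl power_int_add algebra_simps)
  qed (simp add: act_one)
  from this[of "nat k"] True show ?thesis by (simp add: mon_def del: pow_nat)
next
  case False
  have "act (Y1 [^]\<^bsub>W\<^esub> j) f m = p (- int j) * sg (- int j) (f (m + int j))" for j
  proof (induction j arbitrary: f m)
    case (Suc j)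
    have "nat (- (- int (Suc j))) = Suc j" "nat (- (- int j)) = j"
      by simp_all
    then have "p (- int (Suc j)) = p (- int j) * sg (- int (Suc j)) h"
      unfolding p_def by (simp only: prod.cl_ivl_Suc) simp
    moreover have "inverse q * q powi (- int j) = q powi (- 1 - int j)"
      using q power_int_add[of q "- 1" "- int j"] by simp
    ultimately show ?case
      using Suc by (simp add: act_mult Y1_def act_cl algebra_simps)
  qed (simp add: act_one)
  from this[of "nat (- k)"] False show ?thesis by (simp add: mon_def del: pow_nat)
qed

lemma act_monomial: "act (C r \<otimes>\<^bsub>W\<^esub> mon k) f m = r * p k * sg k (f (m - k))"
  by (simp add: act_mult) (simp add: C_def act_cl act_mon)

text \<open>The factor is \<open>1\<close> for nonnegative \<open>k\<close>, and \<open>h\<close>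
  otherwise, from \<open>x y = h\<close>. Its value is irrelevant for the purpose, which is that the
  monomials span.\<close>

lemma X1_mon: "\<exists>s. X1 \<otimes>\<^bsub>W\<^esub> mon k = C s \<otimes>\<^bsub>W\<^esub> mon (k + 1)"
proof (cases "k \<ge> 0")
  case True
  then obtain j where j: "k = int j"
    using nonneg_int_cases by blast
  have "X1 \<otimes>\<^bsub>W\<^esub> X1 [^]\<^bsub>W\<^esub> j = X1 [^]\<^bsub>W\<^esub> Suc j"
    by (simp only: W.nat_pow_Suc2 X1_closed)
  then have "X1 \<otimes>\<^bsub>W\<^esub> mon k = mon (k + 1)"
    by (simp add: j mon_def nat_add_distrib del: pow_nat)
  then show ?thesis
    by (intro exI[of _ 1]) (simp add: C_1)
next
  case False
  define j where "j = nat (- k - 1)"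
  have "k = - int (Suc j)"
    using False by (simp add: j_def)
  moreover have "Y1 [^]\<^bsub>W\<^esub> Suc j = Y1 \<otimes>\<^bsub>W\<^esub> Y1 [^]\<^bsub>W\<^esub> j"
    by (simp only: W.nat_pow_Suc2 Y1_closed)
  ultimately have "mon k = Y1 \<otimes>\<^bsub>W\<^esub> mon (k + 1)"
    by (cases j) (simp_all add: mon_def nat_add_distrib del: pow_nat)
  then have "X1 \<otimes>\<^bsub>W\<^esub> mon k = C h \<otimes>\<^bsub>W\<^esub> mon (k + 1)"
    by (simp add: X1_Y1 flip: W.m_assoc)
  then show ?thesis ..
qed

lemma Y1_mon: "\<exists>s. Y1 \<otimes>\<^bsub>W\<^esub> mon k = C s \<otimes>\<^bsub>W\<^esub> mon (k - 1)"
proof (cases "k \<le> 0")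
  case True
  define j where "j = nat (- k)"
  have "k = - int j"
    using True by (simp add: j_def)
  moreover have "Y1 \<otimes>\<^bsub>W\<^esub> Y1 [^]\<^bsub>W\<^esub> j = Y1 [^]\<^bsub>W\<^esub> Suc j"
    by (simp only: W.nat_pow_Suc2 Y1_closed)
  ultimately have "Y1 \<otimes>\<^bsub>W\<^esub> mon k = mon (k - 1)"
    by (cases j) (simp_all add: mon_def nat_add_distrib del: pow_nat)
  then show ?thesis
    by (intro exI[of _ 1]) (simp add: C_1)
next
  case False
  define j where "j = nat (k - 1)"
  have "k = int (Suc j)"
    using False by (simp add: j_def)
  moreover have "X1 [^]\<^bsub>W\<^esub> Suc j = X1 \<otimes>\<^bsub>W\<^esub> X1 [^]\<^bsub>W\<^esub> j"
    by (simp only: W.nat_pow_Suc2 X1_closed)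
  ultimately have "mon k = X1 \<otimes>\<^bsub>W\<^esub> mon (k - 1)"
    by (simp add: mon_def nat_add_distrib del: pow_nat)
  then have "Y1 \<otimes>\<^bsub>W\<^esub> mon k = C (sg (- 1) h) \<otimes>\<^bsub>W\<^esub> mon (k - 1)"
    by (simp add: Y1_X1 flip: W.m_assoc)
  then show ?thesis ..
qed

section \<open>Spanning and independence of the monomials\<close>

definition comb :: "(int \<Rightarrow> 'k poly) \<Rightarrow> 'k poly gwa_term set" where
  "comb a = (\<Oplus>\<^bsub>W\<^esub>k\<in>{k. a k \<noteq> 0}. C (a k) \<otimes>\<^bsub>W\<^esub> mon k)"

lemma comb_closed [simp]: "comb a \<in> carrier W"
  by (simp add: comb_def)

lemma comb_superset:
  assumes "finite A" "{k. a k \<noteq> 0} \<subseteq> A"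
  shows "comb a = (\<Oplus>\<^bsub>W\<^esub>k\<in>A. C (a k) \<otimes>\<^bsub>W\<^esub> mon k)"
  unfolding comb_def using assms by (intro W.add.finprod_mono_neutral_cong_left) (auto simp: C_0)

lemma comb_add:
  assumes "finite {k. a k \<noteq> 0}" "finite {k. b k \<noteq> 0}"
  shows "comb a \<oplus>\<^bsub>W\<^esub> comb b = comb (\<lambda>k. a k + b k)"
proof -
  let ?A = "{k. a k \<noteq> 0} \<union> {k. b k \<noteq> 0}"
  have "comb a \<oplus>\<^bsub>W\<^esub> comb b = (\<Oplus>\<^bsub>W\<^esub>k\<in>?A. C (a k) \<otimes>\<^bsub>W\<^esub> mon k) \<oplus>\<^bsub>W\<^esub> (\<Oplus>\<^bsub>W\<^esub>k\<in>?A. C (b k) \<otimes>\<^bsub>W\<^esub> mon k)"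
    using assms by (subst (1 2) comb_superset[of ?A]) auto
  also have "\<dots> = (\<Oplus>\<^bsub>W\<^esub>k\<in>?A. C (a k) \<otimes>\<^bsub>W\<^esub> mon k \<oplus>\<^bsub>W\<^esub> C (b k) \<otimes>\<^bsub>W\<^esub> mon k)"
    by (rule W.finsum_addf[symmetric]) auto
  also have "\<dots> = (\<Oplus>\<^bsub>W\<^esub>k\<in>?A. C (a k + b k) \<otimes>\<^bsub>W\<^esub> mon k)"
    by (rule W.finsum_cong') (auto simp: W.l_distr[symmetric] C_add)
  also have "\<dots> = comb (\<lambda>k. a k + b k)"
    using assms by (intro comb_superset[symmetric]) auto
  finally show ?thesis .
qed

definition combs :: "'k poly gwa_term set set" where
  "combs = {comb a | a. finite {k. a k \<noteq> 0}}"

lemma combs_add: "\<lbrakk>w \<in> combs; w' \<in> combs\<rbrakk> \<Longrightarrow> w \<oplus>\<^bsub>W\<^esub> w' \<in> combs"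
proof -
  assume "w \<in> combs" "w' \<in> combs"
  then obtain a b where *: "w = comb a" "w' = comb b" "finite {k. a k \<noteq> 0}" "finite {k. b k \<noteq> 0}"
    by (auto simp: combs_def)
  moreover have "finite {k. a k + b k \<noteq> 0}"
    by (rule finite_subset[of _ "{k. a k \<noteq> 0} \<union> {k. b k \<noteq> 0}"]) (use * in auto)
  ultimately show ?thesis
    unfolding combs_def using comb_add by blast
qed

lemma combs_monomial: "C r \<otimes>\<^bsub>W\<^esub> mon k \<in> combs"
proof -
  have "comb (\<lambda>l. if l = k then r else 0) = C r \<otimes>\<^bsub>W\<^esub> mon k"
    by (subst comb_superset[of "{k}"]) auto
  moreover have "finite {l. (if l = k then r else 0) \<noteq> 0}"
    by (rule finite_subset[of _ "{k}"]) auto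
  ultimately show ?thesis
    unfolding combs_def by blast
qed

lemma combs_zero: "\<zero>\<^bsub>W\<^esub> \<in> combs"
  using combs_monomial[of 0 0] by (simp add: C_0)

lemma combs_mult:
  assumes g: "g \<in> carrier W" "\<And>r k. g \<otimes>\<^bsub>W\<^esub> (C r \<otimes>\<^bsub>W\<^esub> mon k) \<in> combs" and w: "w \<in> combs"
  shows "g \<otimes>\<^bsub>W\<^esub> w \<in> combs"
proof -
  obtain a where a: "w = comb a" "finite {k. a k \<noteq> 0}"
    using w by (auto simp: combs_def)
  have "(\<Oplus>\<^bsub>W\<^esub>k\<in>A. g \<otimes>\<^bsub>W\<^esub> (C (a k) \<otimes>\<^bsub>W\<^esub> mon k)) \<in> combs" if "finite A" for A
    using that by (induction A) (auto simp: combs_zero g(1) intro!: combs_add g)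
  then show ?thesis
    using a g(1) by (simp add: comb_def W.finsum_rdistr)
qed

lemma combs_C: "w \<in> combs \<Longrightarrow> C s \<otimes>\<^bsub>W\<^esub> w \<in> combs"
  by (rule combs_mult) (simp_all add: C_mult combs_monomial flip: W.m_assoc)

lemma combs_carrier: "w \<in> combs \<Longrightarrow> w \<in> carrier W"
  by (auto simp: combs_def)

text \<open>The set of combinations of monomials is stable under left multiplication by each
  constant and generator, hence by every term. Applied to \<open>1\<close>, this gives spanning
  without bringing terms to a normal form.\<close>

lemma combs_term: "w \<in> combs \<Longrightarrow> cl u \<otimes>\<^bsub>W\<^esub> w \<in> combs"
proof (induction u arbitrary: w)
  case (Const r)
  then show ?case using combs_C by (simp add: C_def)
next
  case GenX
  have "X1 \<otimes>\<^bsub>W\<^esub> (C r \<otimes>\<^bsub>W\<^esub> mon k) \<in> combs" for r k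
  proof -
    obtain s where "X1 \<otimes>\<^bsub>W\<^esub> mon k = C s \<otimes>\<^bsub>W\<^esub> mon (k + 1)"
      using X1_mon by blast
    then have "X1 \<otimes>\<^bsub>W\<^esub> (C r \<otimes>\<^bsub>W\<^esub> mon k) = C (scale_var q r * s) \<otimes>\<^bsub>W\<^esub> mon (k + 1)"
      by (simp add: X1_C W.m_assoc flip: C_mult) (simp add: X1_C flip: W.m_assoc, simp add: W.m_assoc)
    then show ?thesis using combs_monomial by simp
  qed
  then show ?case
    using combs_mult[of X1] GenX by (simp add: X1_def)
next
  case GenY
  have "Y1 \<otimes>\<^bsub>W\<^esub> (C r \<otimes>\<^bsub>W\<^esub> mon k) \<in> combs" for r k
  proof -
    obtain s where "Y1 \<otimes>\<^bsub>W\<^esub> mon k = C s \<otimes>\<^bsub>W\<^esub> mon (k - 1)"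
      using Y1_mon by blast
    then have "Y1 \<otimes>\<^bsub>W\<^esub> (C r \<otimes>\<^bsub>W\<^esub> mon k) = C (sg (- 1) r * s) \<otimes>\<^bsub>W\<^esub> mon (k - 1)"
      by (simp add: Y1_C W.m_assoc flip: C_mult) (simp add: Y1_C flip: W.m_assoc, simp add: W.m_assoc)
    then show ?thesis using combs_monomial by simp
  qed
  then show ?case
    using combs_mult[of Y1] GenY by (simp add: Y1_def)
next
  case (Plus u v)
  then have "cl u \<otimes>\<^bsub>W\<^esub> w \<oplus>\<^bsub>W\<^esub> cl v \<otimes>\<^bsub>W\<^esub> w \<in> combs"
    by (intro combs_add)
  then show ?case
    using combs_carrier[OF Plus.prems] by (simp add: W.l_distr flip: gwa_simps(5))
next
  case (Neg u)
  have "cl (Neg u) \<oplus>\<^bsub>W\<^esub> cl u = \<zero>\<^bsub>W\<^esub>"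
    by (simp add: gwa_simps gwa_class_eq_iff gwa_eq.plus_neg)
  moreover have "C (- 1) \<otimes>\<^bsub>W\<^esub> cl u \<oplus>\<^bsub>W\<^esub> cl u = \<zero>\<^bsub>W\<^esub>"
    using W.l_distr[of "C (- 1)" "C 1" "cl u"] by (simp add: C_add C_0) (simp add: C_1)
  ultimately have "cl (Neg u) = C (- 1) \<otimes>\<^bsub>W\<^esub> cl u"
    by (metis W.add.inv_equality cl_closed C_closed W.m_closed)
  then show ?case
    using Neg combs_carrier[OF Neg.prems] by (simp add: W.m_assoc combs_C)
next
  case (Times u v)
  then have "cl u \<otimes>\<^bsub>W\<^esub> (cl v \<otimes>\<^bsub>W\<^esub> w) \<in> combs"
    by simp
  then show ?case
    using combs_carrier[OF Times.prems] by (simp add: W.m_assoc flip: gwa_simps(4))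
qed

lemma combs_eq: "combs = carrier W"
proof -
  have "\<one>\<^bsub>W\<^esub> \<in> combs"
    using combs_monomial[of 1 0] by (simp add: C_1 mon_def)
  then have "cl u \<in> combs" for u
    using combs_term[of "\<one>\<^bsub>W\<^esub>" u] by simp
  then show ?thesis
    using combs_carrier by (auto elim: W_carrierE)
qed

lemma W_combE:
  assumes "w \<in> carrier W"
  obtains a where "finite {k. a k \<noteq> 0}" "w = comb a"
  using assms unfolding combs_eq[symmetric] combs_def by blast

lemma act_comb:
  assumes "finite {k. a k \<noteq> 0}"
  shows "act (comb a) f m = (\<Sum>k | a k \<noteq> 0. a k * p k * sg k (f (m - k)))"
  unfolding comb_def using assms by (simp add: act_finsum act_monomial)

lemma cf_comb:
  assumes "finite {k. a k \<noteq> 0}"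
  shows "cf (comb a) = (\<lambda>k. a k * p k)"
proof
  fix m
  have "cf (comb a) m = (\<Sum>k | a k \<noteq> 0. if k = m then a k * p k else 0)"
    unfolding cf_def act_comb[OF assms] by (intro sum.cong) auto
  then show "cf (comb a) m = a m * p m"
    using assms by simp
qed

text \<open>Independence of the monomials: the coefficient \<open>a k * p k\<close> determines
  \<open>a k\<close>, because \<open>p k\<close> is nonzero.\<close>

lemma cf_inj: "inj_on cf (carrier W)"
proof (rule inj_onI)
  fix w w' assume "w \<in> carrier W" "w' \<in> carrier W" "cf w = cf w'"
  then obtain a b where *: "finite {k. a k \<noteq> 0}" "w = comb a" "finite {k. b k \<noteq> 0}" "w' = comb b"
    by (metis W_combE)
  with \<open>cf w = cf w'\<close> have "a k * p k = b k * p k" for k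
    by (simp add: cf_comb fun_eq_iff)
  then have "a = b"
    by auto
  with * show "w = w'" by simp
qed

lemma W_eqI: "\<lbrakk>w \<in> carrier W; w' \<in> carrier W; \<And>k. cf w k = cf w' k\<rbrakk> \<Longrightarrow> w = w'"
  using cf_inj by (auto dest: inj_onD)

lemma cf_finite: "w \<in> carrier W \<Longrightarrow> finite {k. cf w k \<noteq> 0}"
  by (erule W_combE) (simp add: cf_comb)

lemma p_dvd_cf: "w \<in> carrier W \<Longrightarrow> p k dvd cf w k"
  by (erule W_combE) (simp add: cf_comb)

text \<open>The inverse of \<open>cf\<close>. By \<open>p_dvd_cf\<close> and
  \<open>cf_finite\<close>, the coefficient sequences of elements are exactly the finitely supported
  ones whose entry at \<open>k\<close> is divisible by \<open>p k\<close>.\<close>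

definition of_cf :: "(int \<Rightarrow> 'k poly) \<Rightarrow> 'k poly gwa_term set" where
  "of_cf f = comb (\<lambda>k. f k div p k)"

lemma of_cf:
  assumes "finite {k. f k \<noteq> 0}" "\<And>k. p k dvd f k"
  shows "of_cf f \<in> carrier W" "cf (of_cf f) = f"
proof -
  have "finite {k. f k div p k \<noteq> 0}"
    by (rule finite_subset[OF _ assms(1)]) auto
  then show "of_cf f \<in> carrier W" "cf (of_cf f) = f"
    using assms by (simp_all add: of_cf_def cf_comb)
qed

text \<open>In these coordinates the algebra sits inside the skew Laurent polynomials in
  \<open>x\<close> over \<open>k[t]\<close>: a coefficient that passes \<open>x^k\<close> is twisted
  by the \<open>k\<close>-th power of the automorphism.\<close>

lemma cf_mult:
  assumes "a \<in> carrier W" "b \<in> carrier W"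
  shows "cf (a \<otimes>\<^bsub>W\<^esub> b) m = (\<Sum>k | cf a k \<noteq> 0. cf a k * sg k (cf b (m - k)))"
proof -
  obtain c where c: "finite {k. c k \<noteq> 0}" "a = comb c"
    using assms W_combE by metis
  have "cf (a \<otimes>\<^bsub>W\<^esub> b) m = act a (cf b) m"
    using assms by (simp add: cf_def act_mult)
  then show ?thesis
    using c by (simp add: act_comb cf_comb)
qed

lemma cf_add: "\<lbrakk>a \<in> carrier W; b \<in> carrier W\<rbrakk> \<Longrightarrow> cf (a \<oplus>\<^bsub>W\<^esub> b) k = cf a k + cf b k"
  and cf_zero [simp]: "cf \<zero>\<^bsub>W\<^esub> k = 0" and cf_one: "cf \<one>\<^bsub>W\<^esub> k = (if k = 0 then 1 else 0)"
  by (simp_all add: cf_def act_add act_zero act_one)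

lemma cf_finsum: "\<lbrakk>finite A; g \<in> A \<rightarrow> carrier W\<rbrakk> \<Longrightarrow> cf (finsum W g A) k = (\<Sum>i\<in>A. cf (g i) k)"
  by (simp add: cf_def act_finsum)

lemma cf_monomial: "cf (C r \<otimes>\<^bsub>W\<^esub> mon k) m = (if m = k then r * p k else 0)"
  unfolding cf_def act_monomial by simp

lemma cf_C: "cf (C r) m = (if m = 0 then r else 0)"
  using cf_monomial[of r 0 m] by (simp add: mon_def)

lemma cf_monomial_mult:
  assumes "b \<in> carrier W"
  shows "cf (C r \<otimes>\<^bsub>W\<^esub> mon k \<otimes>\<^bsub>W\<^esub> b) m = r * p k * sg k (cf b (m - k))"
proof -
  have "cf (C r \<otimes>\<^bsub>W\<^esub> mon k \<otimes>\<^bsub>W\<^esub> b) m = act (C r \<otimes>\<^bsub>W\<^esub> mon k) (cf b) m"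
    unfolding cf_def using assms by (subst act_mult) simp_all
  then show ?thesis
    by (simp only: act_monomial)
qed

lemma cf_mult_monomial:
  assumes "b \<in> carrier W"
  shows "cf (b \<otimes>\<^bsub>W\<^esub> (C r \<otimes>\<^bsub>W\<^esub> mon k)) m = cf b (m - k) * sg (m - k) (r * p k)"
proof -
  have "cf (b \<otimes>\<^bsub>W\<^esub> (C r \<otimes>\<^bsub>W\<^esub> mon k)) m
      = (\<Sum>l | cf b l \<noteq> 0. if l = m - k then cf b l * sg l (r * p k) else 0)"
    using assms by (subst cf_mult) (auto simp: cf_monomial intro!: sum.cong)
  then show ?thesis
    using cf_finite[OF assms] by simp
qed

lemma cf_eq_0_iff: "w \<in> carrier W \<Longrightarrow> (\<forall>k. cf w k = 0) \<longleftrightarrow> w = \<zero>\<^bsub>W\<^esub>"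
  using W_eqI[of w "\<zero>\<^bsub>W\<^esub>"] by auto

text \<open>The coefficient at the sum of the two largest exponents is the product of the leading
  coefficients, one of them twisted by an automorphism, hence nonzero.\<close>

lemma W_integral:
  assumes "a \<in> carrier W" "b \<in> carrier W" "a \<noteq> \<zero>\<^bsub>W\<^esub>" "b \<noteq> \<zero>\<^bsub>W\<^esub>"
  shows "a \<otimes>\<^bsub>W\<^esub> b \<noteq> \<zero>\<^bsub>W\<^esub>"
proof
  assume "a \<otimes>\<^bsub>W\<^esub> b = \<zero>\<^bsub>W\<^esub>"
  let ?A = "{k. cf a k \<noteq> 0}" and ?B = "{k. cf b k \<noteq> 0}"
  define i j where "i = Max ?A" and "j = Max ?B"
  have fin: "finite ?A" "finite ?B" and ne: "?A \<noteq> {}" "?B \<noteq> {}"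
    using assms cf_finite by (auto simp: cf_eq_0_iff[symmetric])
  have i: "cf a i \<noteq> 0" and j: "cf b j \<noteq> 0"
    using Max_in[OF fin(1) ne(1)] Max_in[OF fin(2) ne(2)] by (auto simp: i_def j_def)
  have "cf (a \<otimes>\<^bsub>W\<^esub> b) (i + j) = (\<Sum>k\<in>?A. if k = i then cf a k * sg k (cf b (i + j - k)) else 0)"
    unfolding cf_mult[OF assms(1,2)]
  proof (intro sum.cong HOL.refl)
    fix k assume "k \<in> ?A"
    then have "k \<le> i"
      using fin by (simp add: i_def)
    then have "k = i \<or> j < i + j - k" by auto
    moreover have "cf b l = 0" if "j < l" for l
      using Max_ge[OF fin(2), of l] that by (auto simp: j_def)
    ultimately show "cf a k * sg k (cf b (i + j - k)) = (if k = i then cf a k * sg k (cf b (i + j - k)) else 0)"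
      by auto
  qed
  also have "\<dots> = cf a i * sg i (cf b j)"
    using fin i by simp
  also have "\<dots> \<noteq> 0"
    using i j q by simp
  finally show False
    using \<open>a \<otimes>\<^bsub>W\<^esub> b = \<zero>\<^bsub>W\<^esub>\<close> by simp
qed

end

section \<open>Center of a quantum generalized Weyl algebra at a root of unity\<close>

text \<open>The \<open>n * n\<close> basis elements are numbered by \<open>c = i + n * j\<close>,
  with \<open>i\<close> the power of \<open>t\<close> and \<open>j\<close> that of \<open>x\<close>
  or \<open>y\<close>.\<close>

lemma sum_div_mod: "(\<Sum>c<n * n. g (c mod n) (c div n)) = (\<Sum>j<n. \<Sum>i<n. g i j)" if "n > 0"
  for g :: "nat \<Rightarrow> nat \<Rightarrow> 'a::comm_monoid_add"
proof -
  have "(\<Sum>c<n * n. g (c mod n) (c div n)) = (\<Sum>j<n. \<Sum>c = j * n..<j * n + n. g (c mod n) (c div n))"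
    by (simp add: sum.nat_group)
  also have "\<dots> = (\<Sum>j<n. \<Sum>i<n. g i j)"
  proof (rule sum.cong[OF HOL.refl])
    fix j
    have "(\<Sum>c = j * n..<j * n + n. g (c mod n) (c div n)) = (\<Sum>c = 0 + j * n..<n + j * n. g (c mod n) (c div n))"
      by (simp add: add.commute)
    also have "\<dots> = (\<Sum>i = 0..<n. g ((i + j * n) mod n) ((i + j * n) div n))"
      by (rule sum.shift_bounds_nat_ivl)
    also have "\<dots> = (\<Sum>i<n. g i j)"
      using that by (intro sum.cong) (auto simp: lessThan_atLeast0)
    finally show "(\<Sum>c = j * n..<j * n + n. g (c mod n) (c div n)) = (\<Sum>i<n. g i j)" .
  qed
  finally show ?thesis .
qed

lemma (in ring) subring_center: "subring (ring_center R) R"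
proof (rule subringI)
  have carr: "a \<in> carrier R" if "a \<in> ring_center R" for a
    using that by (simp add: ring_center_def)
  have comm: "a \<otimes> x = x \<otimes> a" if "a \<in> ring_center R" "x \<in> carrier R" for a x
    using that by (simp add: ring_center_def)
  show "\<ominus> a \<in> ring_center R" if a: "a \<in> ring_center R" for a
    using carr[OF a] comm[OF a] by (simp add: ring_center_def l_minus r_minus)
  show "a \<oplus> b \<in> ring_center R" if a: "a \<in> ring_center R" and b: "b \<in> ring_center R" for a b
    using carr[OF a] carr[OF b] comm[OF a] comm[OF b] by (simp add: ring_center_def l_distr r_distr)
  show "a \<otimes> b \<in> ring_center R" if a: "a \<in> ring_center R" and b: "b \<in> ring_center R" for a b
  proof -
    have "a \<otimes> b \<otimes> x = x \<otimes> (a \<otimes> b)" if x: "x \<in> carrier R" for x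
    proof -
      have "a \<otimes> b \<otimes> x = a \<otimes> (b \<otimes> x)"
        using carr[OF a] carr[OF b] x by (rule m_assoc)
      also have "\<dots> = a \<otimes> (x \<otimes> b)"
        by (simp only: comm[OF b x])
      also have "\<dots> = (a \<otimes> x) \<otimes> b"
        using carr[OF a] x carr[OF b] by (rule m_assoc[symmetric])
      also have "\<dots> = (x \<otimes> a) \<otimes> b"
        by (simp only: comm[OF a x])
      also have "\<dots> = x \<otimes> (a \<otimes> b)"
        using x carr[OF a] carr[OF b] by (rule m_assoc)
      finally show ?thesis .
    qed
    then show ?thesis
      using carr[OF a] carr[OF b] by (simp add: ring_center_def)
  qed
qed (auto simp: ring_center_def)

section \<open>Polynomials in \<open>t^n\<close> when \<open>q\<close> has order
  \<open>n\<close>\<close>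

locale finite_quantum_gwa = quantum_gwa +
  fixes n :: nat
  assumes n: "n > 0" and power_q_eq_1_iff: "\<And>k::nat. q ^ k = 1 \<longleftrightarrow> n dvd k"
begin

lemma powi_q_eq_1_iff: "q powi k = 1 \<longleftrightarrow> int n dvd k"
proof (cases k)
  case (nonneg j)
  then show ?thesis by (simp add: power_q_eq_1_iff)
next
  case (neg j)
  then have "q powi k = inverse (q ^ Suc j)"
    by (simp only: power_int_minus power_int_of_nat)
  then show ?thesis
    using neg power_q_eq_1_iff[of "Suc j"] by (simp del: power_Suc of_nat_Suc)
qed

text \<open>The polynomial \<open>1 + z + ... + z^(n-1)\<close> vanishes at the powers of
  \<open>q\<close> other than \<open>1\<close>. If \<open>n\<close> were zero in the field, it would
  vanish at \<open>1\<close> as well and have \<open>n\<close> roots, more than its degree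
  allows.\<close>

lemma of_nat_n_nonzero: "of_nat n \<noteq> (0 :: 'a)"
proof
  assume *: "of_nat n = (0 :: 'a)"
  define g :: "'a poly" where "g = (\<Sum>i<n. monom 1 i)"
  have "coeff g 0 = 1"
    using n by (simp add: g_def coeff_sum)
  then have "g \<noteq> 0" by auto
  have "degree g \<le> n - 1"
    unfolding g_def by (rule degree_sum_le) (auto intro: order.trans[OF degree_monom_le])
  have "poly g (q ^ j) = 0" for j
  proof (cases "q ^ j = 1")
    case True
    with * show ?thesis by (simp add: g_def poly_sum poly_monom)
  next
    case False
    have "(q ^ j - 1) * poly g (q ^ j) = (q ^ j) ^ n - 1"
      by (simp add: g_def poly_sum poly_monom power_diff_1_eq)
    also have "(q ^ j) ^ n = 1"
      using power_q_eq_1_iff[of "j * n"] by (simp add: power_mult)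
    finally show ?thesis using False by simp
  qed
  moreover have "inj_on (\<lambda>j. q ^ j) {..<n}"
  proof (rule linorder_inj_onI)
    fix i j assume *: "i < j" "i \<in> {..<n}" "j \<in> {..<n}"
    then have "q ^ j = q ^ i * q ^ (j - i)"
      by (simp flip: power_add)
    moreover have "q ^ (j - i) \<noteq> 1"
      using * power_q_eq_1_iff[of "j - i"] by (auto dest: dvd_imp_le)
    ultimately show "q ^ i \<noteq> q ^ j"
      using q by auto
  qed auto
  ultimately have "card {x. poly g x = 0} \<ge> n"
    using card_mono[OF poly_roots_finite[OF \<open>g \<noteq> 0\<close>], of "(\<lambda>j. q ^ j) ` {..<n}"]
    by (auto simp: card_image)
  with card_poly_roots_bound[OF \<open>g \<noteq> 0\<close>] \<open>degree g \<le> n - 1\<close> n show False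
    by linarith
qed

abbreviation "inv_poly f \<equiv> scale_var q f = f"

lemma inv_poly_iff: "inv_poly f \<longleftrightarrow> (\<forall>m. coeff f m \<noteq> 0 \<longrightarrow> n dvd m)"
  by (simp add: poly_eq_iff) (metis mult_cancel_right1 power_q_eq_1_iff)

lemma sg_inv_poly: "inv_poly f \<Longrightarrow> sg k f = f"
proof (rule poly_eqI)
  fix m assume "inv_poly f"
  then have "coeff f m = 0 \<or> q ^ m = 1"
    by (auto simp: inv_poly_iff power_q_eq_1_iff)
  moreover have "(q powi k) ^ m = (q ^ m) powi k"
    by (metis power_int_of_nat power_int_mult mult.commute)
  ultimately show "coeff (sg k f) m = coeff f m" by auto
qed

lemma sg_dvd [simp]: "int n dvd k \<Longrightarrow> sg k f = f"
proof -
  assume "int n dvd k"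
  then have "q powi k = 1"
    by (simp add: powi_q_eq_1_iff)
  then show ?thesis by simp
qed

text \<open>For \<open>i < n\<close>, this is the coefficient of \<open>t^i\<close> when
  \<open>k[t]\<close> is viewed as a free module over \<open>k[t^n]\<close> on
  \<open>1, t, ..., t^(n-1)\<close>.\<close>

definition part :: "nat \<Rightarrow> 'a poly \<Rightarrow> 'a poly" where
  "part i f = (\<Sum>m | m \<le> degree f \<and> n dvd m. monom (coeff f (m + i)) m)"

lemma coeff_part [simp]: "coeff (part i f) m = (if n dvd m then coeff f (m + i) else 0)"
proof -
  have "coeff (part i f) m = (\<Sum>l | l \<le> degree f \<and> n dvd l. if l = m then coeff f (l + i) else 0)"
    by (simp add: part_def coeff_sum)
  also have "\<dots> = (if m \<le> degree f \<and> n dvd m then coeff f (m + i) else 0)"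
    by (subst sum.delta) auto
  finally show ?thesis
    by (auto simp: coeff_eq_0)
qed

lemma inv_poly_part [simp]: "scale_var q (part i f) = part i f"
  by (simp add: inv_poly_iff)

lemma part_add [simp]: "part i (f + g) = part i f + part i g"
  and part_0 [simp]: "part i 0 = 0"
  by (simp_all add: poly_eq_iff)

lemma part_sum: "part i (\<Sum>x\<in>A. g x) = (\<Sum>x\<in>A. part i (g x))"
  by (induction A rule: infinite_finite_induct) simp_all

lemma part_mult_inv_poly:
  assumes r: "inv_poly r" and i: "i < n"
  shows "part i (r * f) = r * part i f"
proof (rule poly_eqI)
  fix m
  have r0: "coeff r l = 0" if "\<not> n dvd l" for l
    using r that by (auto simp: inv_poly_iff)
  show "coeff (part i (r * f)) m = coeff (r * part i f) m"
  proof (cases "n dvd m")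
    case True
    have "coeff (r * f) (m + i) = (\<Sum>l\<le>m + i. coeff r l * coeff f (m + i - l))"
      by (simp add: coeff_mult)
    also have "\<dots> = (\<Sum>l\<le>m. coeff r l * coeff f (m + i - l))"
    proof (rule sum.mono_neutral_right)
      show "\<forall>l\<in>{..m + i} - {..m}. coeff r l * coeff f (m + i - l) = 0"
      proof
        fix l assume l: "l \<in> {..m + i} - {..m}"
        \<comment> \<open>Here \<open>m\<close> is a multiple of \<open>n\<close> and
          \<open>l - m\<close> lies between \<open>1\<close> and \<open>i < n\<close>.\<close>
        have "\<not> n dvd l"
        proof
          assume "n dvd l"
          with True l have "n dvd l - m" by auto
          moreover have "0 < l - m" "l - m \<le> i" using l by auto
          ultimately show False using i by (auto dest: dvd_imp_le)
        qed
        then show "coeff r l * coeff f (m + i - l) = 0" by (simp add: r0)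
      qed
    qed auto
    also have "\<dots> = (\<Sum>l\<le>m. coeff r l * coeff (part i f) (m - l))"
    proof (intro sum.cong HOL.refl)
      fix l assume "l \<in> {..m}"
      then show "coeff r l * coeff f (m + i - l) = coeff r l * coeff (part i f) (m - l)"
        using True r0[of l] by (cases "n dvd l") auto
    qed
    finally show ?thesis
      using True by (simp add: coeff_mult)
  next
    case False
    have "coeff r l * coeff (part i f) (m - l) = 0" if "l \<le> m" for l
    proof (cases "n dvd l")
      case True
      then have "\<not> n dvd m - l"
        using False that by (auto dest: dvd_diffD)
      then show ?thesis by simp
    qed (simp add: r0)
    then have "coeff (r * part i f) m = 0"
      unfolding coeff_mult by (intro sum.neutral) auto
    then show ?thesis
      using False by simp
  qed
qed

lemma part_monom: "\<lbrakk>i < n; j < n\<rbrakk> \<Longrightarrow> part i (monom 1 j) = (if i = j then 1 else 0)"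
  using n by (auto simp: poly_eq_iff) (metis add_0 dvd_imp_le leD le_add1 le_eq_less_or_eq add_gr_0 gr0I less_le_trans)+

lemma part_inv_monom: "\<lbrakk>inv_poly r; i < n; j < n\<rbrakk> \<Longrightarrow> part i (r * monom 1 j) = (if i = j then r else 0)"
  by (simp add: part_mult_inv_poly part_monom)

lemma part_monom_mult: "part i (monom 1 i * f) = part 0 f"
  by (simp add: poly_eq_iff coeff_monom_mult)

lemma sum_part: "(\<Sum>i<n. part i f * monom 1 i) = f"
proof (rule poly_eqI)
  fix m
  have "coeff (\<Sum>i<n. part i f * monom 1 i) m = (\<Sum>i<n. coeff (monom 1 i * part i f) m)"
    by (simp add: coeff_sum mult.commute)
  also have "\<dots> = (\<Sum>i<n. if i = m mod n then coeff f m else 0)"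
  proof (intro sum.cong HOL.refl)
    fix i assume "i \<in> {..<n}"
    then have "i \<le> m \<and> n dvd m - i \<longleftrightarrow> i = m mod n"
      using mod_less_eq_dividend[of m n] by (auto simp: minus_mod_eq_mult_div elim!: dvdE)
        (metis add_diff_inverse_nat less_imp_not_less linorder_not_less mod_less mod_mult_self2 add.commute)
    then show "coeff (monom 1 i * part i f) m = (if i = m mod n then coeff f m else 0)"
      by (auto simp: coeff_monom_mult)
  qed
  also have "\<dots> = coeff f m"
    using n by simp
  finally show "coeff (\<Sum>i<n. part i f * monom 1 i) m = coeff f m" .
qed

lemma dvd_part: "\<lbrakk>inv_poly r; i < n; r dvd f\<rbrakk> \<Longrightarrow> r dvd part i f"
  by (auto simp: part_mult_inv_poly elim!: dvdE)

section \<open>Multiplicativity of the factors \<open>p k\<close>, from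
  \<open>y^(a+b) = y^a y^b\<close>, and their invariance\<close>

lemma p_add:
  assumes "k \<le> 0" "l \<le> 0"
  shows "p (k + l) = p k * sg k (p l)"
proof -
  define a b where "a = nat (- k)" and "b = nat (- l)"
  have ab: "k = - int a" "l = - int b" "nat (- (k + l)) = a + b"
    using assms by (auto simp: a_def b_def)
  have "p (k + l) = (\<Prod>i = 1..a. sg (- int i) h) * (\<Prod>i = a + 1..a + b. sg (- int i) h)"
    unfolding p_def ab(3) by (rule prod.ub_add_nat) simp
  also have "(\<Prod>i = a + 1..a + b. sg (- int i) h) = (\<Prod>i = 1..b. sg (- int (i + a)) h)"
    using prod.shift_bounds_cl_nat_ivl[of "\<lambda>i. sg (- int i) h" 1 a b] by (simp add: add.commute)
  also have "\<dots> = (\<Prod>i = 1..b. sg (k + - int i) h)"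
    by (intro prod.cong HOL.refl arg_cong[where f = "\<lambda>k. sg k h"]) (simp add: ab)
  also have "\<dots> = sg k (p l)"
    by (simp add: p_def scale_var_prod ab(2) del: scale_var_scale_var)
  finally show ?thesis
    by (simp add: p_def ab)
qed

text \<open>This factor is the norm of \<open>h\<close>, the product of its images under all
  \<open>n\<close> powers of the automorphism, which the automorphism permutes cyclically.\<close>

lemma inv_poly_p_n: "inv_poly (p (- int n))"
proof -
  have "scale_var q (p (- int n)) = (\<Prod>i = 1..n. sg (1 - int i) h)"
    using q by (auto simp: p_def scale_var_prod power_int_add[symmetric] power_int_diff divide_inverse power_int_minus intro!: prod.cong)
  also have "\<dots> = (\<Prod>i = 0..<n. sg (- int i) h)"
    by (rule prod.reindex_bij_witness[of _ Suc "\<lambda>i. i - 1"]) auto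
  also have "\<dots> = h * (\<Prod>i = 1..<n. sg (- int i) h)"
    using n by (simp add: prod.atLeast_Suc_lessThan)
  \<comment> \<open>The factor that leaves the product at one end returns at the other, because
    \<open>q ^ n = 1\<close>.\<close>
  also have "\<dots> = sg (- int n) h * (\<Prod>i = 1..<n. sg (- int i) h)"
    by simp
  also have "sg (- int n) h * (\<Prod>i = 1..<n. sg (- int i) h) = p (- int n)"
  proof -
    have "{1..n} = insert n {1..<n}" using n by auto
    then show ?thesis by (simp add: p_def)
  qed
  finally show ?thesis .
qed

lemma inv_poly_p: "int n dvd k \<Longrightarrow> inv_poly (p k)"
proof (cases "k \<ge> 0")
  case False
  assume "int n dvd k"
  have "inv_poly (p (- int (n * j)))" for j
  proof (induction j)
    case (Suc j)
    have "p (- int (n * Suc j)) = p (- int n) * sg (- int n) (p (- int (n * j)))"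
      using p_add[of "- int n" "- int (n * j)"] by (simp add: algebra_simps)
    with Suc inv_poly_p_n show ?case by simp
  qed simp
  moreover obtain j where "k = - int (n * j)"
  proof -
    obtain l where "k = int n * l" using \<open>int n dvd k\<close> by blast
    with False have "k = - int (n * nat (- l))" using n by (simp add: mult_le_0_iff not_le zero_le_mult_iff)
    then show ?thesis by (rule that)
  qed
  ultimately show ?thesis by simp
qed simp

section \<open>Embedding into Laurent series and the center\<close>

abbreviation "Z \<equiv> ring_center W"
abbreviation "ZR \<equiv> W\<lparr>carrier := Z\<rparr>"

text \<open>The Laurent variable stands for \<open>x\<close> itself, so that all of \<open>W\<close>
  is embedded and not only \<open>Z\<close>. The map forgets the twist: it is additive and injective
  on \<open>W\<close>, and multiplicative when one of the factors is central.\<close>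

definition emb :: "'a poly gwa_term set \<Rightarrow> 'a poly fract fls" where
  "emb w = (\<Sum>k | cf w k \<noteq> 0. fls_const (to_fract (cf w k)) * fls_X_intpow k)"

lemma emb_nth:
  assumes "w \<in> carrier W"
  shows "fls_nth (emb w) k = to_fract (cf w k)"
proof -
  have "fls_nth (emb w) k = (\<Sum>l | cf w l \<noteq> 0. if k = l then to_fract (cf w l) else 0)"
    unfolding emb_def fls_nth_sum by (intro sum.cong HOL.refl) auto
  then show ?thesis
    using cf_finite[OF assms] by simp
qed

lemma emb_inj:
  assumes "a \<in> carrier W" "b \<in> carrier W" "emb a = emb b"
  shows "a = b"
proof (rule W_eqI)
  fix k
  have "to_fract (cf a k) = to_fract (cf b k)"
    using assms by (simp only: emb_nth[symmetric])
  then show "cf a k = cf b k" by simp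
qed (use assms in auto)

lemma emb_add: "\<lbrakk>a \<in> carrier W; b \<in> carrier W\<rbrakk> \<Longrightarrow> emb (a \<oplus>\<^bsub>W\<^esub> b) = emb a + emb b"
  by (rule fls_eqI) (simp add: emb_nth cf_add)

lemma emb_one: "emb \<one>\<^bsub>W\<^esub> = 1"
  by (rule fls_eqI) (simp add: emb_nth cf_one)

lemma emb_mult_if:
  assumes ab: "a \<in> carrier W" "b \<in> carrier W"
    and *: "\<And>k l. cf a k * sg k (cf b l) = cf a k * cf b l"
  shows "emb (a \<otimes>\<^bsub>W\<^esub> b) = emb a * emb b"
proof (rule fls_eqI)
  fix m
  have "fls_nth (emb a * emb b) m
      = (\<Sum>k | cf a k \<noteq> 0. fls_nth (fls_const (to_fract (cf a k)) * (fls_X_intpow k * emb b)) m)"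
    unfolding emb_def[of a] by (simp add: sum_distrib_right fls_nth_sum mult.assoc)
  also have "\<dots> = (\<Sum>k | cf a k \<noteq> 0. to_fract (cf a k * cf b (m - k)))"
    using ab by (simp add: fls_X_intpow_times_conv_shift emb_nth)
  also have "\<dots> = to_fract (\<Sum>k | cf a k \<noteq> 0. cf a k * cf b (m - k))"
    by (induction "{k. cf a k \<noteq> 0}" rule: infinite_finite_induct) simp_all
  finally show "fls_nth (emb (a \<otimes>\<^bsub>W\<^esub> b)) m = fls_nth (emb a * emb b) m"
    using ab by (simp add: emb_nth cf_mult *)
qed

lemma cf_C_mult: "b \<in> carrier W \<Longrightarrow> cf (C r \<otimes>\<^bsub>W\<^esub> b) m = r * cf b m"
  using cf_monomial_mult[of b r 0 m] by (simp add: mon_def)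

lemma cf_mult_C: "b \<in> carrier W \<Longrightarrow> cf (b \<otimes>\<^bsub>W\<^esub> C r) m = cf b m * sg m r"
  using cf_mult_monomial[of b r 0 m] by (simp add: mon_def)

lemma cf_mon_mult: "b \<in> carrier W \<Longrightarrow> cf (mon k \<otimes>\<^bsub>W\<^esub> b) m = p k * sg k (cf b (m - k))"
  using cf_monomial_mult[of b 1 k m] by (simp add: C_1)

lemma cf_mult_mon: "b \<in> carrier W \<Longrightarrow> cf (b \<otimes>\<^bsub>W\<^esub> mon k) m = cf b (m - k) * sg (m - k) (p k)"
  using cf_mult_monomial[of b 1 k m] by (simp add: C_1)

lemma cf_mon: "cf (mon k) m = (if m = k then p k else 0)"
  using cf_monomial[of 1 k m] by (simp add: C_1)

text \<open>Commuting with \<open>t\<close> forces the exponents to be multiples of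
  \<open>n\<close>, and commuting with \<open>x\<close> forces the coefficients to be invariant.
  Conversely, these conditions make every twist trivial in both orders of multiplication, so that
  commutativity is inherited from the target of \<open>emb\<close>.\<close>

lemma center_iff: "z \<in> Z \<longleftrightarrow> z \<in> carrier W \<and> (\<forall>k. cf z k \<noteq> 0 \<longrightarrow> int n dvd k) \<and> (\<forall>k. inv_poly (cf z k))"
proof
  assume "z \<in> Z"
  then have z: "z \<in> carrier W" and comm: "\<And>b. b \<in> carrier W \<Longrightarrow> z \<otimes>\<^bsub>W\<^esub> b = b \<otimes>\<^bsub>W\<^esub> z"
    by (auto simp: ring_center_def)
  have "int n dvd k" if "cf z k \<noteq> 0" for k
  proof -
    define t :: "'a poly" where "t = [:0, 1:]"
    have "cf z k * sg k t = cf z k * t"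
      using comm[OF C_closed, of t] cf_C_mult[OF z, of t k] cf_mult_C[OF z, of t k]
      by (metis mult.commute)
    then have "sg k [:0, 1:] = [:0, 1:]"
      using that by (simp add: t_def[symmetric])
    then have "coeff (sg k [:0, 1:]) 1 = coeff [:0, 1:] 1"
      by simp
    then show ?thesis
      by (simp add: powi_q_eq_1_iff)
  qed
  moreover have "inv_poly (cf z k)" for k
    using cf_mon_mult[OF z, of 1 "k + 1"] cf_mult_mon[OF z, of 1 "k + 1"] comm[OF mon_closed, of 1]
    by simp
  ultimately show "z \<in> carrier W \<and> (\<forall>k. cf z k \<noteq> 0 \<longrightarrow> int n dvd k) \<and> (\<forall>k. inv_poly (cf z k))"
    using z by blast
next
  assume z: "z \<in> carrier W \<and> (\<forall>k. cf z k \<noteq> 0 \<longrightarrow> int n dvd k) \<and> (\<forall>k. inv_poly (cf z k))"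
  have "z \<otimes>\<^bsub>W\<^esub> b = b \<otimes>\<^bsub>W\<^esub> z" if b: "b \<in> carrier W" for b
  proof (rule emb_inj)
    have "emb (z \<otimes>\<^bsub>W\<^esub> b) = emb z * emb b"
    proof (rule emb_mult_if)
      show "cf z k * sg k (cf b l) = cf z k * cf b l" for k l
        using z by (cases "cf z k = 0") auto
    qed (use z b in auto)
    moreover have "emb (b \<otimes>\<^bsub>W\<^esub> z) = emb b * emb z"
      by (rule emb_mult_if) (use z b sg_inv_poly in auto)
    ultimately show "emb (z \<otimes>\<^bsub>W\<^esub> b) = emb (b \<otimes>\<^bsub>W\<^esub> z)"
      by (simp add: mult.commute)
  qed (use z b in auto)
  with z show "z \<in> Z"
    by (auto simp: ring_center_def)
qed

lemma Z_closed: "z \<in> Z \<Longrightarrow> z \<in> carrier W"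
  and Z_dvd: "\<lbrakk>z \<in> Z; cf z k \<noteq> 0\<rbrakk> \<Longrightarrow> int n dvd k" and Z_inv: "z \<in> Z \<Longrightarrow> inv_poly (cf z k)"
  by (auto simp: center_iff)

lemma emb_mult:
  assumes z: "z \<in> Z" and b: "b \<in> carrier W"
  shows "emb (z \<otimes>\<^bsub>W\<^esub> b) = emb z * emb b"
proof (rule emb_mult_if[OF Z_closed[OF z] b])
  fix k l
  show "cf z k * sg k (cf b l) = cf z k * cf b l"
  proof (cases "cf z k = 0")
    case False
    then have "int n dvd k" by (rule Z_dvd[OF z])
    then show ?thesis by (simp only: sg_dvd)
  qed simp
qed

lemma subdomain_Z: "subdomain Z W"
proof (rule W.subdomainI)
  show "subcring Z W"
  proof (rule W.subcringI[OF W.subring_center])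
    show "a \<otimes>\<^bsub>W\<^esub> b = b \<otimes>\<^bsub>W\<^esub> a" if "a \<in> Z" "b \<in> Z" for a b
      using that unfolding ring_center_def by blast
  qed
  show "\<one>\<^bsub>W\<^esub> \<noteq> \<zero>\<^bsub>W\<^esub>"
    using cf_one[of 0] cf_zero[of 0] by force
  show "\<And>a b. \<lbrakk>a \<in> Z; b \<in> Z; a \<otimes>\<^bsub>W\<^esub> b = \<zero>\<^bsub>W\<^esub>\<rbrakk> \<Longrightarrow> a = \<zero>\<^bsub>W\<^esub> \<or> b = \<zero>\<^bsub>W\<^esub>"
    using W_integral Z_closed by blast
qed

lemma domain_Z: "domain ZR"
  by (rule W.subdomain_is_domain[OF subdomain_Z])

sublocale CS: central_subdomain W Z emb
proof -
  have "cring ZR"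
    using domain_Z by (simp add: domain_def)
  moreover have "embedded_domain_axioms ZR emb"
    by unfold_locales (auto simp: emb_add emb_mult emb_one Z_closed inj_on_def emb_inj)
  ultimately show "central_subdomain W Z emb"
    by (simp add: central_subdomain_def central_subdomain_axioms_def embedded_domain_def W.ring_axioms)
qed

end

section \<open>Frames and trace form of the algebra over its center\<close>

lemma to_fract_sum: "to_fract (\<Sum>x\<in>A. f x) = (\<Sum>x\<in>A. to_fract (f x))"
  by (induction A rule: infinite_finite_induct) simp_all

lemma scale_var_monom: "scale_var a (monom c k) = monom (a ^ k * c) k"
  by (rule poly_eqI) simp

lemma scale_var_of_nat [simp]: "scale_var a (of_nat k) = of_nat k"
  by (simp add: of_nat_poly)

context finite_quantum_gwa
begin

text \<open>Up to a factor, the coordinate of \<open>w\<close> along \<open>t^i x^d\<close>: the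
  \<open>t^i\<close>-parts of the coefficients at exponents congruent to \<open>d\<close> modulo
  \<open>n\<close> are collected into a central element. The trace and the coordinates of both
  frames are instances; \<open>r\<close> is \<open>n^2\<close> for the trace, and clears
  denominators for the frames.\<close>

definition component :: "'a poly \<Rightarrow> nat \<Rightarrow> int \<Rightarrow> 'a poly gwa_term set \<Rightarrow> 'a poly gwa_term set" where
  "component r i d w = of_cf (\<lambda>k. if int n dvd k then part i (r * cf w (k + d)) else 0)"

text \<open>The coefficients that define \<open>component r i d w\<close> are those of an element of the algebra.\<close>

definition integral_at :: "'a poly \<Rightarrow> int \<Rightarrow> bool" where
  "integral_at r d \<longleftrightarrow> (\<forall>w\<in>carrier W. \<forall>k. int n dvd k \<longrightarrow> p k dvd r * cf w (k + d))"

context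
  fixes r i d
  assumes integral_at: "integral_at r d" and i: "i < n"
begin

lemma component:
  assumes w: "w \<in> carrier W"
  shows component_closed: "component r i d w \<in> carrier W"
    and cf_component: "cf (component r i d w) k = (if int n dvd k then part i (r * cf w (k + d)) else 0)"
proof -
  let ?f = "\<lambda>k. if int n dvd k then part i (r * cf w (k + d)) else 0"
  have "{k. ?f k \<noteq> 0} \<subseteq> (\<lambda>l. l - d) ` {l. cf w l \<noteq> 0}"
  proof
    fix k assume "k \<in> {k. ?f k \<noteq> 0}"
    then have "cf w (k + d) \<noteq> 0"
      by (auto split: if_splits)
    then show "k \<in> (\<lambda>l. l - d) ` {l. cf w l \<noteq> 0}"
      by (intro image_eqI[of _ _ "k + d"]) auto
  qed
  then have "finite {k. ?f k \<noteq> 0}"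
    using cf_finite[OF w] by (meson finite_imageI finite_subset)
  moreover have "p k dvd ?f k" for k
    using integral_at w i inv_poly_p[of k] by (auto simp: integral_at_def intro!: dvd_part)
  ultimately show "component r i d w \<in> carrier W" "cf (component r i d w) k = ?f k"
    unfolding component_def using of_cf[of ?f] by auto
qed

lemma component_center: "w \<in> carrier W \<Longrightarrow> component r i d w \<in> Z"
  by (auto simp: center_iff component_closed cf_component)

lemma component_add:
  assumes "w \<in> carrier W" "w' \<in> carrier W"
  shows "component r i d (w \<oplus>\<^bsub>W\<^esub> w') = component r i d w \<oplus>\<^bsub>W\<^esub> component r i d w'"
  using assms by (intro W_eqI) (simp_all add: component_closed cf_component cf_add ring_distribs)

text \<open>Multiplication by a central element is convolution without twist, with invariant
  coefficients at multiples of \<open>n\<close>. Over such coefficients \<open>part i\<close> is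
  linear, and divisibility of exponents by \<open>n\<close> is preserved.\<close>

lemma component_smult:
  assumes z: "z \<in> Z" and w: "w \<in> carrier W"
  shows "component r i d (z \<otimes>\<^bsub>W\<^esub> w) = z \<otimes>\<^bsub>W\<^esub> component r i d w"
proof (rule W_eqI)
  note zW = Z_closed[OF z]
  show "component r i d (z \<otimes>\<^bsub>W\<^esub> w) \<in> carrier W" "z \<otimes>\<^bsub>W\<^esub> component r i d w \<in> carrier W"
    using zW w by (simp_all add: component_closed)
  fix k
  have sg_l: "int n dvd l" if "l \<in> {l. cf z l \<noteq> 0}" for l
    using Z_dvd[OF z, of l] that by simp
  have rhs: "cf (z \<otimes>\<^bsub>W\<^esub> component r i d w) k = (\<Sum>l | cf z l \<noteq> 0. cf z l * cf (component r i d w) (k - l))"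
    unfolding cf_mult[OF zW component_closed[OF w]] using sg_l by (intro sum.cong HOL.refl) simp
  show "cf (component r i d (z \<otimes>\<^bsub>W\<^esub> w)) k = cf (z \<otimes>\<^bsub>W\<^esub> component r i d w) k"
  proof (cases "int n dvd k")
    case True
    have "cf (component r i d (z \<otimes>\<^bsub>W\<^esub> w)) k = part i (r * cf (z \<otimes>\<^bsub>W\<^esub> w) (k + d))"
      using True zW w by (simp add: cf_component)
    also have "cf (z \<otimes>\<^bsub>W\<^esub> w) (k + d) = (\<Sum>l | cf z l \<noteq> 0. cf z l * cf w (k + d - l))"
      unfolding cf_mult[OF zW w] using sg_l by (intro sum.cong HOL.refl) simp
    also have "part i (r * \<dots>) = (\<Sum>l | cf z l \<noteq> 0. part i (cf z l * (r * cf w (k - l + d))))"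
      by (simp add: sum_distrib_left part_sum mult.left_commute algebra_simps)
    also have "\<dots> = (\<Sum>l | cf z l \<noteq> 0. cf z l * cf (component r i d w) (k - l))"
    proof (rule sum.cong[OF HOL.refl])
      fix l assume "l \<in> {l. cf z l \<noteq> 0}"
      then have "int n dvd k - l"
        using sg_l[of l] True by simp
      then show "part i (cf z l * (r * cf w (k - l + d))) = cf z l * cf (component r i d w) (k - l)"
        using w by (simp add: cf_component part_mult_inv_poly[OF Z_inv[OF z] i])
    qed
    finally show ?thesis
      unfolding rhs .
  next
    case False
    have "cf (component r i d w) (k - l) = 0" if "l \<in> {l. cf z l \<noteq> 0}" for l
    proof -
      have "\<not> int n dvd k - l"
        using sg_l[OF that] False by (metis diff_add_cancel dvd_add)
      then show ?thesis
        using w by (simp add: cf_component)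
    qed
    then show ?thesis
      unfolding rhs using False zW w by (simp add: cf_component)
  qed
qed

end

definition tr :: "'a poly gwa_term set \<Rightarrow> 'a poly gwa_term set" where
  "tr = component (of_nat (n * n)) 0 0"

lemma integral_at_tr: "integral_at (of_nat (n * n)) 0"
  by (auto simp: integral_at_def p_dvd_cf)

lemma cf_tr: "b \<in> carrier W \<Longrightarrow> cf (tr b) k = (if int n dvd k then of_nat (n * n) * part 0 (cf b k) else 0)"
  using n unfolding tr_def by (simp add: cf_component[OF integral_at_tr] part_mult_inv_poly del: of_nat_mult)

lemma tr_center: "b \<in> carrier W \<Longrightarrow> tr b \<in> Z"
  using n unfolding tr_def by (intro component_center integral_at_tr)

text \<open>The quotient of \<open>p (s n)\<close> by \<open>p (s j)\<close>, obtained from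
  \<open>y^n = y^j y^(n-j)\<close> when \<open>s = - 1\<close>; for \<open>s = 1\<close> both
  factors are \<open>1\<close>.\<close>

definition compl :: "int \<Rightarrow> nat \<Rightarrow> 'a poly" where
  "compl s j = (if s = 1 then 1 else sg (- int j) (p (int j - int n)))"

text \<open>The sign \<open>s\<close> selects the frame on powers of \<open>x\<close> for
  \<open>s = 1\<close>, with denominator \<open>X\<close>, or on powers of \<open>y\<close> for
  \<open>s = - 1\<close>, with denominator \<open>Y\<close>.\<close>

abbreviation "V s \<equiv> mon (s * int n)"

definition e :: "int \<Rightarrow> nat \<Rightarrow> 'a poly gwa_term set" where
  "e s c = C (monom 1 (c mod n)) \<otimes>\<^bsub>W\<^esub> mon (s * int (c div n))"

text \<open>Multiplication by \<open>V s\<close> shifts exponents by \<open>s n\<close>, so the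
  coordinate of \<open>V s w\<close> along the power \<open>s j\<close> is read off from
  \<open>w\<close> at exponents shifted to \<open>s j - s n\<close>.\<close>

definition \<alpha> :: "int \<Rightarrow> nat \<Rightarrow> 'a poly gwa_term set \<Rightarrow> 'a poly gwa_term set" where
  "\<alpha> s c = (\<lambda>w\<in>carrier W. component (compl s (c div n)) (c mod n) (s * int (c div n) - s * int n) w)"

text \<open>Negation of both entries of the index pair modulo \<open>n\<close>, extended by the
  identity so as to be a permutation of \<open>{..<n * n}\<close>.\<close>

definition \<rho> :: "nat \<Rightarrow> nat" where
  "\<rho> c = (if c < n * n then (n - c mod n) mod n + n * ((n - c div n) mod n) else c)"

lemma e_closed [simp]: "e s c \<in> carrier W"
  by (simp add: e_def)

lemma cf_e: "cf (e s c) m = (if m = s * int (c div n) then monom 1 (c mod n) * p m else 0)"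
  unfolding e_def cf_monomial by auto

lemma cf_mult_e: "b \<in> carrier W \<Longrightarrow> cf (b \<otimes>\<^bsub>W\<^esub> e s c) m
    = cf b (m - s * int (c div n)) * sg (m - s * int (c div n)) (monom 1 (c mod n) * p (s * int (c div n)))"
  unfolding e_def by (rule cf_mult_monomial)

lemma div_mod_less: "c < n * n \<Longrightarrow> c div n < n" "c < n * n \<Longrightarrow> c mod n < n"
  using n by (simp_all add: less_mult_imp_div_less)

lemma V_center: "V s \<in> Z"
  by (auto simp: center_iff cf_mon inv_poly_p)

lemma V_nonzero: "V s \<noteq> \<zero>\<^bsub>W\<^esub>"
  using cf_mon[of "s * int n" "s * int n"] cf_zero[of "s * int n"] p_nonzero by force

section \<open>The two frames\<close>

context
  fixes s :: int
  assumes s: "s = 1 \<or> s = - 1"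
begin

lemma p_compl: "j < n \<Longrightarrow> p (s * int j) * compl s j = p (s * int n)"
  using s p_add[of "- int j" "int j - int n"] by (auto simp: compl_def)

text \<open>For \<open>k \<ge> 0\<close> the divisor is \<open>1\<close>. For negative
  \<open>k\<close> and \<open>s = 1\<close>, the factor that divides the shifted coefficient of
  \<open>w\<close> already contains \<open>p k\<close>. For \<open>s = - 1\<close> it becomes
  \<open>p (k + n) * p (- n) = p k\<close> after multiplication by \<open>compl\<close>.\<close>

lemma integral_at_compl:
  assumes j: "j < n"
  shows "integral_at (compl s j) (s * int j - s * int n)"
  unfolding integral_at_def
proof (intro ballI allI impI)
  fix w k assume w: "w \<in> carrier W" and k: "int n dvd k"
  show "p k dvd compl s j * cf w (k + (s * int j - s * int n))"
  proof (cases "k \<ge> 0")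
    case False
    with s show ?thesis
    proof (elim disjE)
      assume s1: "s = 1"
      have "p k dvd p (k + (int j - int n))"
        using p_add[of k "int j - int n"] False j by simp
      then show ?thesis
        using p_dvd_cf[OF w, of "k + (int j - int n)"] s1 by (auto simp: compl_def intro: dvd_trans)
    next
      assume s1: "s = - 1"
      \<comment> \<open>A negative multiple of \<open>n\<close> is at most \<open>- n\<close>; this
        makes \<open>p_add\<close> applicable at \<open>k + n\<close>.\<close>
      have kn: "k + int n \<le> 0"
      proof -
        have "int n dvd - k" "0 < - k"
          using k False by simp_all
        then have "int n \<le> - k"
          by (rule zdvd_imp_le)
        then show ?thesis by simp
      qed
      obtain g where "cf w (k + int n + - int j) = p (k + int n + - int j) * g"
        using p_dvd_cf[OF w] by blast
      also have "p (k + int n + - int j) = p (k + int n) * p (- int j)"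
        using p_add[OF kn, of "- int j"] k by simp
      finally have "compl s j * cf w (k + int n + - int j) = p (k + int n) * (p (- int j) * compl s j) * g"
        by (simp only: mult_ac)
      also have "p (- int j) * compl s j = p (- int n)"
        using p_compl[OF j] s1 by simp
      also have "p (k + int n) * p (- int n) = p k"
        using p_add[OF kn, of "- int n"] k by simp
      finally show ?thesis
        using s1 by (simp add: algebra_simps)
    qed
  qed simp
qed

lemma \<alpha>:
  assumes c: "c < n * n" and w: "w \<in> carrier W"
  shows \<alpha>_center: "\<alpha> s c w \<in> Z"
    and cf_\<alpha>: "cf (\<alpha> s c w) k = (if int n dvd k
      then part (c mod n) (compl s (c div n) * cf w (k + (s * int (c div n) - s * int n))) else 0)"
  using w component_center[OF integral_at_compl div_mod_less(2)] cf_component[OF integral_at_compl div_mod_less(2)] div_mod_less[OF c] c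
  unfolding \<alpha>_def by auto

text \<open>Exactly one \<open>j < n\<close> is congruent to \<open>s m\<close> modulo
  \<open>n\<close>, and \<open>s\<close> is its own inverse.\<close>

lemma sum_residue: "(\<Sum>j<n. if int n dvd m - s * int j then a else 0) = (a :: 'b::comm_monoid_add)"
proof -
  define j0 where "j0 = nat ((s * m) mod int n)"
  have j0: "j0 < n" "int j0 = (s * m) mod int n"
    using n by (auto simp: j0_def nat_less_iff)
  have "int n dvd m - s * int j \<longleftrightarrow> j = j0" if "j < n" for j
  proof -
    have "int n dvd m - s * int j \<longleftrightarrow> int n dvd s * m - int j"
      using s dvd_minus_iff[of "int n" "m + int j"] by (auto simp: algebra_simps)
    also have "\<dots> \<longleftrightarrow> (s * m) mod int n = int j mod int n"
      by (rule mod_eq_dvd_iff[symmetric])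
    also have "\<dots> \<longleftrightarrow> j = j0"
      using that j0 by auto
    finally show ?thesis .
  qed
  then have "(\<Sum>j<n. if int n dvd m - s * int j then a else 0) = (\<Sum>j<n. if j = j0 then a else 0)"
    by (intro sum.cong) auto
  then show ?thesis
    using j0 by simp
qed

text \<open>Compare coefficients of \<open>x^m\<close>. Only the \<open>j\<close> with
  \<open>s j\<close> congruent to \<open>m\<close> modulo \<open>n\<close> contributes, and for this
  \<open>j\<close> the sum over \<open>i\<close> reassembles a polynomial from its parts.\<close>

lemma frame_expand:
  assumes w: "w \<in> carrier W"
  shows "V s \<otimes>\<^bsub>W\<^esub> w = (\<Oplus>\<^bsub>W\<^esub>c\<in>{..<n * n}. \<alpha> s c w \<otimes>\<^bsub>W\<^esub> e s c)"
proof (rule W_eqI)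
  have \<alpha>W: "\<alpha> s c w \<in> carrier W" if "c < n * n" for c
    using \<alpha>_center[OF that w] by (rule Z_closed)
  then show "(\<Oplus>\<^bsub>W\<^esub>c\<in>{..<n * n}. \<alpha> s c w \<otimes>\<^bsub>W\<^esub> e s c) \<in> carrier W"
    by (intro W.finsum_closed) auto
  fix m
  let ?g = "\<lambda>i j. if int n dvd m - s * int j
      then p (s * int j) * (part i (compl s j * cf w (m - s * int n)) * monom 1 i) else 0"
  have "cf (\<Oplus>\<^bsub>W\<^esub>c\<in>{..<n * n}. \<alpha> s c w \<otimes>\<^bsub>W\<^esub> e s c) m = (\<Sum>c<n * n. cf (\<alpha> s c w \<otimes>\<^bsub>W\<^esub> e s c) m)"
    using \<alpha>W by (intro cf_finsum) auto
  also have "\<dots> = (\<Sum>c<n * n. ?g (c mod n) (c div n))"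
  proof (rule sum.cong[OF HOL.refl])
    fix c assume "c \<in> {..<n * n}"
    then have c: "c < n * n" by simp
    have "m - s * int (c div n) + (s * int (c div n) - s * int n) = m - s * int n"
      by simp
    then show "cf (\<alpha> s c w \<otimes>\<^bsub>W\<^esub> e s c) m = ?g (c mod n) (c div n)"
      unfolding cf_mult_e[OF \<alpha>W[OF c]] cf_\<alpha>[OF c w] by (simp add: mult_ac del: scale_var_mult)
  qed
  also have "\<dots> = (\<Sum>j<n. \<Sum>i<n. ?g i j)"
    using n by (rule sum_div_mod)
  also have "\<dots> = (\<Sum>j<n. if int n dvd m - s * int j then p (s * int n) * cf w (m - s * int n) else 0)"
  proof (rule sum.cong[OF HOL.refl])
    fix j assume "j \<in> {..<n}"
    then have pc: "p (s * int j) * compl s j = p (s * int n)"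
      using p_compl by simp
    have "(\<Sum>i<n. p (s * int j) * (part i (compl s j * cf w (m - s * int n)) * monom 1 i))
        = p (s * int n) * cf w (m - s * int n)"
      unfolding sum_distrib_left[symmetric] sum_part by (simp only: mult.assoc[symmetric] pc)
    then show "(\<Sum>i<n. ?g i j) = (if int n dvd m - s * int j then p (s * int n) * cf w (m - s * int n) else 0)"
      by (cases "int n dvd m - s * int j") (simp_all only: if_True if_False sum.neutral_const)
  qed
  also have "\<dots> = p (s * int n) * cf w (m - s * int n)"
    by (rule sum_residue)
  finally show "cf (V s \<otimes>\<^bsub>W\<^esub> w) m = cf (\<Oplus>\<^bsub>W\<^esub>c\<in>{..<n * n}. \<alpha> s c w \<otimes>\<^bsub>W\<^esub> e s c) m"
    using w by (simp add: cf_mon_mult)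
qed (use w in simp_all)

lemma frame_delta:
  assumes c: "c < n * n" and c': "c' < n * n"
  shows "\<alpha> s c (e s c') = (if c = c' then V s else \<zero>\<^bsub>W\<^esub>)"
proof (rule W_eqI)
  let ?i = "c mod n" and ?j = "c div n" and ?i' = "c' mod n" and ?j' = "c' div n"
  note less = div_mod_less[OF c] div_mod_less[OF c']
  show "\<alpha> s c (e s c') \<in> carrier W"
    using \<alpha>_center[OF c] by (simp add: Z_closed)
  have eq_iff: "c = c' \<longleftrightarrow> ?i = ?i' \<and> ?j = ?j'"
    by (metis div_mult_mod_eq)
  fix k
  show "cf (\<alpha> s c (e s c')) k = cf (if c = c' then V s else \<zero>\<^bsub>W\<^esub>) k"
  proof (cases "int n dvd k \<and> k + (s * int ?j - s * int n) = s * int ?j'")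
    case True
    then have "int n dvd s * (int ?j' - int ?j)"
      by (metis (no_types, lifting) add_diff_cancel_left' diff_add_eq diff_diff_eq2 dvd_diff dvd_triv_right right_diff_distrib')
    then have "int n dvd int ?j' - int ?j"
      using s by (auto simp: algebra_simps dvd_diff_commute)
    then have jj: "?j = ?j'"
      using less by (simp flip: mod_eq_dvd_iff)
    then have k: "k = s * int n"
      using True by simp
    have "cf (\<alpha> s c (e s c')) k = part ?i (compl s ?j * (monom 1 ?i' * p (s * int ?j')))"
      using True by (simp add: cf_\<alpha>[OF c] cf_e)
    also have "compl s ?j * (monom 1 ?i' * p (s * int ?j')) = p (s * int n) * monom 1 ?i'"
      using p_compl[of ?j] less jj by (simp add: mult_ac)
    also have "part ?i \<dots> = (if ?i = ?i' then p (s * int n) else 0)"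
      using less by (intro part_inv_monom) (auto intro: inv_poly_p)
    finally show ?thesis
      using jj eq_iff k by (simp add: cf_mon)
  next
    case False
    then have "cf (\<alpha> s c (e s c')) k = 0"
      by (auto simp: cf_\<alpha>[OF c] cf_e)
    moreover have "\<not> (c = c' \<and> k = s * int n)"
      using False by auto
    ultimately show ?thesis
      by (auto simp: cf_mon)
  qed
qed simp

lemma frame_W: "frame ZR (mult_module W) (n * n) (V s) (e s) (\<alpha> s)"
proof -
  have "\<alpha> s c \<in> carrier (dual ZR (mult_module W))" if c: "c < n * n" for c
  proof -
    note component = integral_at_compl[OF div_mod_less(1)[OF c]] div_mod_less(2)[OF c]
    show ?thesis
      unfolding dual_iff using \<alpha>_center[OF c] component_add[OF component] component_smult[OF component] Z_closed
      by (auto simp: \<alpha>_def)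
  qed
  then show ?thesis
    unfolding frame_def
    using V_center V_nonzero frame_expand frame_delta by (simp add: finsum_mult_module)
qed

text \<open>All diagonal entries agree: the coordinate of \<open>b e\<close> along \<open>e\<close>,
  with the denominator cleared, is \<open>V s\<close> times the projection of \<open>b\<close> to
  the center, whatever the basis element \<open>e\<close>. The \<open>n * n\<close> equal summands
  give the factor in \<open>tr\<close>.\<close>

lemma trace_W:
  assumes b: "b \<in> carrier W"
  shows "(\<Sum>c<n * n. emb (\<alpha> s c (b \<otimes>\<^bsub>W\<^esub> e s c))) = emb (V s) * emb (tr b)"
proof (rule fls_eqI)
  fix m
  have be: "b \<otimes>\<^bsub>W\<^esub> e s c \<in> carrier W" for c
    using b by simp
  have "fls_nth (\<Sum>c<n * n. emb (\<alpha> s c (b \<otimes>\<^bsub>W\<^esub> e s c))) m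
      = to_fract (\<Sum>c<n * n. cf (\<alpha> s c (b \<otimes>\<^bsub>W\<^esub> e s c)) m)"
    unfolding fls_nth_sum to_fract_sum
    by (intro sum.cong HOL.refl emb_nth Z_closed \<alpha>_center be) simp
  also have "(\<Sum>c<n * n. cf (\<alpha> s c (b \<otimes>\<^bsub>W\<^esub> e s c)) m)
      = (\<Sum>c<n * n. if int n dvd m then p (s * int n) * part 0 (cf b (m - s * int n)) else 0)"
  proof (rule sum.cong[OF HOL.refl])
    fix c assume "c \<in> {..<n * n}"
    then have c: "c < n * n" by simp
    let ?i = "c mod n" and ?j = "c div n"
    show "cf (\<alpha> s c (b \<otimes>\<^bsub>W\<^esub> e s c)) m = (if int n dvd m then p (s * int n) * part 0 (cf b (m - s * int n)) else 0)"
    proof (cases "int n dvd m")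
      case True
      have idx: "m + (s * int ?j - s * int n) - s * int ?j = m - s * int n"
        by simp
      have "int n dvd m - s * int n"
        using True by simp
      then have "cf (b \<otimes>\<^bsub>W\<^esub> e s c) (m + (s * int ?j - s * int n))
          = cf b (m - s * int n) * (monom 1 ?i * p (s * int ?j))"
        unfolding cf_mult_e[OF b] idx by (simp only: sg_dvd)
      then have "cf (\<alpha> s c (b \<otimes>\<^bsub>W\<^esub> e s c)) m
          = part ?i (compl s ?j * (cf b (m - s * int n) * (monom 1 ?i * p (s * int ?j))))"
        using True by (simp add: cf_\<alpha>[OF c be])
      also have "compl s ?j * (cf b (m - s * int n) * (monom 1 ?i * p (s * int ?j)))
          = p (s * int n) * (monom 1 ?i * cf b (m - s * int n))"
        using p_compl[OF div_mod_less(1)[OF c]] by (simp add: mult_ac)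
      also have "part ?i \<dots> = p (s * int n) * part 0 (cf b (m - s * int n))"
        using div_mod_less[OF c] by (simp add: part_mult_inv_poly inv_poly_p part_monom_mult)
      finally show ?thesis
        using True by simp
    qed (simp add: cf_\<alpha>[OF c be])
  qed
  also have "\<dots> = cf (V s \<otimes>\<^bsub>W\<^esub> tr b) m"
  proof -
    have "int n dvd m - s * int n \<longleftrightarrow> int n dvd m"
      by (metis diff_add_cancel dvd_add dvd_diff dvd_triv_right)
    then show ?thesis
      using b tr_center[OF b, THEN Z_closed] by (simp add: cf_mon_mult cf_tr mult.left_commute)
  qed
  finally show "fls_nth (\<Sum>c<n * n. emb (\<alpha> s c (b \<otimes>\<^bsub>W\<^esub> e s c))) m = fls_nth (emb (V s) * emb (tr b)) m"
    using tr_center[OF b, THEN Z_closed] V_center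
    by (simp add: emb_nth flip: emb_mult)
qed

end

section \<open>The trace form on the frames\<close>

lemma \<rho>_less: "c < n * n \<Longrightarrow> \<rho> c < n * n" and \<rho>_mod: "c < n * n \<Longrightarrow> \<rho> c mod n = (n - c mod n) mod n"
  and \<rho>_div: "c < n * n \<Longrightarrow> \<rho> c div n = (n - c div n) mod n"
proof -
  have "a + n * b < n * n" if "a < n" "b < n" for a b
  proof -
    have "a + n * b < n * Suc b" using that by simp
    also have "\<dots> \<le> n * n" using that by (intro mult_le_mono2) simp
    finally show ?thesis .
  qed
  then show "c < n * n \<Longrightarrow> \<rho> c < n * n"
    using n by (simp add: \<rho>_def)
qed (use n in \<open>simp_all add: \<rho>_def\<close>)

lemma neg_mod_neg_mod: "a < n \<Longrightarrow> (n - (n - a) mod n) mod n = a"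
  using n by (cases "a = 0") simp_all

lemma \<rho>_permutes: "\<rho> permutes {..<n * n}"
proof (rule bij_imp_permutes)
  have "\<rho> (\<rho> c) = c" if "c < n * n" for c
    using that \<rho>_less[OF that] \<rho>_mod[OF \<rho>_less[OF that]] \<rho>_div[OF \<rho>_less[OF that]]
    by (metis \<rho>_div \<rho>_mod div_mod_less div_mult_mod_eq neg_mod_neg_mod)
  then show "bij_betw \<rho> {..<n * n} {..<n * n}"
    using \<rho>_less by (intro bij_betw_byWitness[where f' = \<rho>]) auto
qed (simp add: \<rho>_def)

lemma dvd_add_neg_mod: "\<lbrakk>a < n; b < n\<rbrakk> \<Longrightarrow> n dvd a + (n - b) mod n \<longleftrightarrow> a = b"
proof (cases "b = 0")
  case False
  assume ab: "a < n" "b < n"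
  then have "(n - b) mod n = n - b"
    using False by simp
  moreover have "n dvd a + (n - b) \<Longrightarrow> a = b"
  proof -
    assume "n dvd a + (n - b)"
    then obtain t where t: "a + (n - b) = n * t" by blast
    have "n - b > 0" using ab by simp
    then have "t \<noteq> 0" using t by (intro notI) simp
    moreover have "n * t < n * 2" unfolding t[symmetric] using ab False by linarith
    ultimately have "t = 1" by simp
    with t ab show "a = b" by simp
  qed
  ultimately show ?thesis using ab by auto
qed (use n in \<open>auto dest: dvd_imp_le\<close>)

lemma add_neg_mod: "a < n \<Longrightarrow> a + (n - a) mod n = (if a = 0 then 0 else n)"
  by (cases "a = 0") simp_all

text \<open>The scalar that arises when the power \<open>s j\<close> of \<open>x\<close> passes
  \<open>t^i'\<close>, where \<open>i'\<close> represents \<open>- i\<close> modulo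
  \<open>n\<close>, together with the factor \<open>n^2\<close> of the trace.\<close>

definition \<kappa> :: "int \<Rightarrow> nat \<Rightarrow> 'a" where
  "\<kappa> s c = of_nat (n * n) * (q powi (s * int (c div n))) ^ ((n - c mod n) mod n)"

definition T :: "'a poly gwa_term set" where "T = C (monom 1 n)"

text \<open>Up to the scalar, the product of a basis element with its partner is \<open>t^n\<close>
  or \<open>1\<close>, times \<open>V s\<close> or \<open>1\<close>, according to whether
  \<open>i\<close> and \<open>j\<close> vanish.\<close>

definition D :: "int \<Rightarrow> nat \<Rightarrow> 'a poly fract fls" where
  "D s c = emb (C [:\<kappa> s c:]) * emb T ^ (if c mod n = 0 then 0 else 1)
    * emb (V s) ^ (if c div n = 0 then 0 else 1)"

lemma \<kappa>_nonzero: "\<kappa> s c \<noteq> 0"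
  using q of_nat_n_nonzero by (simp add: \<kappa>_def)

lemma C_center: "inv_poly r \<Longrightarrow> C r \<in> Z"
  by (simp add: center_iff cf_C)

lemma T_center: "T \<in> Z"
  unfolding T_def by (rule C_center) (simp add: scale_var_monom power_q_eq_1_iff)

text \<open>The product of two basis elements is a scalar times a single monomial with exponents
  \<open>i + i'\<close> and \<open>j + j'\<close>. The trace kills it unless both are divisible by
  \<open>n\<close>, which identifies the partner uniquely.\<close>

lemma trace_form:
  assumes s: "s = 1 \<or> s = - 1" and c: "c < n * n" and c': "c' < n * n"
  shows "emb (tr (e s c \<otimes>\<^bsub>W\<^esub> e s (\<rho> c'))) = (if c = c' then D s c else 0)"
proof -
  define i j i' j' where "i = c mod n" and "j = c div n" and "i' = (n - c' mod n) mod n" and "j' = (n - c' div n) mod n"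
  note less = div_mod_less[OF c, folded i_def j_def] div_mod_less[OF c']
  have i'j': "i' < n" "j' < n"
    using n by (simp_all add: i'_def j'_def)
  have \<rho>c': "\<rho> c' mod n = i'" "\<rho> c' div n = j'"
    using \<rho>_mod[OF c'] \<rho>_div[OF c'] by (simp_all add: i'_def j'_def)
  have ee: "e s c \<otimes>\<^bsub>W\<^esub> e s (\<rho> c') \<in> carrier W"
    by simp
  define k where "k = (q powi (s * int j)) ^ i'"
  have p_sum: "p (s * int j) * sg (s * int j) (p (s * int j')) = p (s * int (j + j'))"
    using s p_add[of "- int j" "- int j'"] by auto
  have cf_ee: "cf (e s c \<otimes>\<^bsub>W\<^esub> e s (\<rho> c')) m
      = (if m = s * int (j + j') then monom k (i + i') * p m else 0)" for m
  proof (cases "m = s * int (j + j')")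
    case True
    then have m: "m - s * int j' = s * int j"
      by (simp add: algebra_simps)
    have "cf (e s c \<otimes>\<^bsub>W\<^esub> e s (\<rho> c')) m
        = monom 1 i * p (s * int j) * sg (s * int j) (monom 1 i' * p (s * int j'))"
      by (subst cf_mult_e) (simp_all add: cf_e \<rho>c' m i_def j_def)
    also have "\<dots> = monom 1 i * monom k i' * (p (s * int j) * sg (s * int j) (p (s * int j')))"
      by (simp add: scale_var_monom k_def mult_ac)
    finally show ?thesis
      unfolding p_sum using True by (simp add: mult_monom)
  next
    case False
    then have "m - s * int j' \<noteq> s * int j"
      by (auto simp: algebra_simps)
    then show ?thesis
      using False by (subst cf_mult_e) (simp_all add: cf_e \<rho>c' j_def)
  qed
  have eq_iff: "c = c' \<longleftrightarrow> i = c' mod n \<and> j = c' div n"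
    unfolding i_def j_def by (metis div_mult_mod_eq)
  have dvd_j: "int n dvd s * int (j + j') \<longleftrightarrow> j = c' div n"
  proof -
    have "int n dvd s * int (j + j') \<longleftrightarrow> n dvd j + j'"
      using s int_dvd_int_iff[of n "j + j'"] by (auto simp flip: of_nat_add)
    also have "\<dots> \<longleftrightarrow> j = c' div n"
      unfolding j'_def using less by (intro dvd_add_neg_mod)
    finally show ?thesis .
  qed
  have dvd_i: "n dvd i + i' \<longleftrightarrow> i = c' mod n"
    unfolding i'_def using less by (intro dvd_add_neg_mod)
  have part: "part 0 (monom k (i + i') * p m) = (if n dvd i + i' then monom k (i + i') * p m else 0)"
    if "int n dvd m" for m
  proof -
    have "part 0 (p m * monom k (i + i')) = p m * part 0 (monom k (i + i'))"
      using n inv_poly_p[OF that] by (intro part_mult_inv_poly)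
    also have "part 0 (monom k (i + i')) = (if n dvd i + i' then monom k (i + i') else 0)"
      by (auto simp: poly_eq_iff)
    finally show ?thesis
      by (simp add: mult.commute)
  qed
  show ?thesis
  proof (cases "c = c'")
    case False
    have "cf (tr (e s c \<otimes>\<^bsub>W\<^esub> e s (\<rho> c'))) m = 0" for m
      using False eq_iff dvd_i dvd_j part by (auto simp: cf_tr[OF ee] cf_ee)
    then have "emb (tr (e s c \<otimes>\<^bsub>W\<^esub> e s (\<rho> c'))) = 0"
      by (simp add: emb_def)
    with False show ?thesis by simp
  next
    case True
    have ij: "i + i' = (if i = 0 then 0 else n)" "j + j' = (if j = 0 then 0 else n)"
      unfolding i'_def j'_def using True less add_neg_mod by (simp_all add: i_def j_def)
    have \<kappa>: "[:\<kappa> s c:] * monom 1 (i + i') = of_nat (n * n) * monom k (i + i')"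
      using True by (simp add: \<kappa>_def k_def i_def j_def i'_def of_nat_poly mult_monom flip: monom_0)
    have "tr (e s c \<otimes>\<^bsub>W\<^esub> e s (\<rho> c')) = C ([:\<kappa> s c:] * monom 1 (i + i')) \<otimes>\<^bsub>W\<^esub> mon (s * int (j + j'))"
    proof (rule W_eqI)
      fix m
      show "cf (tr (e s c \<otimes>\<^bsub>W\<^esub> e s (\<rho> c'))) m = cf (C ([:\<kappa> s c:] * monom 1 (i + i')) \<otimes>\<^bsub>W\<^esub> mon (s * int (j + j'))) m"
        unfolding \<kappa> cf_tr[OF ee] cf_ee cf_monomial
        using True eq_iff dvd_i dvd_j part by (auto simp: mult.assoc)
    qed (use tr_center[OF ee, THEN Z_closed] in simp_all)
    also have "\<dots> = C [:\<kappa> s c:] \<otimes>\<^bsub>W\<^esub> (C (monom 1 (i + i')) \<otimes>\<^bsub>W\<^esub> mon (s * int (j + j')))"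
      unfolding C_mult[symmetric] by (rule W.m_assoc) simp_all
    also have "emb \<dots> = emb (C [:\<kappa> s c:]) * (emb (C (monom 1 (i + i'))) * emb (mon (s * int (j + j'))))"
    proof -
      have "C (monom 1 (i + i')) \<in> Z"
        using ij(1) T_center C_center[of 1] by (auto simp: T_def split: if_splits)
      then show ?thesis
        by (simp add: emb_mult C_center)
    qed
    also have "emb (C (monom 1 (i + i'))) = emb T ^ (if i = 0 then 0 else 1)"
      using ij(1) by (simp add: T_def C_1 emb_one)
    also have "emb (mon (s * int (j + j'))) = emb (V s) ^ (if j = 0 then 0 else 1)"
      using ij(2) emb_one by (auto simp: mon_def)
    finally show ?thesis
      using True by (simp add: D_def i_def j_def mult.assoc)
  qed
qed

text \<open>Among the \<open>n * n\<close> index pairs, \<open>n (n - 1)\<close> have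
  \<open>i \<noteq> 0\<close> and as many have \<open>j \<noteq> 0\<close>; these counts are the
  exponents of \<open>t^n\<close> and of \<open>V s\<close>.\<close>

lemma prod_D: "\<exists>a. a \<noteq> 0 \<and> (\<Prod>c<n * n. D s c) = emb (C [:a:]) * emb T ^ (n * (n - 1)) * emb (V s) ^ (n * (n - 1))"
proof -
  have "(\<Prod>c\<in>A. emb (C [:\<kappa> s c:])) = emb (C [:\<Prod>c\<in>A. \<kappa> s c:])" if "finite A" for A
    using that
  proof (induction A)
    case empty
    then show ?case by (simp add: C_1 emb_one flip: one_pCons)
  next
    case (insert x A)
    have "emb (C [:\<kappa> s x:]) * emb (C [:\<Prod>c\<in>A. \<kappa> s c:]) = emb (C ([:\<kappa> s x:] * [:\<Prod>c\<in>A. \<kappa> s c:]))"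
      unfolding C_mult[symmetric] by (rule emb_mult[symmetric]) (simp_all add: C_center)
    with insert show ?case by (simp add: mult.commute)
  qed
  then have "(\<Prod>c<n * n. emb (C [:\<kappa> s c:])) = emb (C [:\<Prod>c<n * n. \<kappa> s c:])"
    by simp
  moreover have count: "(\<Sum>i<n. if i = 0 then 0 else 1) = n - 1"
  proof -
    have "(\<Sum>i<n. if i = 0 then 0 else 1) = card ({..<n} - {0})"
      by (simp add: sum.If_cases Diff_eq)
    then show ?thesis using n by simp
  qed
  have "(\<Sum>c<n * n. if c mod n = 0 then 0 else 1) = n * (n - 1)"
    using sum_div_mod[OF n, of "\<lambda>i j. if i = 0 then 0 else (1::nat)"] count by simp
  moreover have "(\<Sum>c<n * n. if c div n = 0 then 0 else 1) = n * (n - 1)"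
    using sum_div_mod[OF n, of "\<lambda>i j. if j = 0 then 0 else (1::nat)"] count
    by (simp add: sum_distrib_left[symmetric])
  ultimately have "(\<Prod>c<n * n. D s c)
      = emb (C [:\<Prod>c<n * n. \<kappa> s c:]) * emb T ^ (n * (n - 1)) * emb (V s) ^ (n * (n - 1))"
    unfolding D_def prod.distrib by (simp only: power_sum[symmetric])
  then show ?thesis
    using \<kappa>_nonzero by (intro exI[of _ "\<Prod>c<n * n. \<kappa> s c"]) simp
qed

end

section \<open>The discriminants\<close>

lemma submodule_finsum:
  assumes N: "submodule R N M" and A: "finite A" "f \<in> A \<rightarrow> N"
  shows "finsum M f A \<in> N"
proof -
  interpret N: submodule R N M by fact
  interpret M: module R M by (rule N.module)
  show ?thesis
    using A
  proof (induction A)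
    case (insert x A)
    then show ?case
      using N.subset by (subst M.M.finsum_insert) (auto simp: Pi_iff subset_iff)
  qed simp
qed

text \<open>The frame consisting of \<open>1\<close>: since coordinates are recorded as numerators
  over \<open>v\<close>, the coordinate map is multiplication by \<open>v\<close>.\<close>

lemma (in domain) mult_module_frame:
  assumes v: "v \<in> carrier R" "v \<noteq> \<zero>"
  shows "frame R (mult_module R) 1 v (\<lambda>_. \<one>) (\<lambda>_. \<lambda>x\<in>carrier R. v \<otimes> x)"
  using v by (auto simp: frame_def dual_iff r_distr m_lcomm finsum_mult_module lessThan_Suc)

lemma (in cring) module_mult_module: "module R (mult_module R)"
  using module_over_central_subring[of "carrier R"] m_comm is_cring
  by (auto simp: ring_center_def)

lemma nat_pow_subring: "x [^]\<^bsub>B\<lparr>carrier := Z\<rparr>\<^esub> (k::nat) = x [^]\<^bsub>B\<^esub> k"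
  by (simp add: nat_pow_def)

context finite_quantum_gwa
begin

section \<open>Regularity of powers of \<open>X\<close> and \<open>Y\<close>\<close>

lemma C_pow: "C r [^]\<^bsub>W\<^esub> (k::nat) = C (r ^ k)"
  by (induction k) (simp_all add: C_1 C_mult mult.commute)

lemma cf_V_pow_mult:
  "w \<in> carrier W \<Longrightarrow> cf (V s [^]\<^bsub>W\<^esub> K \<otimes>\<^bsub>W\<^esub> w) m = p (s * int n) ^ K * cf w (m - int K * (s * int n))"
proof (induction K arbitrary: w m)
  case (Suc K)
  have "V s [^]\<^bsub>W\<^esub> Suc K \<otimes>\<^bsub>W\<^esub> w = V s [^]\<^bsub>W\<^esub> K \<otimes>\<^bsub>W\<^esub> (V s \<otimes>\<^bsub>W\<^esub> w)"
    using Suc.prems by (simp add: W.m_assoc)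
  then show ?case
    using Suc.IH[of "V s \<otimes>\<^bsub>W\<^esub> w" m] Suc.prems
    by (simp add: cf_mon_mult algebra_simps)
qed simp

lemma p_multiple: "p (- (int K * int n)) = p (- int n) ^ K"
proof (induction K)
  case (Suc K)
  have "p (- (int (Suc K) * int n)) = p (- (int K * int n) + - int n)"
    by (simp add: algebra_simps)
  also have "\<dots> = p (- (int K * int n)) * p (- int n)"
    by (subst p_add) simp_all
  finally show ?case
    using Suc by simp
qed simp

text \<open>The candidate for \<open>c\<close> is \<open>a\<close> with exponents shifted by
  \<open>L n\<close>, and it lies in the algebra if \<open>p k\<close> divides the shifted
  coefficient. For \<open>k < 0\<close>, comparing the hypothesis at exponent
  \<open>k + L n - K n\<close> shows that \<open>p (- n) ^ K\<close> times this coefficient is a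
  multiple of \<open>p (k - K n) = p (- n) ^ K * p k\<close>; the common factor cancels.\<close>

lemma V_regular:
  fixes K L :: nat
  assumes a: "a \<in> carrier W" and b: "b \<in> carrier W"
    and eq: "V (- 1) [^]\<^bsub>W\<^esub> K \<otimes>\<^bsub>W\<^esub> a = V 1 [^]\<^bsub>W\<^esub> L \<otimes>\<^bsub>W\<^esub> b"
  shows "\<exists>c\<in>carrier W. a = V 1 [^]\<^bsub>W\<^esub> L \<otimes>\<^bsub>W\<^esub> c \<and> (a \<in> Z \<longrightarrow> c \<in> Z)"
proof -
  let ?f = "\<lambda>k. cf a (k + int L * int n)"
  have "{k. ?f k \<noteq> 0} \<subseteq> (\<lambda>l. l - int L * int n) ` {l. cf a l \<noteq> 0}"
  proof
    fix k assume "k \<in> {k. ?f k \<noteq> 0}"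
    then show "k \<in> (\<lambda>l. l - int L * int n) ` {l. cf a l \<noteq> 0}"
      by (intro image_eqI[of _ _ "k + int L * int n"]) auto
  qed
  then have fin: "finite {k. ?f k \<noteq> 0}"
    using cf_finite[OF a] by (meson finite_imageI finite_subset)
  have "p k dvd ?f k" for k
  proof (cases "k \<ge> 0")
    case False
    let ?m = "k + int L * int n - int K * int n"
    have "cf (V (- 1) [^]\<^bsub>W\<^esub> K \<otimes>\<^bsub>W\<^esub> a) ?m = cf (V 1 [^]\<^bsub>W\<^esub> L \<otimes>\<^bsub>W\<^esub> b) ?m"
      using eq by simp
    then have "p (- int n) ^ K * ?f k = cf b (- (int K * int n) + k)"
      unfolding cf_V_pow_mult[OF a] cf_V_pow_mult[OF b] by (simp add: algebra_simps)
    moreover have "p (- (int K * int n) + k) = p (- int n) ^ K * p k"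
      using False by (subst p_add) (simp_all add: p_multiple)
    ultimately have "p (- int n) ^ K * p k dvd p (- int n) ^ K * ?f k"
      using p_dvd_cf[OF b, of "- (int K * int n) + k"] by simp
    then show ?thesis
      by simp
  qed simp
  note c = of_cf[of ?f, OF fin this]
  show ?thesis
  proof (intro bexI[of _ "of_cf ?f"] conjI impI)
    show "a = V 1 [^]\<^bsub>W\<^esub> L \<otimes>\<^bsub>W\<^esub> of_cf ?f"
      by (rule W_eqI) (use a c(1) cf_V_pow_mult[OF c(1), of 1 L] in \<open>simp_all add: c(2)\<close>)
    show "of_cf ?f \<in> Z" if "a \<in> Z"
      unfolding center_iff c(2)
    proof (intro conjI allI impI)
      show "int n dvd k" if "?f k \<noteq> 0" for k
        using Z_dvd[OF \<open>a \<in> Z\<close> that] by simp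
    qed (use c(1) Z_inv[OF that] in simp_all)
  qed (rule c(1))
qed

lemma Z_pow_closed: "z \<in> Z \<Longrightarrow> z [^]\<^bsub>W\<^esub> (k::nat) \<in> Z"
  using CS.Z.nat_pow_closed[of z k] by (simp add: nat_pow_subring)

lemma Z_mult_closed: "\<lbrakk>a \<in> Z; b \<in> Z\<rbrakk> \<Longrightarrow> a \<otimes>\<^bsub>W\<^esub> b \<in> Z"
  using CS.Z.m_closed[of a b] by simp

lemma Z_commute: "\<lbrakk>z \<in> Z; b \<in> carrier W\<rbrakk> \<Longrightarrow> z \<otimes>\<^bsub>W\<^esub> b = b \<otimes>\<^bsub>W\<^esub> z"
  by (simp add: ring_center_def)

lemma emb_pow: "z \<in> Z \<Longrightarrow> emb (z [^]\<^bsub>W\<^esub> (k::nat)) = emb z ^ k"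
  using CS.Z.emb_pow[of z k] by (simp add: nat_pow_subring)

lemma emb_mult_Z: "\<lbrakk>a \<in> Z; b \<in> Z\<rbrakk> \<Longrightarrow> emb (a \<otimes>\<^bsub>W\<^esub> b) = emb a * emb b"
  using emb_mult Z_closed by simp

lemma emb_eq_0_iff: "z \<in> Z \<Longrightarrow> emb z = 0 \<longleftrightarrow> z = \<zero>\<^bsub>W\<^esub>"
  using CS.Z.emb_eq_0_iff[of z] by simp

lemma W_cancel:
  assumes "z \<in> carrier W" "z \<noteq> \<zero>\<^bsub>W\<^esub>" "a \<in> carrier W" "b \<in> carrier W" "z \<otimes>\<^bsub>W\<^esub> a = z \<otimes>\<^bsub>W\<^esub> b"
  shows "a = b"
proof -
  have "z \<otimes>\<^bsub>W\<^esub> (a \<ominus>\<^bsub>W\<^esub> b) = \<zero>\<^bsub>W\<^esub>"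
    using assms by (simp add: W.minus_eq W.r_distr W.r_minus W.r_neg)
  then have "a \<ominus>\<^bsub>W\<^esub> b = \<zero>\<^bsub>W\<^esub>"
    using W_integral[of z "a \<ominus>\<^bsub>W\<^esub> b"] assms by auto
  then show ?thesis
    using assms by simp
qed

lemma V_pow_center: "V s [^]\<^bsub>W\<^esub> (k::nat) \<in> Z"
  by (intro Z_pow_closed V_center)

lemma V_pow_nonzero: "V s [^]\<^bsub>W\<^esub> (k::nat) \<noteq> \<zero>\<^bsub>W\<^esub>"
  using V_nonzero[of s] V_center[of s] V_pow_center[of s k]
  by (simp add: emb_pow flip: emb_eq_0_iff)

section \<open>Bounds for the discriminant ideal\<close>

abbreviation "I \<equiv> modified_discriminant W Z"

definition discr :: "'a poly gwa_term set" where "discr = T [^]\<^bsub>W\<^esub> (n * (n - 1))"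

lemma discr_center: "discr \<in> Z"
  unfolding discr_def by (intro Z_pow_closed T_center)

lemma discr_nonzero: "discr \<noteq> \<zero>\<^bsub>W\<^esub>"
proof -
  have "discr = C (monom 1 n ^ (n * (n - 1)))"
    by (simp add: discr_def T_def C_pow)
  moreover have "cf (C (monom 1 n ^ (n * (n - 1)))) 0 \<noteq> 0"
    by (simp add: cf_C)
  ultimately show ?thesis by auto
qed

definition gens :: "'a poly gwa_term set set" where
  "gens = {d \<in> Z. \<exists>u u'. u \<in> {..<n * n} \<rightarrow> carrier W \<and> inj_on u {..<n * n}
      \<and> u' \<in> {..<n * n} \<rightarrow> carrier W \<and> inj_on u' {..<n * n}
      \<and> emb d = det (mat (n * n) (n * n) (\<lambda>(i, j). emb (tr (u i \<otimes>\<^bsub>W\<^esub> u' j))))}"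

lemma I_eq: "I = genideal ZR gens"
proof -
  have 1: "(1::int) = 1 \<or> (1::int) = - 1"
    by simp
  note generators = CS.discriminant_generators[where \<tau> = tr, OF frame_W[OF 1] tr_center trace_W[OF 1]]
  show ?thesis
    by (simp only: modified_discriminant_def gens_def generators)
qed

lemma tr_add: "\<lbrakk>a \<in> carrier W; b \<in> carrier W\<rbrakk> \<Longrightarrow> emb (tr (a \<oplus>\<^bsub>W\<^esub> b)) = emb (tr a) + emb (tr b)"
  and tr_smult: "\<lbrakk>z \<in> Z; b \<in> carrier W\<rbrakk> \<Longrightarrow> emb (tr (z \<otimes>\<^bsub>W\<^esub> b)) = emb z * emb (tr b)"
  using n integral_at_tr tr_center
  by (simp_all add: tr_def component_add component_smult emb_add emb_mult_Z Z_closed component_center)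

text \<open>Comparison with a single frame. The exponent is twice the rank, one factor
  \<open>V s\<close> for each row of either coordinate matrix; the power of \<open>V s\<close> in
  the product of the \<open>D s c\<close> is absorbed into \<open>r\<close>.\<close>

lemma gens_multiple:
  assumes g: "g \<in> gens" and s: "s = 1 \<or> s = - 1"
  shows "\<exists>r\<in>Z. V s [^]\<^bsub>W\<^esub> (2 * (n * n)) \<otimes>\<^bsub>W\<^esub> g = discr \<otimes>\<^bsub>W\<^esub> r"
proof -
  obtain u u' where gZ: "g \<in> Z" and u: "u \<in> {..<n * n} \<rightarrow> carrier W" "u' \<in> {..<n * n} \<rightarrow> carrier W"
    and det: "emb g = det (mat (n * n) (n * n) (\<lambda>(i, j). emb (tr (u i \<otimes>\<^bsub>W\<^esub> u' j))))"
    using g unfolding gens_def by blast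
  obtain r where r: "r \<in> Z" "emb (V s) ^ (2 * (n * n)) * emb g = (\<Prod>c<n * n. D s c) * emb r"
    using CS.discriminant_divisible[OF frame_W[OF s] tr_center tr_add tr_smult \<rho>_permutes trace_form[OF s] u]
    unfolding det by blast
  obtain a where a: "(\<Prod>c<n * n. D s c) = emb (C [:a:]) * emb T ^ (n * (n - 1)) * emb (V s) ^ (n * (n - 1))"
    using prod_D by blast
  let ?r = "C [:a:] \<otimes>\<^bsub>W\<^esub> (V s [^]\<^bsub>W\<^esub> (n * (n - 1)) \<otimes>\<^bsub>W\<^esub> r)"
  have rZ: "?r \<in> Z"
    using r(1) by (intro Z_mult_closed C_center V_pow_center) simp_all
  have "emb (V s [^]\<^bsub>W\<^esub> (2 * (n * n)) \<otimes>\<^bsub>W\<^esub> g) = emb (V s) ^ (2 * (n * n)) * emb g"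
    using gZ by (simp add: emb_mult_Z V_pow_center emb_pow V_center)
  also have "\<dots> = emb (discr \<otimes>\<^bsub>W\<^esub> ?r)"
    unfolding r(2) a discr_def
    using r(1) by (simp add: emb_mult_Z Z_mult_closed Z_pow_closed C_center V_center T_center emb_pow mult_ac)
  finally have "V s [^]\<^bsub>W\<^esub> (2 * (n * n)) \<otimes>\<^bsub>W\<^esub> g = discr \<otimes>\<^bsub>W\<^esub> ?r"
    by (rule emb_inj[OF Z_closed[OF Z_mult_closed[OF V_pow_center gZ]]
          Z_closed[OF Z_mult_closed[OF discr_center rZ]]])
  with rZ show ?thesis by blast
qed

text \<open>For powers \<open>x\<close> of \<open>X\<close> and \<open>y\<close> of
  \<open>Y\<close>, the equations \<open>x g = discr a\<close> and \<open>y g = discr b\<close> give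
  \<open>y a = x b\<close>. By regularity \<open>a = x c\<close>, and cancelling \<open>x\<close>
  leaves \<open>g = discr c\<close>.\<close>

lemma gens_divisible:
  assumes g: "g \<in> gens"
  shows "\<exists>z\<in>Z. g = discr \<otimes>\<^bsub>W\<^esub> z"
proof -
  have gZ: "g \<in> Z"
    using g by (simp add: gens_def)
  let ?N = "2 * (n * n)"
  let ?x = "V 1 [^]\<^bsub>W\<^esub> ?N" and ?y = "V (- 1) [^]\<^bsub>W\<^esub> ?N"
  obtain a where a: "a \<in> Z" "?x \<otimes>\<^bsub>W\<^esub> g = discr \<otimes>\<^bsub>W\<^esub> a"
    using gens_multiple[OF g, of 1] by auto
  obtain b where b: "b \<in> Z" "?y \<otimes>\<^bsub>W\<^esub> g = discr \<otimes>\<^bsub>W\<^esub> b"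
    using gens_multiple[OF g, of "- 1"] by auto
  have nz: "emb discr \<noteq> 0" "emb ?x \<noteq> 0"
    by (simp_all only: emb_eq_0_iff discr_center V_pow_center discr_nonzero V_pow_nonzero not_False_eq_True)
  have ea: "emb ?x * emb g = emb discr * emb a" and eb: "emb ?y * emb g = emb discr * emb b"
    using arg_cong[OF a(2), of emb] arg_cong[OF b(2), of emb] a(1) b(1) gZ
    by (simp_all only: emb_mult_Z V_pow_center discr_center)
  have "emb discr * (emb ?y * emb a) = emb ?y * (emb ?x * emb g)"
    unfolding ea by (simp only: mult_ac)
  also have "\<dots> = emb ?x * (emb ?y * emb g)"
    by (simp only: mult_ac)
  also have "\<dots> = emb discr * (emb ?x * emb b)"
    unfolding eb by (simp only: mult_ac)
  finally have "emb ?y * emb a = emb ?x * emb b"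
    using nz by simp
  then have "emb (?y \<otimes>\<^bsub>W\<^esub> a) = emb (?x \<otimes>\<^bsub>W\<^esub> b)"
    using a(1) b(1) by (simp only: emb_mult_Z V_pow_center)
  then have "?y \<otimes>\<^bsub>W\<^esub> a = ?x \<otimes>\<^bsub>W\<^esub> b"
    using a(1) b(1) by (intro emb_inj Z_closed Z_mult_closed V_pow_center)
  then obtain c where c: "c \<in> Z" "a = ?x \<otimes>\<^bsub>W\<^esub> c"
    using V_regular[of a b ?N ?N] a(1) b(1) Z_closed by blast
  have "emb ?x * emb g = emb ?x * (emb discr * emb c)"
    unfolding ea c(2) using c(1) by (simp only: emb_mult_Z V_pow_center mult_ac)
  then have "emb g = emb (discr \<otimes>\<^bsub>W\<^esub> c)"
    using nz c(1) by (simp add: emb_mult_Z discr_center)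
  then have "g = discr \<otimes>\<^bsub>W\<^esub> c"
    using gZ c(1) by (intro emb_inj Z_closed Z_mult_closed discr_center)
  with c(1) show ?thesis by blast
qed

lemma gens_sub: "gens \<subseteq> Z"
  by (auto simp: gens_def)

lemma I_ideal: "ideal I ZR"
  unfolding I_eq by (rule CS.Z.genideal_ideal) (use gens_sub in simp)

lemma I_sub_Z: "I \<subseteq> Z"
  using ideal.Icarr[OF I_ideal] by auto

lemma I_divisible:
  assumes "x \<in> I"
  shows "\<exists>z\<in>Z. x = discr \<otimes>\<^bsub>W\<^esub> z"
proof -
  have "ideal (cgenideal ZR discr) ZR"
    by (rule CS.Z.cgenideal_ideal) (simp add: discr_center)
  moreover have "gens \<subseteq> cgenideal ZR discr"
  proof
    fix g assume "g \<in> gens"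
    then obtain z where "z \<in> Z" "g = discr \<otimes>\<^bsub>W\<^esub> z"
      using gens_divisible by blast
    then show "g \<in> cgenideal ZR discr"
      using Z_commute[OF discr_center Z_closed] by (auto simp: cgenideal_def)
  qed
  ultimately have "I \<subseteq> cgenideal ZR discr"
    unfolding I_eq by (rule CS.Z.genideal_minimal)
  with assms obtain z where "z \<in> Z" "x = z \<otimes>\<^bsub>W\<^esub> discr"
    by (auto simp: cgenideal_def)
  then show ?thesis
    using Z_commute[OF discr_center Z_closed] by auto
qed

text \<open>The discriminant of the frame is a generator of the ideal, and it is this element times
  a nonzero constant, which is a unit of \<open>Z\<close>.\<close>

lemma V_discr_in_I:
  assumes s: "s = 1 \<or> s = - 1"
  shows "V s [^]\<^bsub>W\<^esub> (n * (n - 1)) \<otimes>\<^bsub>W\<^esub> discr \<in> I"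
proof -
  let ?m = "n * (n - 1)"
  obtain a where a: "a \<noteq> 0" "(\<Prod>c<n * n. D s c) = emb (C [:a:]) * emb T ^ ?m * emb (V s) ^ ?m"
    using prod_D by blast
  let ?v = "V s [^]\<^bsub>W\<^esub> ?m \<otimes>\<^bsub>W\<^esub> discr"
  have v: "?v \<in> Z"
    by (intro Z_mult_closed V_pow_center discr_center)
  let ?g = "C [:a:] \<otimes>\<^bsub>W\<^esub> ?v"
  have gZ: "?g \<in> Z"
    by (rule Z_mult_closed[OF C_center v]) simp
  have "emb ?g = (\<Prod>c<n * n. D s c)"
    unfolding a(2) using v
    by (simp add: emb_mult_Z C_center V_pow_center discr_center emb_pow V_center) (simp add: discr_def emb_pow T_center)
  moreover obtain u u' where "u \<in> {..<n * n} \<rightarrow> carrier W" "inj_on u {..<n * n}"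
    "u' \<in> {..<n * n} \<rightarrow> carrier W" "inj_on u' {..<n * n}"
    "(\<Prod>c<n * n. D s c) = det (mat (n * n) (n * n) (\<lambda>(i, j). emb (tr (u i \<otimes>\<^bsub>W\<^esub> u' j))))"
    using CS.frame_discriminant[OF frame_W[OF s] tr_center tr_add tr_smult \<rho>_permutes trace_form[OF s]] by blast
  ultimately have "?g \<in> gens"
    unfolding gens_def using gZ by auto
  then have "?g \<in> I"
    unfolding I_eq using CS.Z.genideal_self[of gens] gens_sub by auto
  moreover have "C [:inverse a:] \<in> Z"
    by (rule C_center) simp
  ultimately have "C [:inverse a:] \<otimes>\<^bsub>W\<^esub> ?g \<in> I"
    using ideal.I_l_closed[OF I_ideal, of ?g "C [:inverse a:]"] by simp
  also have "C [:inverse a:] \<otimes>\<^bsub>W\<^esub> ?g = C 1 \<otimes>\<^bsub>W\<^esub> ?v"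
    using a(1) Z_closed[OF v] W.m_assoc[of "C [:inverse a:]" "C [:a:]" ?v] by (simp add: C_mult one_pCons)
  finally show ?thesis
    using Z_closed[OF v] by (simp add: C_1)
qed

section \<open>Primeness, finite generation and integrality of the trace\<close>

lemma prime_W: "prime_ring W"
  unfolding prime_ring_def
proof (intro conjI ballI impI)
  show "\<one>\<^bsub>W\<^esub> \<noteq> \<zero>\<^bsub>W\<^esub>"
    using subdomain_Z by (rule subdomain.sub_one_not_zero)
  fix a b assume ab: "a \<in> carrier W" "b \<in> carrier W" "\<forall>x\<in>carrier W. a \<otimes>\<^bsub>W\<^esub> x \<otimes>\<^bsub>W\<^esub> b = \<zero>\<^bsub>W\<^esub>"
  then have "a \<otimes>\<^bsub>W\<^esub> b = \<zero>\<^bsub>W\<^esub>"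
    using W.one_closed by (metis W.r_one)
  with ab show "a = \<zero>\<^bsub>W\<^esub> \<or> b = \<zero>\<^bsub>W\<^esub>"
    using W_integral by blast
qed (rule W.ring_axioms)

text \<open>Divide the exponent by \<open>n\<close> with remainder \<open>j\<close> and split
  \<open>r\<close> into its parts. Each part times the power \<open>s n l\<close> is central, and
  what remains is the basis element \<open>t^i\<close> times the power \<open>s j\<close>.\<close>

lemma monomial_in_span:
  assumes k: "k = s * (int n * int l + int j)" and s: "s = 1 \<or> s = - 1" and j: "j < n"
    and N: "submodule ZR N (mult_module W)" "\<And>c. c < n * n \<Longrightarrow> e s c \<in> N"
  shows "C r \<otimes>\<^bsub>W\<^esub> mon k \<in> N"
proof -
  interpret N: submodule ZR N "mult_module W" by fact
  let ?z = "\<lambda>i. C (part i r) \<otimes>\<^bsub>W\<^esub> mon (s * (int n * int l))"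
  have z: "?z i \<in> Z" for i
    unfolding center_iff by (auto simp: cf_monomial inv_poly_p)
  have less: "i + n * j < n * n" if "i < n" for i
  proof -
    have "i + n * j < n * Suc j" using that by simp
    also have "\<dots> \<le> n * n" using j by (intro mult_le_mono2) simp
    finally show ?thesis .
  qed
  have "(\<Oplus>\<^bsub>mult_module W\<^esub>i\<in>{..<n}. ?z i \<otimes>\<^bsub>W\<^esub> e s (i + n * j)) \<in> N"
  proof (rule submodule_finsum[OF N(1)])
    show "(\<lambda>i. ?z i \<otimes>\<^bsub>W\<^esub> e s (i + n * j)) \<in> {..<n} \<rightarrow> N"
      using N.smult_closed[OF _ N(2)[OF less]] z by simp
  qed simp
  also have "(\<Oplus>\<^bsub>mult_module W\<^esub>i\<in>{..<n}. ?z i \<otimes>\<^bsub>W\<^esub> e s (i + n * j)) = C r \<otimes>\<^bsub>W\<^esub> mon k"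
    unfolding finsum_mult_module
  proof (rule W_eqI)
    show "(\<Oplus>\<^bsub>W\<^esub>i\<in>{..<n}. ?z i \<otimes>\<^bsub>W\<^esub> e s (i + n * j)) \<in> carrier W"
      by (intro W.finsum_closed) auto
    fix m
    have pk: "p (s * (int n * int l)) * p (s * int j) = p k"
      using s p_add[of "- (int n * int l)" "- int j"] by (auto simp: k algebra_simps)
    have "cf (\<Oplus>\<^bsub>W\<^esub>i\<in>{..<n}. ?z i \<otimes>\<^bsub>W\<^esub> e s (i + n * j)) m = (\<Sum>i<n. cf (?z i \<otimes>\<^bsub>W\<^esub> e s (i + n * j)) m)"
      by (intro cf_finsum) auto
    also have "\<dots> = (\<Sum>i<n. if m = k then p k * (part i r * monom 1 i) else 0)"
    proof (rule sum.cong[OF HOL.refl])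
      fix i assume "i \<in> {..<n}"
      then have "cf (?z i \<otimes>\<^bsub>W\<^esub> e s (i + n * j)) m = part i r * p (s * (int n * int l))
          * (if m - s * (int n * int l) = s * int j then monom 1 i * p (s * int j) else 0)"
        unfolding cf_monomial_mult[OF e_closed] by (simp add: cf_e)
      also have "\<dots> = (if m = k then p k * (part i r * monom 1 i) else 0)"
        unfolding pk[symmetric] by (auto simp: k algebra_simps)
      finally show "cf (?z i \<otimes>\<^bsub>W\<^esub> e s (i + n * j)) m = (if m = k then p k * (part i r * monom 1 i) else 0)" .
    qed
    also have "\<dots> = (if m = k then r * p k else 0)"
    proof -
      have "(\<Sum>i<n. p k * (part i r * monom 1 i)) = r * p k"
        unfolding sum_distrib_left[symmetric] sum_part by (rule mult.commute)
      then show ?thesis by simp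
    qed
    finally show "cf (\<Oplus>\<^bsub>W\<^esub>i\<in>{..<n}. ?z i \<otimes>\<^bsub>W\<^esub> e s (i + n * j)) m = cf (C r \<otimes>\<^bsub>W\<^esub> mon k) m"
      by (simp add: cf_monomial)
  qed simp
  finally show ?thesis .
qed

text \<open>The bases of both frames together generate: nonnegative exponents come from the powers
  of \<open>x\<close>, negative ones from the powers of \<open>y\<close>.\<close>

lemma finitely_generated:
  "\<exists>S. finite S \<and> S \<subseteq> carrier W \<and> module.span ZR (mult_module W) S = carrier W"
proof (intro exI conjI)
  let ?S = "e 1 ` {..<n * n} \<union> e (- 1) ` {..<n * n}"
  show sub: "?S \<subseteq> carrier W" by auto
  let ?N = "CS.ZM.span ?S"
  have N: "submodule ZR ?N (mult_module W)"
    by (rule CS.ZM.span_is_submodule) (use sub in simp)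
  interpret N: submodule ZR ?N "mult_module W" by fact
  have S: "?S \<subseteq> ?N"
    by (rule CS.ZM.in_own_span) (use sub in simp)
  have mono: "C r \<otimes>\<^bsub>W\<^esub> mon k \<in> ?N" for r k
  proof (cases "k \<ge> 0")
    case True
    then have k: "k = 1 * (int n * int (nat k div n) + int (nat k mod n))"
      by (simp flip: of_nat_mult of_nat_add)
    show ?thesis
      by (rule monomial_in_span[OF k _ _ N]) (use n S in auto)
  next
    case False
    then have k: "k = - 1 * (int n * int (nat (- k) div n) + int (nat (- k) mod n))"
      by (simp flip: of_nat_mult of_nat_add)
    show ?thesis
      by (rule monomial_in_span[OF k _ _ N]) (use n S in auto)
  qed
  have "w \<in> ?N" if w: "w \<in> carrier W" for w
  proof -
    obtain a where a: "finite {k. a k \<noteq> 0}" "w = comb a"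
      using w by (rule W_combE)
    have "finsum (mult_module W) (\<lambda>k. C (a k) \<otimes>\<^bsub>W\<^esub> mon k) {k. a k \<noteq> 0} \<in> ?N"
      by (rule submodule_finsum[OF N a(1)]) (use mono in auto)
    then show ?thesis
      by (simp add: a(2) comb_def finsum_mult_module)
  qed
  then show "?N = carrier W"
    using N.subset by auto
qed simp

lemma setting: "discriminant_setting W Z"
  unfolding discriminant_setting_def
proof (intro conjI ballI)
  fix b assume b: "b \<in> carrier W"
  have "reg_trace W Z b = fraction ZR (tr b) \<one>\<^bsub>W\<^esub>"
    using CS.reg_trace_eq[where \<tau> = tr, OF frame_W[of 1] tr_center trace_W[of 1] b] by simp
  then show "\<exists>r\<in>Z. reg_trace W Z b = fraction ZR r \<one>\<^bsub>W\<^esub>"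
    using tr_center[OF b] by blast
qed (simp_all add: prime_W subdomain_Z finitely_generated)

section \<open>Reflexivity and reflexive hulls\<close>

lemma reflexive_Z: "reflexive_module ZR (mult_module ZR)"
proof (rule module.reflexive_if_two_frames[OF CS.Z.module_mult_module domain_Z])
  interpret Z: domain ZR by (rule domain_Z)
  show "frame ZR (mult_module ZR) 1 (V 1) (\<lambda>_. \<one>\<^bsub>ZR\<^esub>) (\<lambda>_. \<lambda>x\<in>carrier ZR. V 1 \<otimes>\<^bsub>ZR\<^esub> x)"
    "frame ZR (mult_module ZR) 1 (V (- 1)) (\<lambda>_. \<one>\<^bsub>ZR\<^esub>) (\<lambda>_. \<lambda>x\<in>carrier ZR. V (- 1) \<otimes>\<^bsub>ZR\<^esub> x)"
    using Z.mult_module_frame[of "V 1"] Z.mult_module_frame[of "V (- 1)"]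
      V_center[of 1] V_center[of "- 1"] V_nonzero[of 1] V_nonzero[of "- 1"] by simp_all
  show "m = \<zero>\<^bsub>mult_module ZR\<^esub>"
    if "m \<in> carrier (mult_module ZR)" "V 1 \<odot>\<^bsub>mult_module ZR\<^esub> m = \<zero>\<^bsub>mult_module ZR\<^esub>" for m
    using that W_integral[of "V 1" m] V_nonzero[of 1] Z_closed by auto
  show "\<exists>c\<in>carrier (mult_module ZR). a = V 1 \<odot>\<^bsub>mult_module ZR\<^esub> c"
    if "a \<in> carrier (mult_module ZR)" "b \<in> carrier (mult_module ZR)"
      "V (- 1) \<odot>\<^bsub>mult_module ZR\<^esub> a = V 1 \<odot>\<^bsub>mult_module ZR\<^esub> b" for a b
    using that V_regular[of a b 1 1] Z_closed by auto
qed

lemma reflexive_W: "reflexive_module ZR (mult_module W)"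
proof (rule module.reflexive_if_two_frames[OF CS.ZM.module_axioms domain_Z frame_W[of 1] frame_W[of "- 1"]])
  show "m = \<zero>\<^bsub>mult_module W\<^esub>"
    if "m \<in> carrier (mult_module W)" "V 1 \<odot>\<^bsub>mult_module W\<^esub> m = \<zero>\<^bsub>mult_module W\<^esub>" for m
    using that W_integral[of "V 1" m] V_nonzero[of 1] by auto
  show "\<exists>c\<in>carrier (mult_module W). a = V 1 \<odot>\<^bsub>mult_module W\<^esub> c"
    if "a \<in> carrier (mult_module W)" "b \<in> carrier (mult_module W)"
      "V (- 1) \<odot>\<^bsub>mult_module W\<^esub> a = V 1 \<odot>\<^bsub>mult_module W\<^esub> b" for a b
    using that V_regular[of a b 1 1] by auto
qed simp_all

text \<open>The exponent is the one with which \<open>V s\<close> occurs in the discriminant of its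
  frame, so that \<open>discr\<close> times either power lies in the discriminant ideal.\<close>

abbreviation "vx \<equiv> V 1 [^]\<^bsub>W\<^esub> (n * (n - 1))"
abbreviation "vy \<equiv> V (- 1) [^]\<^bsub>W\<^esub> (n * (n - 1))"

lemma vx_vy: "vx \<in> Z" "vx \<noteq> \<zero>\<^bsub>W\<^esub>" "vy \<in> Z"
  by (rule V_pow_center V_pow_nonzero)+

lemma Z_regular:
  "\<lbrakk>a \<in> Z; b \<in> Z; vy \<otimes>\<^bsub>W\<^esub> a = vx \<otimes>\<^bsub>W\<^esub> b\<rbrakk> \<Longrightarrow> \<exists>c\<in>Z. a = vx \<otimes>\<^bsub>W\<^esub> c"
  using V_regular[of a b] Z_closed by blast

lemma I_scaled: "z \<in> Z \<Longrightarrow> V s [^]\<^bsub>W\<^esub> (n * (n - 1)) \<otimes>\<^bsub>W\<^esub> (discr \<otimes>\<^bsub>W\<^esub> z) \<in> I" if s: "s = 1 \<or> s = - 1"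
  using ideal.I_r_closed[OF I_ideal V_discr_in_I[OF s], of z] W.m_assoc[of "V s [^]\<^bsub>W\<^esub> (n * (n - 1))" discr z]
    Z_closed discr_center by simp

lemma bidual_Z: "bidual_in ZR (mult_module ZR) I = {discr \<otimes>\<^bsub>W\<^esub> z | z. z \<in> Z}"
proof -
  interpret IM: module ZR "mult_module ZR" by (rule CS.Z.module_mult_module)
  interpret Ii: ideal I ZR by (rule I_ideal)
  have "submodule ZR I (mult_module ZR)"
  proof
    show "I \<subseteq> carrier (mult_module ZR)"
      using I_sub_Z by simp
    show "v \<oplus>\<^bsub>mult_module ZR\<^esub> w \<in> I" if "v \<in> I" "w \<in> I" for v w
      using Ii.a_closed[OF that] by simp
    show "\<zero>\<^bsub>mult_module ZR\<^esub> \<in> I"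
      using Ii.zero_closed by simp
    show "c \<odot>\<^bsub>mult_module ZR\<^esub> v \<in> I" if "c \<in> carrier ZR" "v \<in> I" for c v
      using Ii.I_l_closed[OF that(2,1)] by simp
  qed
  then have "bidual_in ZR (mult_module ZR) I = {discr \<odot>\<^bsub>mult_module ZR\<^esub> m | m. m \<in> carrier (mult_module ZR)}"
  proof (rule IM.bidual_in_eq_scaled[OF domain_Z reflexive_Z, where p = vx and q = vy])
    show "x \<in> I \<Longrightarrow> \<exists>m\<in>carrier (mult_module ZR). x = discr \<odot>\<^bsub>mult_module ZR\<^esub> m" for x
      using I_divisible by simp
    show "m = m'" if "m \<in> carrier (mult_module ZR)" "m' \<in> carrier (mult_module ZR)"
      "discr \<odot>\<^bsub>mult_module ZR\<^esub> m = discr \<odot>\<^bsub>mult_module ZR\<^esub> m'" for m m'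
      using that W_cancel[OF Z_closed[OF discr_center] discr_nonzero] Z_closed by simp
    show "\<exists>c\<in>carrier ZR. a = vx \<otimes>\<^bsub>ZR\<^esub> c"
      if "a \<in> carrier ZR" "b \<in> carrier ZR" "vy \<otimes>\<^bsub>ZR\<^esub> a = vx \<otimes>\<^bsub>ZR\<^esub> b" for a b
      using that Z_regular by simp
  qed (use discr_center vx_vy I_scaled[of 1] I_scaled[of "- 1"] in simp_all)
  then show ?thesis by simp
qed

lemma bidual_W:
  "bidual_in ZR (mult_module W) (ideal_prod W I (carrier W)) = {discr \<otimes>\<^bsub>W\<^esub> w | w. w \<in> carrier W}"
proof -
  interpret Ii: ideal I ZR by (rule I_ideal)
  let ?N = "ideal_prod W I (carrier W)"
  have I_carr: "x \<in> carrier W" if "x \<in> I" for x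
    using that I_sub_Z Z_closed by blast
  have N_sub: "\<exists>w\<in>carrier W. x = discr \<otimes>\<^bsub>W\<^esub> w" if "x \<in> ?N" for x
    using that
  proof induction
    case (prod i w)
    then obtain z where "z \<in> Z" "i = discr \<otimes>\<^bsub>W\<^esub> z"
      using I_divisible by blast
    then show ?case
      using prod Z_closed discr_center by (intro bexI[of _ "z \<otimes>\<^bsub>W\<^esub> w"]) (simp_all add: W.m_assoc)
  next
    case (sum x y)
    then obtain a b where "a \<in> carrier W" "b \<in> carrier W" "x = discr \<otimes>\<^bsub>W\<^esub> a" "y = discr \<otimes>\<^bsub>W\<^esub> b"
      by blast
    then show ?case
      using Z_closed[OF discr_center] by (intro bexI[of _ "a \<oplus>\<^bsub>W\<^esub> b"]) (simp_all add: W.r_distr)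
  qed
  have N_carr: "x \<in> carrier W" if "x \<in> ?N" for x
    using N_sub[OF that] Z_closed[OF discr_center] by auto
  have N_sup: "V s [^]\<^bsub>W\<^esub> (n * (n - 1)) \<otimes>\<^bsub>W\<^esub> (discr \<otimes>\<^bsub>W\<^esub> w) \<in> ?N"
    if s: "s = 1 \<or> s = - 1" and w: "w \<in> carrier W" for s w
    using ideal_prod.prod[OF V_discr_in_I[OF s] w, of W] Z_closed[OF discr_center] w by (simp add: W.m_assoc)
  have smult: "z \<otimes>\<^bsub>W\<^esub> x \<in> ?N" if x: "x \<in> ?N" and z: "z \<in> Z" for z x
    using x
  proof induction
    case (prod i w)
    have "z \<otimes>\<^bsub>W\<^esub> i \<in> I"
      using Ii.I_l_closed[OF prod(1), of z] z by simp
    from ideal_prod.prod[OF this prod(2), of W] show ?case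
      using prod I_carr Z_closed[OF z] by (simp add: W.m_assoc)
  next
    case (sum x y)
    then show ?case
      using ideal_prod.sum[OF sum.IH] N_carr Z_closed[OF z] by (simp add: W.r_distr)
  qed
  have "submodule ZR ?N (mult_module W)"
  proof
    show "?N \<subseteq> carrier (mult_module W)"
      using N_carr by auto
    show "v \<oplus>\<^bsub>mult_module W\<^esub> w \<in> ?N" if "v \<in> ?N" "w \<in> ?N" for v w
      using ideal_prod.sum[OF that] by simp
    show "\<zero>\<^bsub>mult_module W\<^esub> \<in> ?N"
      using ideal_prod.prod[OF Ii.zero_closed W.zero_closed, of W] by simp
    show "c \<odot>\<^bsub>mult_module W\<^esub> v \<in> ?N" if "c \<in> carrier ZR" "v \<in> ?N" for c v
      using smult that by simp
  qed
  then have "bidual_in ZR (mult_module W) ?N = {discr \<odot>\<^bsub>mult_module W\<^esub> m | m. m \<in> carrier (mult_module W)}"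
  proof (rule CS.ZM.bidual_in_eq_scaled[OF domain_Z reflexive_W, where p = vx and q = vy])
    show "x \<in> ?N \<Longrightarrow> \<exists>m\<in>carrier (mult_module W). x = discr \<odot>\<^bsub>mult_module W\<^esub> m" for x
      using N_sub by simp
    show "m = m'" if "m \<in> carrier (mult_module W)" "m' \<in> carrier (mult_module W)"
      "discr \<odot>\<^bsub>mult_module W\<^esub> m = discr \<odot>\<^bsub>mult_module W\<^esub> m'" for m m'
      using that W_cancel[OF Z_closed[OF discr_center] discr_nonzero] by simp
    show "\<exists>c\<in>carrier ZR. a = vx \<otimes>\<^bsub>ZR\<^esub> c"
      if "a \<in> carrier ZR" "b \<in> carrier ZR" "vy \<otimes>\<^bsub>ZR\<^esub> a = vx \<otimes>\<^bsub>ZR\<^esub> b" for a b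
      using that Z_regular by simp
  qed (use discr_center vx_vy N_sup[of 1] N_sup[of "- 1"] in simp_all)
  then show ?thesis by simp
qed

section \<open>Existence and uniqueness of the discriminants\<close>

lemma cgenideal_discr: "cgenideal ZR discr = {discr \<otimes>\<^bsub>W\<^esub> z | z. z \<in> Z}"
  unfolding cgenideal_def using Z_commute[OF discr_center Z_closed] by simp metis

lemma l_coset_eq: "d <#\<^bsub>W\<^esub> carrier W = {d \<otimes>\<^bsub>W\<^esub> w | w. w \<in> carrier W}"
  and r_coset_eq: "carrier W #>\<^bsub>W\<^esub> d = {w \<otimes>\<^bsub>W\<^esub> d | w. w \<in> carrier W}"
  by (auto simp: l_coset_def r_coset_def)

lemma R_discriminant_discr: "R_discriminant W Z discr"
  by (simp add: R_discriminant_def setting discr_center bidual_Z cgenideal_discr)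

lemma R_discriminant_unique:
  assumes "R_discriminant W Z d"
  shows "eq_up_to_unit ZR d discr"
proof -
  have d: "d \<in> Z" and eq: "cgenideal ZR d = cgenideal ZR discr"
    using assms by (simp_all add: R_discriminant_def bidual_Z cgenideal_discr)
  have "d \<in> cgenideal ZR discr" "discr \<in> cgenideal ZR d"
    using CS.Z.cgenideal_self[of d] CS.Z.cgenideal_self[of discr] d discr_center eq by auto
  then obtain x y where x: "x \<in> Z" "d = x \<otimes>\<^bsub>W\<^esub> discr" and y: "y \<in> Z" "discr = y \<otimes>\<^bsub>W\<^esub> d"
    by (auto simp: cgenideal_def)
  have "emb discr = emb y * emb x * emb discr"
    using arg_cong[OF y(2), of emb] arg_cong[OF x(2), of emb] x(1) y(1) d discr_center
    by (simp add: emb_mult_Z)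
  then have "emb (y \<otimes>\<^bsub>W\<^esub> x) = emb \<one>\<^bsub>W\<^esub>"
    using x(1) y(1) discr_nonzero discr_center by (simp add: emb_mult_Z emb_one emb_eq_0_iff)
  then have yx: "y \<otimes>\<^bsub>W\<^esub> x = \<one>\<^bsub>W\<^esub>"
    using x(1) y(1) Z_closed by (intro emb_inj) auto
  then have "x \<otimes>\<^bsub>W\<^esub> y = \<one>\<^bsub>W\<^esub>"
    using Z_commute[OF y(1) Z_closed[OF x(1)]] by simp
  with yx x y have "x \<in> Units ZR"
    by (auto simp: Units_def)
  then show ?thesis
    using x(2) by (auto simp: eq_up_to_unit_def)
qed

lemma R_bar_discriminant_discr: "R_bar_discriminant W Z discr"
proof -
  have "discr <#\<^bsub>W\<^esub> carrier W = carrier W #>\<^bsub>W\<^esub> discr"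
    unfolding l_coset_eq r_coset_eq using Z_commute[OF discr_center] by metis
  then show ?thesis
    by (simp add: R_bar_discriminant_def setting reflexive_W bidual_W Z_closed discr_center l_coset_eq)
qed

text \<open>Equality of right ideals gives \<open>d = discr b\<close>, and normality of
  \<open>d\<close> turns the opposite inclusion into \<open>discr = c d\<close>. Centrality of
  \<open>discr\<close> then yields \<open>c b = 1\<close>, and \<open>b c = 1\<close> follows by
  cancelling \<open>c\<close>, which is nonzero.\<close>

lemma R_bar_discriminant_unique:
  assumes "R_bar_discriminant W Z d"
  shows "eq_up_to_unit W d discr"
proof -
  note discrW = Z_closed[OF discr_center]
  have d: "d \<in> carrier W" and normal: "d <#\<^bsub>W\<^esub> carrier W = carrier W #>\<^bsub>W\<^esub> d"
    and eq: "d <#\<^bsub>W\<^esub> carrier W = {discr \<otimes>\<^bsub>W\<^esub> w | w. w \<in> carrier W}"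
    using assms by (simp_all add: R_bar_discriminant_def bidual_W)
  have "d \<in> d <#\<^bsub>W\<^esub> carrier W"
    unfolding l_coset_eq using d W.one_closed W.r_one by blast
  then obtain b where b: "b \<in> carrier W" "d = discr \<otimes>\<^bsub>W\<^esub> b"
    unfolding eq by blast
  have "discr \<in> carrier W #>\<^bsub>W\<^esub> d"
    unfolding normal[symmetric] eq using discrW W.one_closed W.r_one by blast
  then obtain c where c: "c \<in> carrier W" "discr = c \<otimes>\<^bsub>W\<^esub> d"
    unfolding r_coset_eq by blast
  have d': "d = b \<otimes>\<^bsub>W\<^esub> discr"
    using b Z_commute[OF discr_center b(1)] by simp
  have "discr \<otimes>\<^bsub>W\<^esub> (c \<otimes>\<^bsub>W\<^esub> b) = c \<otimes>\<^bsub>W\<^esub> b \<otimes>\<^bsub>W\<^esub> discr"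
    using Z_commute[OF discr_center, of "c \<otimes>\<^bsub>W\<^esub> b"] b(1) c(1) by simp
  also have "\<dots> = c \<otimes>\<^bsub>W\<^esub> d"
    unfolding d' by (rule W.m_assoc[OF c(1) b(1) discrW])
  also have "\<dots> = discr \<otimes>\<^bsub>W\<^esub> \<one>\<^bsub>W\<^esub>"
    by (simp only: c(2)[symmetric] W.r_one[OF discrW])
  finally have *: "discr \<otimes>\<^bsub>W\<^esub> (c \<otimes>\<^bsub>W\<^esub> b) = discr \<otimes>\<^bsub>W\<^esub> \<one>\<^bsub>W\<^esub>" .
  have cb: "c \<otimes>\<^bsub>W\<^esub> b = \<one>\<^bsub>W\<^esub>"
    by (rule W_cancel[OF discrW discr_nonzero _ _ *]) (simp_all add: b(1) c(1))
  have "b \<otimes>\<^bsub>W\<^esub> c = \<one>\<^bsub>W\<^esub>"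
  proof (rule W_cancel[of c])
    have "c \<otimes>\<^bsub>W\<^esub> (b \<otimes>\<^bsub>W\<^esub> c) = (c \<otimes>\<^bsub>W\<^esub> b) \<otimes>\<^bsub>W\<^esub> c"
      using b(1) c(1) by (simp add: W.m_assoc)
    then show "c \<otimes>\<^bsub>W\<^esub> (b \<otimes>\<^bsub>W\<^esub> c) = c \<otimes>\<^bsub>W\<^esub> \<one>\<^bsub>W\<^esub>"
      using c(1) by (simp add: cb)
    show "c \<noteq> \<zero>\<^bsub>W\<^esub>"
    proof
      assume c0: "c = \<zero>\<^bsub>W\<^esub>"
      have "discr = \<zero>\<^bsub>W\<^esub>"
        by (rule HOL.trans[OF c(2)]) (simp only: c0 W.l_null[OF d])
      with discr_nonzero show False ..
    qed
  qed (simp_all add: b(1) c(1))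
  with cb b(1) c(1) have "b \<in> Units W"
    by (auto simp: Units_def)
  then show ?thesis
    using d' by (auto simp: eq_up_to_unit_def)
qed

lemma discr_eq: "C [:0, 1:] [^]\<^bsub>W\<^esub> (n\<^sup>2 * (n - 1)) = discr"
proof -
  have "[:0, 1:] = (monom 1 1 :: 'a poly)"
    by (simp add: monom_altdef)
  then show ?thesis
    by (simp add: discr_def T_def C_pow monom_power power2_eq_square mult.assoc)
qed

end

text \<open>Translates the order of the automorphism, taken in the group of all bijections of
  \<open>k[t]\<close>, into a statement about powers of \<open>q\<close>.\<close>

lemma scale_var_pow:
  assumes "q \<noteq> 0"
  shows "scale_var q \<in> carrier (BijGroup UNIV)"
    and "scale_var q [^]\<^bsub>BijGroup UNIV\<^esub> (k::nat) = scale_var (q ^ k)"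
proof -
  have Bij: "scale_var a \<in> Bij UNIV" if "a \<noteq> 0" for a :: 'a
  proof -
    have "bij (scale_var a)"
      by (rule o_bij[of "scale_var (inverse a)"]) (use that in \<open>auto simp: fun_eq_iff\<close>)
    then show ?thesis
      by (simp add: Bij_def)
  qed
  then show "scale_var q \<in> carrier (BijGroup UNIV)"
    using assms by (simp add: BijGroup_def)
  show "scale_var q [^]\<^bsub>BijGroup UNIV\<^esub> k = scale_var (q ^ k)"
  proof (induction k)
    case 0
    show ?case by (rule ext) (simp add: BijGroup_def)
  next
    case (Suc k)
    have "scale_var q [^]\<^bsub>BijGroup UNIV\<^esub> Suc k = scale_var (q ^ k) \<otimes>\<^bsub>BijGroup UNIV\<^esub> scale_var q"
      by (simp only: nat_pow_Suc Suc.IH)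
    also have "\<dots> = compose UNIV (scale_var (q ^ k)) (scale_var q)"
      using Bij[of q] Bij[of "q ^ k"] assms by (simp add: BijGroup_def)
    also have "\<dots> = scale_var (q ^ Suc k)"
      by (rule ext) (simp add: compose_def mult.commute)
    finally show ?case .
  qed
qed

theorem theorem0p6:
  fixes q :: "'k::field" and \<sigma> :: "'k poly \<Rightarrow> 'k poly" and h :: "'k poly" and n :: nat
    and W :: "'k poly gwa_term set ring" and Z :: "'k poly gwa_term set set"
    and t :: "'k poly gwa_term set"
  assumes "quantum_automorphism q \<sigma>"
    and "h \<noteq> 0"
    and "n > 0" and "group.ord (BijGroup UNIV) \<sigma> = n"
    and "W = gwa \<sigma> h" and "Z = ring_center W"
    and "t = gwa_class \<sigma> h (Const [:0, 1:])"
  shows "(\<exists>d. R_discriminant W Z d)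
    \<and> (\<forall>d. R_discriminant W Z d \<longrightarrow>
          eq_up_to_unit (W\<lparr>carrier := Z\<rparr>) d (t [^]\<^bsub>W\<^esub> (n^2 * (n - 1))))
    \<and> (\<exists>d. R_bar_discriminant W Z d)
    \<and> (\<forall>d. R_bar_discriminant W Z d \<longrightarrow>
          eq_up_to_unit W d (t [^]\<^bsub>W\<^esub> (n^2 * (n - 1))))"
proof -
  have \<sigma>: "\<sigma> = scale_var q" and q: "q \<noteq> 0"
    using assms(1) by (rule quantum_automorphism_eq) (use assms(1) in \<open>simp add: quantum_automorphism_def\<close>)
  have "q ^ k = 1 \<longleftrightarrow> n dvd k" for k :: nat
  proof -
    have "n dvd k \<longleftrightarrow> scale_var q [^]\<^bsub>BijGroup UNIV\<^esub> k = \<one>\<^bsub>BijGroup UNIV\<^esub>"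
      using group.pow_eq_id[OF group_BijGroup scale_var_pow(1)[OF q], of k] assms(4) \<sigma> by simp
    also have "\<dots> \<longleftrightarrow> scale_var (q ^ k) = (\<lambda>f. f)"
      unfolding scale_var_pow(2)[OF q] by (simp add: BijGroup_def restrict_def)
    also have "\<dots> \<longleftrightarrow> q ^ k = 1"
    proof
      assume "scale_var (q ^ k) = (\<lambda>f. f)"
      \<comment> \<open>The image of \<open>t\<close> has linear coefficient
        \<open>q ^ k\<close>.\<close>
      then have "coeff (scale_var (q ^ k) [:0, 1:]) 1 = coeff [:0, 1:] 1"
        by simp
      then show "q ^ k = 1"
        by simp
    qed (simp add: fun_eq_iff)
    finally show ?thesis by simp
  qed
  then interpret finite_quantum_gwa q h n
    using q assms(2,3) by unfold_locales auto
  have W: "W = gwa (scale_var q) h" and t: "t = C [:0, 1:]"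
    using assms(5,7) \<sigma> by (simp_all add: C_def)
  show ?thesis
    unfolding assms(6) W t discr_eq
    using R_discriminant_discr R_discriminant_unique R_bar_discriminant_discr R_bar_discriminant_unique
    by blast
qed

end
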